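(* Consider the linear network model with latent agents, observed through the data $\{(p_O^{(t)},y_O^{(t)})\}_{t\in[n]}$, and suppose that the design is regular with respect to $(s_n,r_{1n})$ (in particular $H^{-1}$ admits an $(s_n,r_{1n})$-sparse approximation). Let $(\check v,\check W)$, $\hat\Psi$ and $\check W^\mu$ be the debiased estimator, the debiasing matrix and the thresholded estimator defined in the context. Then with probability at least $1-o(1)$ (as $n\to\infty$) the following hold. (i) Uniformly over $k\in V_O$, $$\sqrt n\,\{(-\check v_k,\check W_{k,\cdot})^T-(-v_k,H^{-1}_{k,\cdot})^T\}=-\hat\Psi\,\frac1{\sqrt n}\sum_{t=1}^n\varepsilon_k^{(t)}(1;p_O^{(t)})+R_n^k,$$ where $\|R_n^k\|_\infty=O\big(n^{-1/2}s_n\log|V_O|+r_{1n}\sqrt{\log|V_O|}\big)$. (ii) Let $C_1>0$ be a constant. If the thresholds satisfy $\mu_{kj}\ge 2|\check W_{kj}-(H^{-1})_{kj}|$ and $\mu_{kj}\le C_1\sqrt{\log|V_O|/n}$ for all $k,j\in V_O$, then $$\|\check W^\mu-H^{-1}\|_\infty\le s_nC_2\sqrt{\frac{\log|V_O|}{n}}+3r_{1n}\quad\text{and}\quad\|\check W^\mu-H^{-1}\|_1\le s_nC_2\sqrt{\frac{\log|V_O|}{n}}+3r_{1n}$$ for some constant $C_2>0$.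
   Context: **Asymptotics.** $n$ is the number of periods, $[n]=\{1,\dots,n\}$; limits are as $n\to\infty$. The network, its sizes, all model parameters, the data distribution, $s_n,r_{1n},M_\varepsilon,M_\Psi$ may depend on $n$. A "constant" is a number not depending on $n$ or on the network sizes. **Model.** $V=V_O\sqcup V_L$ is a finite set of agents (observable and latent), $G\in\mathbb R^{V\times V}$ the weights, $\Lambda=\mathrm{diag}(\lambda_i)_{i\in V}$, $M=\Lambda-G$. Outcomes in period $t$ are $y^{(t)}=M^{-1}(a+\xi^{(t)}-p^{(t)})$, with intercepts $a\in\mathbb R^V$, covariates $p^{(t)}\in\mathbb R^V$ and zero-mean shocks $\xi^{(t)}$, independent over $t$ (possibly correlated across agents). Latent covariates are fixed: $p^{(t)}_i=p_0$ for $i\in V_L$. Subscripts $O,L$ denote sub-vectors/blocks for $V_O,V_L$. Put $S_{OL}=M_{OL}M_{LL}^{-1}$, $H=M_{OO}-M_{OL}M_{LL}^{-1}M_{LO}$, $v_O=H^{-1}a_O-H^{-1}S_{OL}(a_L-p_L)$, $\varepsilon_O^{(t)}=H^{-1}\xi_O^{(t)}-H^{-1}S_{OL}\xi_L^{(t)}$, so that $$y_O^{(t)}=v_O-H^{-1}p_O^{(t)}+\varepsilon_O^{(t)}.\qquad( * )$$ Standing assumptions: $M,M_{LL},H$ are invertible; $\|M^{-1}\|_1$ and $\|M^{-1}\|_\infty$ are bounded by a constant; $|a_i|\le\bar a$, $|\lambda_i|\le\bar\lambda$, $|p_i^{(t)}|\le\bar p$ for all $i,t$ with constants $\bar a,\bar\lambda,\bar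 p$. Only $\{(p_O^{(t)},y_O^{(t)})\}$ is observed. **Norms and indices.** $\|A\|_1,\|A\|_\infty$ are the maximum absolute column and row sums; $A_{k,\cdot}$ and $A_{\cdot,k}$ the $k$th row and column. $\bar V_O=\{0\}\cup V_O$; $(1;p_O^{(t)})\in\mathbb R^{\bar V_O}$ has $0$th entry $1$ and $j$th entry $p_j^{(t)}$. $\mathbf 1_{kj}=1$ if $k=j$, else $0$. $\Phi$ is the standard normal CDF. **Sparse approximation.** A matrix is $s$-sparse if each row and each column has at most $s$ nonzero entries. $H^{-1}$ admits an $(s,r_1)$-sparse approximation if there is an $s$-sparse $\bar W$ with $\max\{\|H^{-1}-\bar W\|_1,\|H^{-1}-\bar W\|_\infty\}\le r_1$. **Regular design.** The design is regular with respect to $(s_n,r_{1n})$ if $H^{-1}$ admits an $(s_n,r_{1n})$-sparse approximation and, for constants $0<c<C$, $C'>0$ and parameters $M_\varepsilon,M_\Psi\ge1$: 1. the data $(p_O^{(t)},y_O^{(t)})$, $t\in[n]$, are i.i.d. and satisfy $( * )$, and $E[\varepsilon_O^{(t)}\mid p_O^{(t)}]=0$; 2. for all $t$: $\min_{j\in V_O}E[(\varepsilon_j^{(t)})^2\mid p_O^{(t)}]\ge c$, $\max_{j\in V_O}E[|\varepsilon_j^{(t)}|^4\mid p_O^{(t)}]\le C$, and $E[\max_{t\in[n],j\in V_O}|\varepsilon_j^{(t)}|^4\mid\{p_O^{(t)}\}]\le M_\varepsilon$; 3. $\bar\Psi:=E[(1;p_O^{(t)})(1;p_O^{(t)})^T]^{-1}$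 satisfies $\min_{k,j\in\bar V_O}E[\{\bar\Psi_{k,\cdot}(1;p_O^{(t)})(1;p_O^{(t)})_j-\mathbf 1_{kj}\}^2]\ge c$, $\max_{k,j\in\bar V_O}E[|\bar\Psi_{k,\cdot}(1;p_O^{(t)})(1;p_O^{(t)})_j|^4]\le C$, $E[\max_{t\in[n];j,k\in\bar V_O}|\bar\Psi_{k,\cdot}(1;p_O^{(t)})(1;p_O^{(t)})_j|^4]\le M_\Psi$, and the eigenvalues of $\bar\Psi$ are bounded above by a constant; 4. $s_n^2(\log|V_O|)(\log n)^3=o(n)$, $M_\varepsilon M_\Psi\log|V_O|=o(n)$, $C'\log|V_O|\ge\log n$. **Estimators.** Put $M_n^2=1\vee\max_{k\in V_O}\frac1n\sum_t(p_k^{(t)})^4$, $\tau=\frac1{4M_n}$, $\lambda=\frac1{\sqrt n}\Phi^{-1}\big(1-\frac1{3n|V_O|^2}\big)$, $\hat\Sigma=\frac1n\sum_t(1;p_O^{(t)})(1;p_O^{(t)})^T$. Step 1: $(\hat W,\hat v,\hat z)$ minimizes $\sum_{k\in V_O}\big(\|(\tilde v_k,\tilde W_{k,\cdot})\|_1+\tau z_k\big)$ over $(\tilde W,\tilde v,z)$ subject to, for all $k\in V_O$, $j\in\bar V_O$: $\big|\frac1n\sum_t\{y_k^{(t)}-(\tilde v_k-\tilde W_{k,\cdot}p_O^{(t)})\}(1;p_O^{(t)})_j\big|\le\lambda z_k$ and $\big\{\frac1n\sum_t\{y_k^{(t)}-(\tilde v_k-\tilde W_{k,\cdot}p_O^{(t)})\}^2(1;p_O^{(t)})_j^2\big\}^{1/2}\le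 z_k$. Step 2: $\hat\Psi\in\mathbb R^{\bar V_O\times\bar V_O}$ is the $\Psi$-part of a minimizer of $\sum_{k\in\bar V_O}\big\{\big(\frac1n\sum_t|\Psi_{k,\cdot}(1;p_O^{(t)})|^4\big)^{1/4}+z_k\big\}$ over $(z,\Psi)$ subject to, for all $k,j\in\bar V_O$: $|\Psi_{k,\cdot}\hat\Sigma_{\cdot,j}-\mathbf 1_{kj}|\le\lambda z_k$ and $\big\{\frac1n\sum_t\{\Psi_{k,\cdot}(1;p_O^{(t)})(1;p_O^{(t)})_j-\mathbf 1_{kj}\}^2\big\}^{1/2}\le z_k$. Step 3 (debiased estimator): $(-\check v^T;\check W^T)=(-\hat v^T;\hat W^T)-\hat\Psi\big\{\frac1n\sum_t(1;p_O^{(t)})\{y_O^{(t)}-(\hat v-\hat Wp_O^{(t)})\}^T\big\}$. Step 4 (thresholded estimator, for thresholds $\mu_{kj}$): $\check W^\mu_{kj}=\check W_{kj}\,1\{|\check W_{kj}|>\mu_{kj}\}$, $k,j\in V_O$. *)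

theory Defs
  imports "HOL-Probability.Probability" "HOL-Library.Landau_Symbols"
begin

section \<open>Matrices indexed by finite sets\<close>

text \<open>
  The index sets vary with the number of periods, so matrices are functions of two indices together
  with an explicit finite index set; entries outside the index set play no role.
\<close>

definition inverse_mat_on :: "'i set \<Rightarrow> ('i \<Rightarrow> 'i \<Rightarrow> real) \<Rightarrow> ('i \<Rightarrow> 'i \<Rightarrow> real) \<Rightarrow> bool" where
  "inverse_mat_on I A B \<longleftrightarrow>
     (\<forall>i\<in>I. \<forall>j\<in>I. (\<Sum>k\<in>I. A i k * B k j) = of_bool (i = j)
                   \<and> (\<Sum>k\<in>I. B i k * A k j) = of_bool (i = j))"

definition invertible_mat_on :: "'i set \<Rightarrow> ('i \<Rightarrow> 'i \<Rightarrow> real) \<Rightarrow> bool" where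
  "invertible_mat_on I A \<longleftrightarrow> (\<exists>B. inverse_mat_on I A B)"

definition mat_inv_on :: "'i set \<Rightarrow> ('i \<Rightarrow> 'i \<Rightarrow> real) \<Rightarrow> 'i \<Rightarrow> 'i \<Rightarrow> real" where
  "mat_inv_on I A = (SOME B. inverse_mat_on I A B)"

definition mat_norm_1 :: "'i set \<Rightarrow> ('i \<Rightarrow> 'i \<Rightarrow> real) \<Rightarrow> real" where
  "mat_norm_1 I A = (MAX j\<in>I. \<Sum>i\<in>I. \<bar>A i j\<bar>)"

definition mat_norm_inf :: "'i set \<Rightarrow> ('i \<Rightarrow> 'i \<Rightarrow> real) \<Rightarrow> real" where
  "mat_norm_inf I A = (MAX i\<in>I. \<Sum>j\<in>I. \<bar>A i j\<bar>)"

definition eigenvalue_on :: "'i set \<Rightarrow> ('i \<Rightarrow> 'i \<Rightarrow> real) \<Rightarrow> real \<Rightarrow> bool" where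
  "eigenvalue_on I A e \<longleftrightarrow>
     (\<exists>x. (\<exists>i\<in>I. x i \<noteq> 0) \<and> (\<forall>i\<in>I. (\<Sum>j\<in>I. A i j * x j) = e * x i))"

definition sparse_mat_on :: "'i set \<Rightarrow> nat \<Rightarrow> ('i \<Rightarrow> 'i \<Rightarrow> real) \<Rightarrow> bool" where
  "sparse_mat_on I s A \<longleftrightarrow>
     (\<forall>i\<in>I. card {j\<in>I. A i j \<noteq> 0} \<le> s) \<and> (\<forall>j\<in>I. card {i\<in>I. A i j \<noteq> 0} \<le> s)"

definition sparse_approx_on :: "'i set \<Rightarrow> nat \<Rightarrow> real \<Rightarrow> ('i \<Rightarrow> 'i \<Rightarrow> real) \<Rightarrow> bool" where
  "sparse_approx_on I s r A \<longleftrightarrow>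
     (\<exists>B. sparse_mat_on I s B \<and>
          max (mat_norm_1 I (\<lambda>i j. A i j - B i j)) (mat_norm_inf I (\<lambda>i j. A i j - B i j)) \<le> r)"

section \<open>The linear network model\<close>

text \<open>
  One element of the array of models: \<open>agents_obs\<close>, \<open>agents_lat\<close> are $V_O$, $V_L$;
  \<open>weight\<close>, \<open>own\<close>, \<open>intercept\<close> are $G$, $(\lambda_i)$, $a$;
  \<open>covar t i\<close> and \<open>shock t i\<close> are the random variables $p^{(t)}_i$ and $\xi^{(t)}_i$;
  \<open>lat_covar\<close> is $p_0$; \<open>law\<close> is the probability space.
\<close>

record ('v, 'w) network =
  agents_obs :: "'v set"
  agents_lat :: "'v set"
  weight :: "'v \<Rightarrow> 'v \<Rightarrow> real"
  own :: "'v \<Rightarrow> real"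
  intercept :: "'v \<Rightarrow> real"
  lat_covar :: real
  covar :: "nat \<Rightarrow> 'v \<Rightarrow> 'w \<Rightarrow> real"
  shock :: "nat \<Rightarrow> 'v \<Rightarrow> 'w \<Rightarrow> real"
  law :: "'w measure"

definition agents :: "('v, 'w) network \<Rightarrow> 'v set" where
  "agents N = agents_obs N \<union> agents_lat N"

definition M_mat :: "('v, 'w) network \<Rightarrow> 'v \<Rightarrow> 'v \<Rightarrow> real" where
  "M_mat N i j = (if i = j then own N i else 0) - weight N i j"

definition M_inv :: "('v, 'w) network \<Rightarrow> 'v \<Rightarrow> 'v \<Rightarrow> real" where
  "M_inv N = mat_inv_on (agents N) (M_mat N)"

definition outcome :: "('v, 'w) network \<Rightarrow> nat \<Rightarrow> 'v \<Rightarrow> 'w \<Rightarrow> real" where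
  "outcome N t i \<omega> =
     (\<Sum>j\<in>agents N. M_inv N i j * (intercept N j + shock N t j \<omega> - covar N t j \<omega>))"

definition S_mat :: "('v, 'w) network \<Rightarrow> 'v \<Rightarrow> 'v \<Rightarrow> real" where
  "S_mat N i l = (\<Sum>m\<in>agents_lat N. M_mat N i m * mat_inv_on (agents_lat N) (M_mat N) m l)"

definition H_mat :: "('v, 'w) network \<Rightarrow> 'v \<Rightarrow> 'v \<Rightarrow> real" where
  "H_mat N i j = M_mat N i j - (\<Sum>l\<in>agents_lat N. S_mat N i l * M_mat N l j)"

definition H_inv :: "('v, 'w) network \<Rightarrow> 'v \<Rightarrow> 'v \<Rightarrow> real" where
  "H_inv N = mat_inv_on (agents_obs N) (H_mat N)"

definition HS_mat :: "('v, 'w) network \<Rightarrow> 'v \<Rightarrow> 'v \<Rightarrow> real" where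
  "HS_mat N i l = (\<Sum>j\<in>agents_obs N. H_inv N i j * S_mat N j l)"

definition v_obs :: "('v, 'w) network \<Rightarrow> 'v \<Rightarrow> real" where
  "v_obs N i = (\<Sum>j\<in>agents_obs N. H_inv N i j * intercept N j)
             - (\<Sum>l\<in>agents_lat N. HS_mat N i l * (intercept N l - lat_covar N))"

definition eps :: "('v, 'w) network \<Rightarrow> nat \<Rightarrow> 'v \<Rightarrow> 'w \<Rightarrow> real" where
  "eps N t i \<omega> = (\<Sum>j\<in>agents_obs N. H_inv N i j * shock N t j \<omega>)
               - (\<Sum>l\<in>agents_lat N. HS_mat N i l * shock N t l \<omega>)"

text \<open>
  The constants \<open>bM\<close>, \<open>bA\<close>, \<open>bL\<close>, \<open>bP\<close> bound
  the norms of $M^{-1}$, the intercepts, the $\lambda_i$ and the covariates.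
\<close>

definition linear_network ::
    "nat \<Rightarrow> real \<Rightarrow> real \<Rightarrow> real \<Rightarrow> real \<Rightarrow> ('v, 'w) network \<Rightarrow> bool" where
  "linear_network n bM bA bL bP N \<longleftrightarrow>
     prob_space (law N) \<and>
     finite (agents_obs N) \<and> agents_obs N \<noteq> {} \<and> finite (agents_lat N) \<and>
     agents_obs N \<inter> agents_lat N = {} \<and>
     (\<forall>t\<in>{1..n}. \<forall>i\<in>agents N.
        covar N t i \<in> borel_measurable (law N) \<and> shock N t i \<in> borel_measurable (law N)) \<and>
     (\<forall>t\<in>{1..n}. \<forall>i\<in>agents_lat N. \<forall>\<omega>\<in>space (law N). covar N t i \<omega> = lat_covar N) \<and>
     (\<forall>t\<in>{1..n}. \<forall>i\<in>agents N.
        integrable (law N) (shock N t i) \<and> integral\<^sup>L (law N) (shock N t i) = 0) \<and>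
     prob_space.indep_vars (law N) (\<lambda>_. PiM (agents N) (\<lambda>_. borel))
       (\<lambda>t \<omega>. \<lambda>i\<in>agents N. shock N t i \<omega>) {1..n} \<and>
     invertible_mat_on (agents N) (M_mat N) \<and>
     invertible_mat_on (agents_lat N) (M_mat N) \<and>
     invertible_mat_on (agents_obs N) (H_mat N) \<and>
     mat_norm_1 (agents N) (M_inv N) \<le> bM \<and> mat_norm_inf (agents N) (M_inv N) \<le> bM \<and>
     (\<forall>i\<in>agents N. \<bar>intercept N i\<bar> \<le> bA \<and> \<bar>own N i\<bar> \<le> bL) \<and>
     (\<forall>t\<in>{1..n}. \<forall>i\<in>agents N. AE \<omega> in law N. \<bar>covar N t i \<omega>\<bar> \<le> bP)"

section \<open>Regular designs\<close>

text \<open>The extra index $0$ of $\bar V_O$ is \<open>None\<close>.\<close>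

definition Vbar :: "('v, 'w) network \<Rightarrow> 'v option set" where
  "Vbar N = insert None (Some ` agents_obs N)"

definition one_p :: "('v, 'w) network \<Rightarrow> nat \<Rightarrow> 'w \<Rightarrow> 'v option \<Rightarrow> real" where
  "one_p N t \<omega> j = (case j of None \<Rightarrow> 1 | Some i \<Rightarrow> covar N t i \<omega>)"

definition obs_data :: "('v, 'w) network \<Rightarrow> nat \<Rightarrow> 'w \<Rightarrow> ('v \<Rightarrow> real) \<times> ('v \<Rightarrow> real)" where
  "obs_data N t \<omega> = (\<lambda>i\<in>agents_obs N. covar N t i \<omega>, \<lambda>i\<in>agents_obs N. outcome N t i \<omega>)"

definition data_space :: "('v, 'w) network \<Rightarrow> (('v \<Rightarrow> real) \<times> ('v \<Rightarrow> real)) measure" where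
  "data_space N = PiM (agents_obs N) (\<lambda>_. borel) \<Otimes>\<^sub>M PiM (agents_obs N) (\<lambda>_. borel)"

text \<open>The sigma-algebra generated by the observable covariates of the periods in \<open>T\<close>.\<close>

definition sigma_covar :: "('v, 'w) network \<Rightarrow> nat set \<Rightarrow> 'w measure" where
  "sigma_covar N T = vimage_algebra (space (law N))
     (\<lambda>\<omega>. \<lambda>(t, j)\<in>T \<times> agents_obs N. covar N t j \<omega>)
     (PiM (T \<times> agents_obs N) (\<lambda>_. borel))"

text \<open>
  $\bar\Psi$ is computed in period 1; by identical distribution every period gives the same matrix.
\<close>

definition second_moment :: "('v, 'w) network \<Rightarrow> 'v option \<Rightarrow> 'v option \<Rightarrow> real" where
  "second_moment N k j = integral\<^sup>L (law N) (\<lambda>\<omega>. one_p N 1 \<omega> k * one_p N 1 \<omega> j)"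

definition Psi_bar :: "('v, 'w) network \<Rightarrow> 'v option \<Rightarrow> 'v option \<Rightarrow> real" where
  "Psi_bar N = mat_inv_on (Vbar N) (second_moment N)"

definition row_apply ::
    "('v, 'w) network \<Rightarrow> ('v option \<Rightarrow> 'v option \<Rightarrow> real) \<Rightarrow> nat \<Rightarrow> 'w \<Rightarrow> 'v option \<Rightarrow> real" where
  "row_apply N \<Psi> t \<omega> k = (\<Sum>m\<in>Vbar N. \<Psi> k m * one_p N t \<omega> m)"

definition regular_data :: "nat \<Rightarrow> ('v, 'w) network \<Rightarrow> bool" where
  "regular_data n N \<longleftrightarrow>
     prob_space.indep_vars (law N) (\<lambda>_. data_space N) (obs_data N) {1..n} \<and>
     (\<forall>t\<in>{1..n}. \<forall>t'\<in>{1..n}.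
        distr (law N) (data_space N) (obs_data N t) = distr (law N) (data_space N) (obs_data N t')) \<and>
     (\<forall>t\<in>{1..n}. \<forall>i\<in>agents_obs N. \<forall>\<omega>\<in>space (law N).
        outcome N t i \<omega> =
          v_obs N i - (\<Sum>j\<in>agents_obs N. H_inv N i j * covar N t j \<omega>) + eps N t i \<omega>) \<and>
     (\<forall>t\<in>{1..n}. \<forall>j\<in>agents_obs N.
        AE \<omega> in law N. real_cond_exp (law N) (sigma_covar N {t}) (eps N t j) \<omega> = 0)"

text \<open>
  Conditional expectations of nonnegative variables are taken in \<open>ennreal\<close>, because
  \<open>real_cond_exp\<close> would turn an infinite value into 0.
\<close>

definition regular_noise :: "nat \<Rightarrow> real \<Rightarrow> real \<Rightarrow> real \<Rightarrow> ('v, 'w) network \<Rightarrow> bool" where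
  "regular_noise n c C M\<epsilon> N \<longleftrightarrow>
     (\<forall>t\<in>{1..n}. \<forall>j\<in>agents_obs N. AE \<omega> in law N.
        nn_cond_exp (law N) (sigma_covar N {t}) (\<lambda>\<omega>. ennreal ((eps N t j \<omega>)^2)) \<omega> \<ge> ennreal c) \<and>
     (\<forall>t\<in>{1..n}. \<forall>j\<in>agents_obs N. AE \<omega> in law N.
        nn_cond_exp (law N) (sigma_covar N {t}) (\<lambda>\<omega>. ennreal (\<bar>eps N t j \<omega>\<bar>^4)) \<omega> \<le> ennreal C) \<and>
     (AE \<omega> in law N.
        nn_cond_exp (law N) (sigma_covar N {1..n})
          (\<lambda>\<omega>. ennreal (MAX (t, j)\<in>{1..n} \<times> agents_obs N. \<bar>eps N t j \<omega>\<bar>^4)) \<omega> \<le> ennreal M\<epsilon>)"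

definition regular_covar :: "nat \<Rightarrow> real \<Rightarrow> real \<Rightarrow> real \<Rightarrow> real \<Rightarrow> ('v, 'w) network \<Rightarrow> bool" where
  "regular_covar n c C Ce M\<Psi> N \<longleftrightarrow>
     invertible_mat_on (Vbar N) (second_moment N) \<and>
     (\<forall>t\<in>{1..n}. \<forall>k\<in>Vbar N. \<forall>j\<in>Vbar N.
        integral\<^sup>L (law N)
          (\<lambda>\<omega>. (row_apply N (Psi_bar N) t \<omega> k * one_p N t \<omega> j - of_bool (k = j))^2) \<ge> c) \<and>
     (\<forall>t\<in>{1..n}. \<forall>k\<in>Vbar N. \<forall>j\<in>Vbar N.
        integral\<^sup>L (law N) (\<lambda>\<omega>. \<bar>row_apply N (Psi_bar N) t \<omega> k * one_p N t \<omega> j\<bar>^4) \<le> C) \<and>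
     integral\<^sup>L (law N)
       (\<lambda>\<omega>. MAX (t, j, k)\<in>{1..n} \<times> Vbar N \<times> Vbar N.
          \<bar>row_apply N (Psi_bar N) t \<omega> k * one_p N t \<omega> j\<bar>^4) \<le> M\<Psi> \<and>
     (\<forall>e. eigenvalue_on (Vbar N) (Psi_bar N) e \<longrightarrow> e \<le> Ce)"

text \<open>
  The sparsity level is a positive integer: the intercept $v_k$ always has to be
  estimated, so $s_n = 0$ is excluded.
\<close>

definition regular_design ::
    "(nat \<Rightarrow> ('v, 'w) network) \<Rightarrow> (nat \<Rightarrow> nat) \<Rightarrow> (nat \<Rightarrow> real) \<Rightarrow> bool" where
  "regular_design N s r \<longleftrightarrow>
     (\<forall>n\<ge>1. s n \<ge> 1 \<and> sparse_approx_on (agents_obs (N n)) (s n) (r n) (H_inv (N n))) \<and>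
     (\<exists>c C C' Ce. \<exists>M\<epsilon> M\<Psi> :: nat \<Rightarrow> real.
        0 < c \<and> c < C \<and> 0 < C' \<and>
        (\<forall>n\<ge>1. M\<epsilon> n \<ge> 1 \<and> M\<Psi> n \<ge> 1 \<and>
           regular_data n (N n) \<and> regular_noise n c C (M\<epsilon> n) (N n) \<and>
           regular_covar n c C Ce (M\<Psi> n) (N n) \<and>
           C' * ln (card (agents_obs (N n))) \<ge> ln n) \<and>
        (\<lambda>n. (s n)^2 * ln (card (agents_obs (N n))) * (ln n)^3) \<in> o(\<lambda>n. real n) \<and>
        (\<lambda>n. M\<epsilon> n * M\<Psi> n * ln (card (agents_obs (N n)))) \<in> o(\<lambda>n. real n))"

section \<open>Estimators\<close>

definition std_normal_cdf :: "real \<Rightarrow> real" where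
  "std_normal_cdf = cdf std_normal_distribution"

definition tun_tau :: "nat \<Rightarrow> ('v, 'w) network \<Rightarrow> 'w \<Rightarrow> real" where
  "tun_tau n N \<omega> =
     1 / (4 * sqrt (max 1 (MAX k\<in>agents_obs N. (1 / n) * (\<Sum>t=1..n. (covar N t k \<omega>)^4))))"

definition tun_lambda :: "nat \<Rightarrow> ('v, 'w) network \<Rightarrow> real" where
  "tun_lambda n N =
     (1 / sqrt n) * inv std_normal_cdf (1 - 1 / (3 * real n * (card (agents_obs N))^2))"

definition residual ::
    "('v, 'w) network \<Rightarrow> ('v \<Rightarrow> real) \<Rightarrow> ('v \<Rightarrow> 'v \<Rightarrow> real) \<Rightarrow> nat \<Rightarrow> 'w \<Rightarrow> 'v \<Rightarrow> real" where
  "residual N v W t \<omega> k =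
     outcome N t k \<omega> - (v k - (\<Sum>j\<in>agents_obs N. W k j * covar N t j \<omega>))"

definition step1_feasible ::
    "nat \<Rightarrow> ('v, 'w) network \<Rightarrow> 'w \<Rightarrow> ('v \<Rightarrow> 'v \<Rightarrow> real) \<times> ('v \<Rightarrow> real) \<times> ('v \<Rightarrow> real) \<Rightarrow> bool" where
  "step1_feasible n N \<omega> = (\<lambda>(W, v, z).
     \<forall>k\<in>agents_obs N. \<forall>j\<in>Vbar N.
       \<bar>(1 / n) * (\<Sum>t=1..n. residual N v W t \<omega> k * one_p N t \<omega> j)\<bar> \<le> tun_lambda n N * z k \<and>
       sqrt ((1 / n) * (\<Sum>t=1..n. (residual N v W t \<omega> k)^2 * (one_p N t \<omega> j)^2)) \<le> z k)"

definition step1_objective ::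
    "nat \<Rightarrow> ('v, 'w) network \<Rightarrow> 'w \<Rightarrow> ('v \<Rightarrow> 'v \<Rightarrow> real) \<times> ('v \<Rightarrow> real) \<times> ('v \<Rightarrow> real) \<Rightarrow> real" where
  "step1_objective n N \<omega> = (\<lambda>(W, v, z).
     \<Sum>k\<in>agents_obs N. (\<bar>v k\<bar> + (\<Sum>j\<in>agents_obs N. \<bar>W k j\<bar>)) + tun_tau n N \<omega> * z k)"

definition sigma_hat :: "nat \<Rightarrow> ('v, 'w) network \<Rightarrow> 'w \<Rightarrow> 'v option \<Rightarrow> 'v option \<Rightarrow> real" where
  "sigma_hat n N \<omega> i j = (1 / n) * (\<Sum>t=1..n. one_p N t \<omega> i * one_p N t \<omega> j)"

definition step2_feasible ::
    "nat \<Rightarrow> ('v, 'w) network \<Rightarrow> 'w \<Rightarrow>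
     ('v option \<Rightarrow> real) \<times> ('v option \<Rightarrow> 'v option \<Rightarrow> real) \<Rightarrow> bool" where
  "step2_feasible n N \<omega> = (\<lambda>(z, \<Psi>).
     \<forall>k\<in>Vbar N. \<forall>j\<in>Vbar N.
       \<bar>(\<Sum>m\<in>Vbar N. \<Psi> k m * sigma_hat n N \<omega> m j) - of_bool (k = j)\<bar> \<le> tun_lambda n N * z k \<and>
       sqrt ((1 / n) * (\<Sum>t=1..n. (row_apply N \<Psi> t \<omega> k * one_p N t \<omega> j - of_bool (k = j))^2)) \<le> z k)"

definition step2_objective ::
    "nat \<Rightarrow> ('v, 'w) network \<Rightarrow> 'w \<Rightarrow>
     ('v option \<Rightarrow> real) \<times> ('v option \<Rightarrow> 'v option \<Rightarrow> real) \<Rightarrow> real" where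
  "step2_objective n N \<omega> = (\<lambda>(z, \<Psi>).
     \<Sum>k\<in>Vbar N. root 4 ((1 / n) * (\<Sum>t=1..n. \<bar>row_apply N \<Psi> t \<omega> k\<bar>^4)) + z k)"

text \<open>
  The regression coefficients of agent \<open>k\<close>, stacked as $(-v_k, W_{k,\cdot})$ over $\bar V_O$.
\<close>

definition stacked :: "('v \<Rightarrow> real) \<Rightarrow> ('v \<Rightarrow> 'v \<Rightarrow> real) \<Rightarrow> 'v \<Rightarrow> 'v option \<Rightarrow> real" where
  "stacked v W k j = (case j of None \<Rightarrow> - v k | Some i \<Rightarrow> W k i)"

text \<open>Entry \<open>j\<close> of the stacked debiased estimator $(-\check v_k, \check W_{k,\cdot})$.\<close>

definition debiased ::
    "nat \<Rightarrow> ('v, 'w) network \<Rightarrow> 'w \<Rightarrow> ('v \<Rightarrow> 'v \<Rightarrow> real) \<Rightarrow> ('v \<Rightarrow> real) \<Rightarrow>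
     ('v option \<Rightarrow> 'v option \<Rightarrow> real) \<Rightarrow> 'v \<Rightarrow> 'v option \<Rightarrow> real" where
  "debiased n N \<omega> W v \<Psi> k j = stacked v W k j -
     (\<Sum>m\<in>Vbar N. \<Psi> j m * ((1 / n) * (\<Sum>t=1..n. one_p N t \<omega> m * residual N v W t \<omega> k)))"

definition debiased_W ::
    "nat \<Rightarrow> ('v, 'w) network \<Rightarrow> 'w \<Rightarrow> ('v \<Rightarrow> 'v \<Rightarrow> real) \<Rightarrow> ('v \<Rightarrow> real) \<Rightarrow>
     ('v option \<Rightarrow> 'v option \<Rightarrow> real) \<Rightarrow> 'v \<Rightarrow> 'v \<Rightarrow> real" where
  "debiased_W n N \<omega> W v \<Psi> k j = debiased n N \<omega> W v \<Psi> k (Some j)"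

definition thresholded :: "('v \<Rightarrow> 'v \<Rightarrow> real) \<Rightarrow> ('v \<Rightarrow> 'v \<Rightarrow> real) \<Rightarrow> 'v \<Rightarrow> 'v \<Rightarrow> real" where
  "thresholded \<mu> W k j = (if \<bar>W k j\<bar> > \<mu> k j then W k j else 0)"

end

(*
  The coefficients theta_k = (-v_k, H^{-1}_k) satisfy y_k = -theta_k . (1;p) + eps_k, and with
  Delta_k = theta^_k - theta_k the remainder is R_k = sqrt n (I - Psi^ Sigma^) Delta_k, so that
  |R_k| <= sqrt n lambda zeta |Delta_k|_1: it suffices to bound the step 2 slack zeta by a constant
  and |Delta_k|_1 by O(s sqrt(log|V|/n) + r).

  For step 2, the population matrix Psi-bar is feasible with a constant slack. For step 1, the true
  theta_k is compared with the minimizer. The exact choice z_k = z*_k (the largest empirical norm of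
  eps_k (1;p)_j) would require a moderate deviation theorem at the normal quantile, which is
  not available when log|V| is much larger than n^(1/3). Instead z_k = (1 + d) z*_k with
  d of order sqrt(log|V|/n) is used. The inequality exp(x - x^2/6) <= 1 + x + x^2/3 then
  gives the Gaussian exponent at the inflated threshold, and the inflation costs only O(d) in the
  cone condition, which has the order of the final bound. The other uniform bounds follow from the
  same inequality or from truncation at the envelopes M_eps and M_Psi.

  The bounded spectrum of Psi-bar gives the restricted eigenvalue condition. Part (ii) holds entry by
  entry: thresholding costs at most 3/2 mu on the sparse support and at most |H^{-1}_{kj}| off it.
*)
theory Submission
  imports Defs
begin


text \<open>The exponent x^2/2 in the score bound has to be exact. The quantile x leaves a Gaussian
  tail of only 1/(3 n p^2), where p = |V_O|, and the union bound runs over about p^2 pairs (k,j).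
  Losing a constant factor in the exponent would leave a power of p, and p may exceed every power of
  n. With the exact exponent the total is of order x/n. The inflation d is the relative accuracy to
  which the sums of squared scores are bounded below with probability of failure p^(-4); from above
  a bound up to the factor 25 is enough. Fourth moments alone give no exponential upper tails.
  Squared scores and fourth powers of the step 2 summands are therefore cut at a multiple of n / log
  p, the largest order at which the exponents are still multiples of log p. Markov's inequality at
  these levels costs, up to constants, M_eps (log p / n)^2 and M_Psi log p / n, and this is where
  the envelope condition enters.\<close>

section \<open>Exponential inequalities for independent sums\<close>

text \<open>The inequality holds on the whole line, so two moments of X control the expectation of
  exp (b X - b^2 X^2 / 6) without boundedness. The logarithm of the ratio of the right side to the
  left has derivative (x^3/9) / (1 + x + x^2/3), which has the sign of x, so its minimum is at
  0.\<close>

lemma exp_minus_sixth_square_le: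
  fixes x :: real
  shows "exp (x - x\<^sup>2 / 6) \<le> 1 + x + x\<^sup>2 / 3"
proof -
  define f :: "real \<Rightarrow> real" where "f = (\<lambda>x. ln (1 + x + x\<^sup>2/3) - x + x\<^sup>2/6)"
  have pos: "1 + x + x\<^sup>2/3 > 0" for x :: real
  proof -
    have "1 + x + x\<^sup>2/3 = (x + 3/2)\<^sup>2/3 + 1/4" by (simp add: power2_eq_square field_simps)
    then show ?thesis by (simp add: add_nonneg_pos)
  qed
  have deriv: "(f has_real_derivative (x^3/9) / (1 + x + x\<^sup>2/3)) (at x)" for x
  proof -
    have "(f has_real_derivative ((1 + 2*x/3) / (1 + x + x\<^sup>2/3) - 1 + x/3)) (at x)"
      unfolding f_def using pos[of x] by (auto intro!: derivative_eq_intros)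
    also have "(1 + 2*x/3) / (1 + x + x\<^sup>2/3) - 1 + x/3 = (x^3/9) / (1 + x + x\<^sup>2/3)"
      using pos[of x] by (simp add: field_simps power2_eq_square power3_eq_cube)
    finally show ?thesis .
  qed
  have "f x \<ge> f 0"
  proof (cases "x \<ge> 0")
    case True
    show ?thesis
      by (rule DERIV_nonneg_imp_nondecreasing[OF True]) (use deriv pos in \<open>fastforce intro: divide_nonneg_pos\<close>)
  next
    case False
    then have x: "x \<le> 0" by simp
    show ?thesis
    proof (rule DERIV_nonpos_imp_nonincreasing[OF x])
      fix y assume "x \<le> y" "y \<le> 0"
      then have "y^3/9 \<le> 0" by (auto simp: power3_eq_cube mult_nonneg_nonpos mult_nonneg_nonneg zero_le_mult_iff mult_le_0_iff)
      then have "(y^3/9) / (1 + y + y\<^sup>2/3) \<le> 0" using pos[of y] by (simp add: divide_nonpos_pos)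
      then show "\<exists>d. (f has_real_derivative d) (at y) \<and> d \<le> 0" using deriv by blast
    qed
  qed
  then have "x - x\<^sup>2/6 \<le> ln (1 + x + x\<^sup>2/3)" by (simp add: f_def)
  then have "exp (x - x\<^sup>2/6) \<le> exp (ln (1 + x + x\<^sup>2/3))" by simp
  then show ?thesis using pos[of x] by simp
qed

lemma exp_le_one_plus_twice:
  fixes u :: real
  assumes "0 \<le> u" "u \<le> 1"
  shows "exp u \<le> 1 + 2 * u"
proof -
  have "u\<^sup>2 \<le> u" using assms by (simp add: power2_eq_square mult_left_le)
  then show ?thesis using exp_bound[OF assms] by linarith
qed

text \<open>The product (1 - z + z^2/2) (1 + z + z^2/2) = 1 + z^4/4 is at least 1, and the second
  factor is at most exp z.\<close>

lemma exp_minus_le_quadratic: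
  fixes z :: real
  assumes "0 \<le> z"
  shows "exp (- z) \<le> 1 - z + z\<^sup>2 / 2"
proof -
  have pos: "1 + z + z\<^sup>2/2 > 0" using assms by (simp add: add_pos_nonneg)
  have "(1 - z + z\<^sup>2/2) * (1 + z + z\<^sup>2/2) = 1 + z^4/4"
    by (simp add: field_simps power2_eq_square power4_eq_xxxx)
  then have "1 \<le> (1 - z + z\<^sup>2/2) * (1 + z + z\<^sup>2/2)" by simp
  then have "1 / (1 + z + z\<^sup>2/2) \<le> 1 - z + z\<^sup>2/2" using pos by (simp add: field_simps)
  moreover have "exp (- z) \<le> 1 / (1 + z + z\<^sup>2/2)"
    using exp_lower_Taylor_quadratic[OF assms] pos
    by (simp add: exp_minus inverse_eq_divide frac_le)
  ultimately show ?thesis by linarith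
qed

context prob_space
begin

text \<open>The multiplier of the Laplace transform is absorbed into \<open>Z\<close>, so that a
  summand may also carry a quadratic correction.\<close>

lemma chernoff_indep:
  fixes Z :: "'i \<Rightarrow> 'a \<Rightarrow> real"
  assumes fin: "finite T" and ind: "indep_vars (\<lambda>_. borel) Z T"
    and int: "\<And>t. t \<in> T \<Longrightarrow> integrable M (\<lambda>\<omega>. exp (Z t \<omega>))"
    and mgf: "\<And>t. t \<in> T \<Longrightarrow> expectation (\<lambda>\<omega>. exp (Z t \<omega>)) \<le> 1 + a t"
  shows "prob {\<omega>\<in>space M. y \<le> (\<Sum>t\<in>T. Z t \<omega>)} \<le> exp ((\<Sum>t\<in>T. a t) - y)"
proof -
  have [measurable]: "\<And>t. t \<in> T \<Longrightarrow> random_variable borel (Z t)"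
    using ind by (auto simp: indep_vars_def)
  have ind': "indep_vars (\<lambda>_. borel) (\<lambda>t \<omega>. exp (Z t \<omega>)) T"
    by (rule indep_vars_compose2[OF ind]) auto
  have intP: "integrable M (\<lambda>\<omega>. \<Prod>t\<in>T. exp (Z t \<omega>))"
    by (rule indep_vars_integrable[OF fin ind']) (use int in auto)
  have E: "expectation (\<lambda>\<omega>. \<Prod>t\<in>T. exp (Z t \<omega>)) = (\<Prod>t\<in>T. expectation (\<lambda>\<omega>. exp (Z t \<omega>)))"
    by (rule indep_vars_lebesgue_integral[OF fin ind']) (use int in auto)
  also have "\<dots> \<le> (\<Prod>t\<in>T. exp (a t))"
  proof (rule prod_mono, intro conjI)
    fix t assume t: "t \<in> T"
    show "expectation (\<lambda>\<omega>. exp (Z t \<omega>)) \<le> exp (a t)"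
      using mgf[OF t] exp_ge_add_one_self[of "a t"] by linarith
  qed simp
  also have "\<dots> = exp (\<Sum>t\<in>T. a t)" by (simp add: exp_sum fin)
  finally have E: "expectation (\<lambda>\<omega>. exp (\<Sum>t\<in>T. Z t \<omega>)) \<le> exp (\<Sum>t\<in>T. a t)"
    by (simp add: exp_sum fin)
  have "{\<omega>\<in>space M. y \<le> (\<Sum>t\<in>T. Z t \<omega>)} = {\<omega>\<in>space M. exp y \<le> exp (\<Sum>t\<in>T. Z t \<omega>)}"
    by auto
  also have "prob \<dots> \<le> expectation (\<lambda>\<omega>. exp (\<Sum>t\<in>T. Z t \<omega>)) / exp y"
    by (rule integral_Markov_inequality_measure[where A = "space M" and M = M, simplified])
       (use intP in \<open>auto simp: exp_sum fin prod_nonneg\<close>)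
  also have "\<dots> \<le> exp (\<Sum>t\<in>T. a t) / exp y"
    using E by (simp add: divide_right_mono)
  finally show ?thesis by (simp add: exp_diff)
qed

text \<open>The Gaussian term, b^2/2 times the variance, is split: one third is charged to the
  observed squares and two thirds to the expected ones. The observed share makes the exponential
  integrable with second moments only.\<close>

lemma self_normalized_chernoff:
  fixes X :: "'i \<Rightarrow> 'a \<Rightarrow> real"
  assumes fin: "finite T" and ind: "indep_vars (\<lambda>_. borel) X T"
    and int: "\<And>t. t \<in> T \<Longrightarrow> integrable M (X t)"
    and int2: "\<And>t. t \<in> T \<Longrightarrow> integrable M (\<lambda>\<omega>. (X t \<omega>)\<^sup>2)"
    and mean: "\<And>t. t \<in> T \<Longrightarrow> expectation (X t) = 0"
  shows "prob {\<omega>\<in>space M. y \<le> b * (\<Sum>t\<in>T. X t \<omega>) - b\<^sup>2 / 6 * (\<Sum>t\<in>T. (X t \<omega>)\<^sup>2)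
            - b\<^sup>2 / 3 * (\<Sum>t\<in>T. expectation (\<lambda>\<omega>. (X t \<omega>)\<^sup>2))} \<le> exp (- y)"
proof -
  have [measurable]: "\<And>t. t \<in> T \<Longrightarrow> random_variable borel (X t)"
    using ind by (auto simp: indep_vars_def)
  let ?Z = "\<lambda>t \<omega>. b * X t \<omega> - (b * X t \<omega>)\<^sup>2 / 6"
  let ?a = "\<lambda>t. b\<^sup>2 / 3 * expectation (\<lambda>\<omega>. (X t \<omega>)\<^sup>2)"
  have ind': "indep_vars (\<lambda>_. borel) ?Z T"
    by (rule indep_vars_compose2[OF ind]) auto
  have i1: "integrable M (\<lambda>\<omega>. 1 + b * X t \<omega> + (b * X t \<omega>)\<^sup>2 / 3)" if "t \<in> T" for t
    using int[OF that] int2[OF that] by (simp add: power_mult_distrib)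
  have le: "exp (?Z t \<omega>) \<le> 1 + b * X t \<omega> + (b * X t \<omega>)\<^sup>2 / 3" for t \<omega>
    by (rule exp_minus_sixth_square_le)
  have i2: "integrable M (\<lambda>\<omega>. exp (?Z t \<omega>))" if t: "t \<in> T" for t
  proof (rule Bochner_Integration.integrable_bound[OF i1[OF t]])
    show "AE \<omega> in M. norm (exp (?Z t \<omega>)) \<le> norm (1 + b * X t \<omega> + (b * X t \<omega>)\<^sup>2 / 3)"
      using le by (intro AE_I2) (smt (verit) exp_ge_zero real_norm_def)
  qed (use t in measurable)
  have mgf: "expectation (\<lambda>\<omega>. exp (?Z t \<omega>)) \<le> 1 + ?a t" if t: "t \<in> T" for t
  proof -
    have "expectation (\<lambda>\<omega>. exp (?Z t \<omega>)) \<le> expectation (\<lambda>\<omega>. 1 + b * X t \<omega> + (b * X t \<omega>)\<^sup>2 / 3)"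
      by (rule integral_mono[OF i2[OF t] i1[OF t] le])
    also have "\<dots> = 1 + ?a t"
      using int[OF t] int2[OF t] mean[OF t] by (simp add: power_mult_distrib prob_space)
    finally show ?thesis .
  qed
  have P: "prob {\<omega>\<in>space M. y + (\<Sum>t\<in>T. ?a t) \<le> (\<Sum>t\<in>T. ?Z t \<omega>)} \<le> exp ((\<Sum>t\<in>T. ?a t) - (y + (\<Sum>t\<in>T. ?a t)))"
    by (rule chernoff_indep[OF fin ind' i2 mgf])
  have Z: "(\<Sum>t\<in>T. ?Z t \<omega>) = b * (\<Sum>t\<in>T. X t \<omega>) - b\<^sup>2 / 6 * (\<Sum>t\<in>T. (X t \<omega>)\<^sup>2)" for \<omega>
    by (simp add: sum_subtractf sum_distrib_left power_mult_distrib)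
  have a: "(\<Sum>t\<in>T. ?a t) = b\<^sup>2 / 3 * (\<Sum>t\<in>T. expectation (\<lambda>\<omega>. (X t \<omega>)\<^sup>2))"
    by (simp add: sum_distrib_left)
  show ?thesis using P unfolding Z a by (simp only: le_diff_eq) simp
qed

text \<open>The restriction on the observed squares is part of the event. Once the observed and the
  expected squares are both at most \<open>Q\<close>, the multipliers b = u/Q and b = -u/Q give the
  Gaussian exponent u^2/(2Q).\<close>

lemma centered_sum_tail:
  fixes X :: "'i \<Rightarrow> 'a \<Rightarrow> real"
  assumes fin: "finite T" and ind: "indep_vars (\<lambda>_. borel) X T"
    and int: "\<And>t. t \<in> T \<Longrightarrow> integrable M (X t)"
    and int2: "\<And>t. t \<in> T \<Longrightarrow> integrable M (\<lambda>\<omega>. (X t \<omega>)\<^sup>2)"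
    and mean: "\<And>t. t \<in> T \<Longrightarrow> expectation (X t) = 0"
    and var: "(\<Sum>t\<in>T. expectation (\<lambda>\<omega>. (X t \<omega>)\<^sup>2)) \<le> Q" and Q: "0 < Q" and u: "0 \<le> u"
  shows "prob {\<omega>\<in>space M. u \<le> \<bar>\<Sum>t\<in>T. X t \<omega>\<bar> \<and> (\<Sum>t\<in>T. (X t \<omega>)\<^sup>2) \<le> Q} \<le> 2 * exp (- u\<^sup>2 / (2 * Q))"
proof -
  have [measurable]: "\<And>t. t \<in> T \<Longrightarrow> random_variable borel (X t)"
    using ind by (auto simp: indep_vars_def)
  let ?E = "\<lambda>b. {\<omega>\<in>space M. u\<^sup>2 / (2 * Q) \<le> b * (\<Sum>t\<in>T. X t \<omega>) - b\<^sup>2 / 6 * (\<Sum>t\<in>T. (X t \<omega>)\<^sup>2)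
            - b\<^sup>2 / 3 * (\<Sum>t\<in>T. expectation (\<lambda>\<omega>. (X t \<omega>)\<^sup>2))}"
  have key: "u\<^sup>2 / (2 * Q) \<le> b * s - b\<^sup>2 / 6 * v - b\<^sup>2 / 3 * w"
    if "b = u/Q \<or> b = -(u/Q)" "b * s \<ge> u/Q * u" "v \<le> Q" "w \<le> Q" for b s v w
  proof -
    have b2: "b\<^sup>2 = u\<^sup>2 / Q\<^sup>2" using that(1) by (auto simp: power_divide)
    have "b\<^sup>2 / 6 * v + b\<^sup>2 / 3 * w \<le> b\<^sup>2 / 6 * Q + b\<^sup>2 / 3 * Q"
      using that by (intro add_mono mult_left_mono) auto
    also have "\<dots> = u\<^sup>2 / (2 * Q)" unfolding b2 using Q by (simp add: field_simps power2_eq_square)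
    finally have "b * s - b\<^sup>2 / 6 * v - b\<^sup>2 / 3 * w \<ge> u/Q*u - u\<^sup>2 / (2 * Q)" using that by linarith
    also have "u/Q*u - u\<^sup>2 / (2 * Q) = u\<^sup>2 / (2 * Q)" using Q by (simp add: field_simps power2_eq_square)
    finally show ?thesis .
  qed
  have "{\<omega>\<in>space M. u \<le> \<bar>\<Sum>t\<in>T. X t \<omega>\<bar> \<and> (\<Sum>t\<in>T. (X t \<omega>)\<^sup>2) \<le> Q} \<subseteq> ?E (u/Q) \<union> ?E (-(u/Q))"
  proof
    fix \<omega> assume "\<omega> \<in> {\<omega>\<in>space M. u \<le> \<bar>\<Sum>t\<in>T. X t \<omega>\<bar> \<and> (\<Sum>t\<in>T. (X t \<omega>)\<^sup>2) \<le> Q}"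
    then have \<omega>: "\<omega> \<in> space M" "u \<le> \<bar>\<Sum>t\<in>T. X t \<omega>\<bar>" "(\<Sum>t\<in>T. (X t \<omega>)\<^sup>2) \<le> Q" by auto
    have uq: "0 \<le> u/Q" using u Q by simp
    consider "u \<le> (\<Sum>t\<in>T. X t \<omega>)" | "u \<le> - (\<Sum>t\<in>T. X t \<omega>)" using \<omega>(2) by linarith
    then show "\<omega> \<in> ?E (u/Q) \<union> ?E (-(u/Q))"
    proof cases
      case 1
      have "u/Q * (\<Sum>t\<in>T. X t \<omega>) \<ge> u/Q * u" by (rule mult_left_mono[OF 1 uq])
      then show ?thesis using key[of "u/Q", OF _ _ \<omega>(3) var] \<omega>(1) by blast
    next
      case 2
      have "-(u/Q) * (\<Sum>t\<in>T. X t \<omega>) \<ge> u/Q * u" using mult_left_mono[OF 2 uq] by simp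
      then show ?thesis using key[of "-(u/Q)", OF _ _ \<omega>(3) var] \<omega>(1) by blast
    qed
  qed
  then have "prob {\<omega>\<in>space M. u \<le> \<bar>\<Sum>t\<in>T. X t \<omega>\<bar> \<and> (\<Sum>t\<in>T. (X t \<omega>)\<^sup>2) \<le> Q}
      \<le> prob (?E (u/Q) \<union> ?E (-(u/Q)))"
    by (intro finite_measure_mono) measurable
  also have "\<dots> \<le> prob (?E (u/Q)) + prob (?E (-(u/Q)))"
    by (intro measure_Un_le) measurable
  also have "\<dots> \<le> exp (- (u\<^sup>2 / (2 * Q))) + exp (- (u\<^sup>2 / (2 * Q)))"
    by (intro add_mono self_normalized_chernoff[OF fin ind int int2 mean])
  finally show ?thesis by simp
qed

text \<open>
  Because the threshold carries the factor \<open>1 + d\<close>, the crude inequality with the constants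
  $1/6$ and $1/3$ already yields the exact Gaussian exponent: in units of the standard deviation
  $B$ of the sum, $u - u^2/6 - 1/3 \ge 1/2$ for $1 \le u \le 5$.
\<close>

lemma self_normalized_tail:
  fixes X :: "'i \<Rightarrow> 'a \<Rightarrow> real"
  assumes fin: "finite T" and ind: "indep_vars (\<lambda>_. borel) X T"
    and int: "\<And>t. t \<in> T \<Longrightarrow> integrable M (X t)"
    and int2: "\<And>t. t \<in> T \<Longrightarrow> integrable M (\<lambda>\<omega>. (X t \<omega>)\<^sup>2)"
    and mean: "\<And>t. t \<in> T \<Longrightarrow> expectation (X t) = 0"
    and Q: "(\<Sum>t\<in>T. expectation (\<lambda>\<omega>. (X t \<omega>)\<^sup>2)) = Q" "0 < Q"
    and x: "0 \<le> x" and d: "0 \<le> d" "d \<le> 1/2"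
  shows "prob {\<omega>\<in>space M. x * (1 + d) * sqrt (\<Sum>t\<in>T. (X t \<omega>)\<^sup>2) \<le> \<bar>\<Sum>t\<in>T. X t \<omega>\<bar> \<and>
           (1 - d) * Q \<le> (\<Sum>t\<in>T. (X t \<omega>)\<^sup>2) \<and> (\<Sum>t\<in>T. (X t \<omega>)\<^sup>2) \<le> 25 * Q} \<le> 2 * exp (- x\<^sup>2 / 2)"
    (is "prob ?A \<le> _")
proof -
  have [measurable]: "\<And>t. t \<in> T \<Longrightarrow> random_variable borel (X t)"
    using ind by (auto simp: indep_vars_def)
  let ?E = "\<lambda>b. {\<omega>\<in>space M. x\<^sup>2 / 2 \<le> b * (\<Sum>t\<in>T. X t \<omega>) - b\<^sup>2 / 6 * (\<Sum>t\<in>T. (X t \<omega>)\<^sup>2)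
            - b\<^sup>2 / 3 * (\<Sum>t\<in>T. expectation (\<lambda>\<omega>. (X t \<omega>)\<^sup>2))}"
  let ?b = "x / sqrt Q"
  have key: "x\<^sup>2 / 2 \<le> b * s - b\<^sup>2 / 6 * v - b\<^sup>2 / 3 * Q"
    if b: "b\<^sup>2 = ?b\<^sup>2" and bs: "b * s \<ge> ?b * (x * (1 + d) * sqrt v)"
      and v: "(1 - d) * Q \<le> v" "v \<le> 25 * Q" for b s v
  proof -
    define u where "u = sqrt (v / Q)"
    have v0: "0 \<le> v" using v(1) d Q(2) by (intro order_trans[OF _ v(1)]) simp
    have u0: "0 \<le> u" and uv: "u\<^sup>2 = v / Q" using v0 Q(2) by (auto simp: u_def)
    have sv: "sqrt v = u * sqrt Q" using Q(2) by (simp add: u_def flip: real_sqrt_mult)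
    have u5: "u \<le> 5"
    proof -
      have "u\<^sup>2 \<le> 5\<^sup>2" unfolding uv using v(2) Q(2) by (simp add: divide_le_eq)
      then show ?thesis by (rule power2_le_imp_le) simp
    qed
    \<comment> \<open>Here the inflation pays for a deficit of the observed squares: (1 + d)^2 (1 -
      d) = 1 + d - d^2 - d^3 is at least 1 for d <= 1/2. This settles the case u < 1, since 1 - 1/6
      - 1/3 = 1/2.\<close>
    have ud: "1 \<le> (1 + d) * u"
    proof -
      have d2: "d * d \<le> d * (1/2)" by (rule mult_left_mono) (use d in auto)
      have d3: "d * (d * d) \<le> 1/2 * (d * d)" by (rule mult_right_mono) (use d in auto)
      have "1 \<le> (1 + d)\<^sup>2 * (1 - d)"
        using d2 d3 d by (simp add: power2_eq_square algebra_simps)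
      also have "\<dots> \<le> (1 + d)\<^sup>2 * u\<^sup>2"
        using v Q(2) by (intro mult_left_mono) (auto simp: uv field_simps)
      finally have "1\<^sup>2 \<le> ((1 + d) * u)\<^sup>2" by (simp add: power_mult_distrib)
      then show ?thesis using u0 d by (intro power2_le_imp_le[of 1 "(1 + d) * u"]) simp_all
    qed
    have ineq: "(1 + d) * u - u\<^sup>2 / 6 - 1/3 \<ge> 1/2"
    proof (cases "u \<ge> 1")
      case True
      have "(u - 1) * (5 - u) \<ge> 0" using True u5 by simp
      moreover have "d * u \<ge> 0" using d u0 by simp
      ultimately show ?thesis by (simp add: algebra_simps power2_eq_square)
    next
      case False
      then have "u\<^sup>2 \<le> 1" using u0 by (simp add: power_le_one)
      then show ?thesis using ud by linarith
    qed
    have b2: "b\<^sup>2 = x\<^sup>2 / Q" using b Q(2) by (simp add: power_divide)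
    have "?b * (x * (1 + d) * sqrt v) = x\<^sup>2 * ((1 + d) * u)"
      unfolding sv using Q(2) by (simp add: power2_eq_square field_simps)
    moreover have "b\<^sup>2 / 6 * v = x\<^sup>2 * (u\<^sup>2 / 6)" "b\<^sup>2 / 3 * Q = x\<^sup>2 * (1/3)"
      unfolding b2 uv using Q(2) by (auto simp: field_simps)
    ultimately have "b * s - b\<^sup>2 / 6 * v - b\<^sup>2 / 3 * Q \<ge> x\<^sup>2 * ((1 + d) * u) - x\<^sup>2 * (u\<^sup>2/6) - x\<^sup>2 * (1/3)"
      using bs by linarith
    also have "x\<^sup>2 * ((1 + d) * u) - x\<^sup>2 * (u\<^sup>2/6) - x\<^sup>2 * (1/3) = x\<^sup>2 * ((1 + d) * u - u\<^sup>2/6 - 1/3)"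
      by (simp add: algebra_simps)
    also have "\<dots> \<ge> x\<^sup>2 * (1/2)"
      by (rule mult_left_mono[OF ineq]) simp
    finally show ?thesis by simp
  qed
  have b0: "0 \<le> ?b" using x Q(2) by simp
  have "?A \<subseteq> ?E ?b \<union> ?E (- ?b)"
  proof
    fix \<omega> assume "\<omega> \<in> ?A"
    then have \<omega>: "\<omega> \<in> space M" "x * (1 + d) * sqrt (\<Sum>t\<in>T. (X t \<omega>)\<^sup>2) \<le> \<bar>\<Sum>t\<in>T. X t \<omega>\<bar>"
      "(1 - d) * Q \<le> (\<Sum>t\<in>T. (X t \<omega>)\<^sup>2)" "(\<Sum>t\<in>T. (X t \<omega>)\<^sup>2) \<le> 25 * Q" by auto
    let ?u = "x * (1 + d) * sqrt (\<Sum>t\<in>T. (X t \<omega>)\<^sup>2)"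
    consider "?u \<le> (\<Sum>t\<in>T. X t \<omega>)" | "?u \<le> - (\<Sum>t\<in>T. X t \<omega>)" using \<omega>(2) by linarith
    then show "\<omega> \<in> ?E ?b \<union> ?E (- ?b)"
    proof cases
      case 1
      then show ?thesis
        using key[OF _ mult_left_mono[OF 1 b0] \<omega>(3,4)] \<omega>(1) Q(1) by auto
    next
      case 2
      have "- ?b * (\<Sum>t\<in>T. X t \<omega>) \<ge> ?b * ?u" using mult_left_mono[OF 2 b0] by simp
      then show ?thesis
        using key[of "- ?b", OF _ _ \<omega>(3,4)] \<omega>(1) Q(1) by auto
    qed
  qed
  then have "prob ?A \<le> prob (?E ?b \<union> ?E (- ?b))"
    by (intro finite_measure_mono) measurable
  also have "\<dots> \<le> prob (?E ?b) + prob (?E (- ?b))"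
    by (intro measure_Un_le) measurable
  also have "\<dots> \<le> exp (- (x\<^sup>2 / 2)) + exp (- (x\<^sup>2 / 2))"
    by (intro add_mono self_normalized_chernoff[OF fin ind int int2 mean])
  finally show ?thesis by simp
qed

text \<open>On the event no summand exceeds \<open>U\<close>, so each may be replaced by its minimum
  with \<open>U\<close>. After division by \<open>U\<close> the values lie in [0,1], where exp u <=
  1 + 2 u; the factor 2 in front of the mean comes from there.\<close>

lemma nonneg_sum_upper_tail:
  fixes Y :: "'i \<Rightarrow> 'a \<Rightarrow> real"
  assumes fin: "finite T" and ind: "indep_vars (\<lambda>_. borel) Y T"
    and int: "\<And>t. t \<in> T \<Longrightarrow> integrable M (Y t)"
    and nonneg: "\<And>t \<omega>. t \<in> T \<Longrightarrow> 0 \<le> Y t \<omega>"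
    and U: "0 < U"
  shows "prob {\<omega>\<in>space M. l \<le> (\<Sum>t\<in>T. Y t \<omega>) \<and> (\<forall>t\<in>T. Y t \<omega> \<le> U)}
           \<le> exp ((2 * (\<Sum>t\<in>T. expectation (Y t)) - l) / U)"
proof -
  have [measurable]: "\<And>t. t \<in> T \<Longrightarrow> random_variable borel (Y t)"
    using ind by (auto simp: indep_vars_def)
  let ?Z = "\<lambda>t \<omega>. min (Y t \<omega>) U / U"
  have ind': "indep_vars (\<lambda>_. borel) ?Z T"
    by (rule indep_vars_compose2[OF ind]) auto
  have le: "exp (?Z t \<omega>) \<le> 1 + 2 * (Y t \<omega> / U)" if "t \<in> T" for t \<omega>
  proof -
    have "exp (?Z t \<omega>) \<le> 1 + 2 * ?Z t \<omega>"
      by (rule exp_le_one_plus_twice) (use nonneg[OF that] U in auto)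
    also have "\<dots> \<le> 1 + 2 * (Y t \<omega> / U)" using U by (intro add_mono mult_left_mono divide_right_mono) auto
    finally show ?thesis .
  qed
  have i1: "integrable M (\<lambda>\<omega>. 1 + 2 * (Y t \<omega> / U))" if "t \<in> T" for t
    using int[OF that] by simp
  have i2: "integrable M (\<lambda>\<omega>. exp (?Z t \<omega>))" if t: "t \<in> T" for t
  proof (rule Bochner_Integration.integrable_bound[OF i1[OF t]])
    show "AE \<omega> in M. norm (exp (?Z t \<omega>)) \<le> norm (1 + 2 * (Y t \<omega> / U))"
      using le[OF t] by (intro AE_I2) (smt (verit) exp_ge_zero real_norm_def)
  qed (use t in measurable)
  have mgf: "expectation (\<lambda>\<omega>. exp (?Z t \<omega>)) \<le> 1 + 2 * expectation (Y t) / U" if t: "t \<in> T" for t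
  proof -
    have "expectation (\<lambda>\<omega>. exp (?Z t \<omega>)) \<le> expectation (\<lambda>\<omega>. 1 + 2 * (Y t \<omega> / U))"
      by (rule integral_mono[OF i2[OF t] i1[OF t] le[OF t]])
    also have "\<dots> = 1 + 2 * expectation (Y t) / U"
      using int[OF t] by (simp add: prob_space)
    finally show ?thesis .
  qed
  have "prob {\<omega>\<in>space M. l \<le> (\<Sum>t\<in>T. Y t \<omega>) \<and> (\<forall>t\<in>T. Y t \<omega> \<le> U)}
      \<le> prob {\<omega>\<in>space M. l / U \<le> (\<Sum>t\<in>T. ?Z t \<omega>)}"
  proof (rule finite_measure_mono)
    show "{\<omega>\<in>space M. l \<le> (\<Sum>t\<in>T. Y t \<omega>) \<and> (\<forall>t\<in>T. Y t \<omega> \<le> U)} \<subseteq> {\<omega>\<in>space M. l / U \<le> (\<Sum>t\<in>T. ?Z t \<omega>)}"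
      using U by (auto simp: sum_divide_distrib[symmetric] divide_right_mono)
  qed measurable
  also have "\<dots> \<le> exp ((\<Sum>t\<in>T. 2 * expectation (Y t) / U) - l / U)"
    by (rule chernoff_indep[OF fin ind' i2 mgf])
  also have "(\<Sum>t\<in>T. 2 * expectation (Y t) / U) - l / U = (2 * (\<Sum>t\<in>T. expectation (Y t)) - l) / U"
    by (simp add: sum_divide_distrib sum_distrib_left diff_divide_distrib)
  finally show ?thesis .
qed

text \<open>For nonnegative summands exp (- b Y) is bounded, so the lower tail is Gaussian with
  second moments alone and without truncation. The choice b = u/q minimizes b^2 q / 2 - b u.\<close>

lemma nonneg_sum_lower_tail:
  fixes Y :: "'i \<Rightarrow> 'a \<Rightarrow> real"
  assumes fin: "finite T" and ind: "indep_vars (\<lambda>_. borel) Y T"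
    and int: "\<And>t. t \<in> T \<Longrightarrow> integrable M (Y t)"
    and int2: "\<And>t. t \<in> T \<Longrightarrow> integrable M (\<lambda>\<omega>. (Y t \<omega>)\<^sup>2)"
    and nonneg: "\<And>t \<omega>. t \<in> T \<Longrightarrow> 0 \<le> Y t \<omega>"
    and q: "(\<Sum>t\<in>T. expectation (\<lambda>\<omega>. (Y t \<omega>)\<^sup>2)) \<le> q" "0 < q" and u: "0 \<le> u"
  shows "prob {\<omega>\<in>space M. (\<Sum>t\<in>T. Y t \<omega>) \<le> (\<Sum>t\<in>T. expectation (Y t)) - u} \<le> exp (- u\<^sup>2 / (2 * q))"
proof -
  have [measurable]: "\<And>t. t \<in> T \<Longrightarrow> random_variable borel (Y t)"
    using ind by (auto simp: indep_vars_def)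
  define b where "b = u / q"
  have b0: "0 \<le> b" using u q by (simp add: b_def)
  let ?Z = "\<lambda>t \<omega>. - (b * Y t \<omega>)"
  let ?a = "\<lambda>t. - b * expectation (Y t) + b\<^sup>2 / 2 * expectation (\<lambda>\<omega>. (Y t \<omega>)\<^sup>2)"
  have ind': "indep_vars (\<lambda>_. borel) ?Z T"
    by (rule indep_vars_compose2[OF ind]) auto
  have le: "exp (?Z t \<omega>) \<le> 1 - b * Y t \<omega> + (b * Y t \<omega>)\<^sup>2 / 2" if "t \<in> T" for t \<omega>
    by (rule exp_minus_le_quadratic) (use nonneg[OF that] b0 in auto)
  have i1: "integrable M (\<lambda>\<omega>. 1 - b * Y t \<omega> + (b * Y t \<omega>)\<^sup>2 / 2)" if "t \<in> T" for t
    using int[OF that] int2[OF that] by (simp add: power_mult_distrib)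
  have i2: "integrable M (\<lambda>\<omega>. exp (?Z t \<omega>))" if t: "t \<in> T" for t
  proof (rule Bochner_Integration.integrable_bound[OF i1[OF t]])
    show "AE \<omega> in M. norm (exp (?Z t \<omega>)) \<le> norm (1 - b * Y t \<omega> + (b * Y t \<omega>)\<^sup>2 / 2)"
      using le[OF t] by (intro AE_I2) (smt (verit) exp_ge_zero real_norm_def)
  qed (use t in measurable)
  have mgf: "expectation (\<lambda>\<omega>. exp (?Z t \<omega>)) \<le> 1 + ?a t" if t: "t \<in> T" for t
  proof -
    have "expectation (\<lambda>\<omega>. exp (?Z t \<omega>)) \<le> expectation (\<lambda>\<omega>. 1 - b * Y t \<omega> + (b * Y t \<omega>)\<^sup>2 / 2)"
      by (rule integral_mono[OF i2[OF t] i1[OF t] le[OF t]])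
    also have "\<dots> = 1 + ?a t"
      using int[OF t] int2[OF t] by (simp add: prob_space power_mult_distrib)
    finally show ?thesis .
  qed
  let ?m = "\<Sum>t\<in>T. expectation (Y t)"
  have "prob {\<omega>\<in>space M. (\<Sum>t\<in>T. Y t \<omega>) \<le> ?m - u} \<le> prob {\<omega>\<in>space M. - (b * (?m - u)) \<le> (\<Sum>t\<in>T. ?Z t \<omega>)}"
  proof (rule finite_measure_mono)
    show "{\<omega>\<in>space M. (\<Sum>t\<in>T. Y t \<omega>) \<le> ?m - u} \<subseteq> {\<omega>\<in>space M. - (b * (?m - u)) \<le> (\<Sum>t\<in>T. ?Z t \<omega>)}"
      using b0 by (auto simp: sum_negf sum_distrib_left[symmetric] intro: mult_left_mono)
  qed measurable
  also have "\<dots> \<le> exp ((\<Sum>t\<in>T. ?a t) - (- (b * (?m - u))))"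
    by (rule chernoff_indep[OF fin ind' i2 mgf])
  also have "(\<Sum>t\<in>T. ?a t) - (- (b * (?m - u))) =
      b\<^sup>2 / 2 * (\<Sum>t\<in>T. expectation (\<lambda>\<omega>. (Y t \<omega>)\<^sup>2)) - b * u"
    by (simp only: sum.distrib sum_distrib_left[symmetric]) (simp add: algebra_simps)
  also have "exp \<dots> \<le> exp (b\<^sup>2 / 2 * q - b * u)"
    using q by (auto intro: mult_left_mono)
  also have "b\<^sup>2 / 2 * q - b * u = - u\<^sup>2 / (2 * q)"
    using q by (simp add: b_def field_simps power2_eq_square)
  finally show ?thesis .
qed

end

section \<open>Union bounds over finite index sets and pairs\<close>

lemma (in prob_space) prob_bex_le:
  fixes b :: real
  assumes "finite I" and "\<And>i. i \<in> I \<Longrightarrow> {\<omega>\<in>space M. P i \<omega>} \<in> events"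
    and "\<And>i. i \<in> I \<Longrightarrow> prob {\<omega>\<in>space M. P i \<omega>} \<le> b"
  shows "{\<omega>\<in>space M. \<exists>i\<in>I. P i \<omega>} \<in> events" and "prob {\<omega>\<in>space M. \<exists>i\<in>I. P i \<omega>} \<le> card I * b"
proof -
  have eq: "{\<omega>\<in>space M. \<exists>i\<in>I. P i \<omega>} = (\<Union>i\<in>I. {\<omega>\<in>space M. P i \<omega>})" by auto
  show "{\<omega>\<in>space M. \<exists>i\<in>I. P i \<omega>} \<in> events" unfolding eq using assms by (intro sets.finite_UN) auto
  have "prob (\<Union>i\<in>I. {\<omega>\<in>space M. P i \<omega>}) \<le> (\<Sum>i\<in>I. prob {\<omega>\<in>space M. P i \<omega>})"
    using assms by (intro finite_measure_subadditive_finite) auto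
  also have "\<dots> \<le> (\<Sum>i\<in>I. b)" using assms by (intro sum_mono) auto
  finally show "prob {\<omega>\<in>space M. \<exists>i\<in>I. P i \<omega>} \<le> card I * b" unfolding eq by simp
qed

lemma (in prob_space) prob_bex2_le:
  fixes b :: real
  assumes "finite I" "finite J" and ev: "\<And>i j. i \<in> I \<Longrightarrow> j \<in> J \<Longrightarrow> {\<omega>\<in>space M. P i j \<omega>} \<in> events"
    and le: "\<And>i j. i \<in> I \<Longrightarrow> j \<in> J \<Longrightarrow> prob {\<omega>\<in>space M. P i j \<omega>} \<le> b"
  shows "{\<omega>\<in>space M. \<exists>i\<in>I. \<exists>j\<in>J. P i j \<omega>} \<in> events"
    and "prob {\<omega>\<in>space M. \<exists>i\<in>I. \<exists>j\<in>J. P i j \<omega>} \<le> card I * (card J * b)"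
proof -
  note * = prob_bex_le[of J, OF \<open>finite J\<close> ev le]
  show "{\<omega>\<in>space M. \<exists>i\<in>I. \<exists>j\<in>J. P i j \<omega>} \<in> events"
    by (rule prob_bex_le(1)[OF \<open>finite I\<close> *])
  show "prob {\<omega>\<in>space M. \<exists>i\<in>I. \<exists>j\<in>J. P i j \<omega>} \<le> card I * (card J * b)"
    by (rule prob_bex_le(2)[OF \<open>finite I\<close> *])
qed

section \<open>Quantiles of the normal distribution\<close>

lemma gaussian_tail_eq:
  "1 - std_normal_cdf x = (\<integral>y. std_normal_density y * indicator {x<..} y \<partial>lborel)"
  and gaussian_tail_integrable: "integrable lborel (\<lambda>y. std_normal_density y * indicator {x<..} y)"
proof -
  interpret N: real_distribution std_normal_distribution by (rule real_dist_normal_dist)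
  have "1 - std_normal_cdf x = measure std_normal_distribution {x<..}"
    unfolding std_normal_cdf_def cdf_def
    using N.prob_compl[of "{..x}"] by (simp add: Compl_eq_Diff_UNIV[symmetric] Compl_atMost)
  also have "\<dots> = (\<integral>y. indicator {x<..} y \<partial>std_normal_distribution)"
    by simp
  also have "\<dots> = (\<integral>y. std_normal_density y * indicator {x<..} y \<partial>lborel)"
    by (subst integral_density) (auto simp: normal_density_nonneg)
  finally show "1 - std_normal_cdf x = (\<integral>y. std_normal_density y * indicator {x<..} y \<partial>lborel)" .
  show "integrable lborel (\<lambda>y. std_normal_density y * indicator {x<..} y)"
    by (rule integrable_real_mult_indicator) auto
qed

text \<open>For y > x >= 0 one has y^2 >= x^2 + (y - x)^2, so the density on the tail is dominated
  by exp (- x^2/2) times the normal density centred at x.\<close>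

lemma gaussian_tail_upper:
  assumes "0 \<le> x"
  shows "1 - std_normal_cdf x \<le> exp (- x\<^sup>2 / 2)"
proof -
  have "std_normal_density y * indicator {x<..} y \<le> exp (- x\<^sup>2 / 2) * normal_density x 1 y" for y
  proof (cases "x < y")
    case True
    have "x * (y - x) \<ge> 0" using True assms by simp
    then have "- y\<^sup>2 / 2 \<le> - x\<^sup>2 / 2 + (- (y - x)\<^sup>2 / 2)"
      by (simp add: power2_eq_square algebra_simps)
    then have "exp (- y\<^sup>2 / 2) \<le> exp (- x\<^sup>2 / 2) * exp (- (y - x)\<^sup>2 / 2)"
      by (simp flip: exp_add)
    then have "exp (- y\<^sup>2 / 2) / sqrt (2 * pi) \<le> exp (- x\<^sup>2 / 2) * exp (- (y - x)\<^sup>2 / 2) / sqrt (2 * pi)"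
      by (rule divide_right_mono) simp
    then show ?thesis using True by (simp add: normal_density_def)
  next
    case False then show ?thesis by (simp add: normal_density_nonneg)
  qed
  then have "(\<integral>y. std_normal_density y * indicator {x<..} y \<partial>lborel)
      \<le> (\<integral>y. exp (- x\<^sup>2 / 2) * normal_density x 1 y \<partial>lborel)"
    by (intro integral_mono gaussian_tail_integrable) auto
  also have "\<dots> = exp (- x\<^sup>2 / 2)" by (simp add: integral_normal_density)
  finally show ?thesis by (simp add: gaussian_tail_eq)
qed

text \<open>Only the interval from x to x + h is kept, on which the density is at least its value at
  the right end. The choice h = 1/x later recovers the order of the Mills ratio.\<close>

lemma gaussian_tail_lower:
  assumes "0 \<le> x" "0 \<le> h"
  shows "h * std_normal_density (x + h) \<le> 1 - std_normal_cdf x"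
proof -
  have "std_normal_density (x + h) * indicator {x<..x+h} y \<le> std_normal_density y * indicator {x<..} y" for y
  proof (cases "y \<in> {x<..x+h}")
    case True
    then have "y\<^sup>2 \<le> (x+h)\<^sup>2" using assms by (intro power_mono) auto
    then have "exp (- (x+h)\<^sup>2 / 2) \<le> exp (- y\<^sup>2 / 2)" by simp
    then show ?thesis using True by (auto simp: normal_density_def intro: divide_right_mono)
  next
    case False then show ?thesis by (simp add: normal_density_nonneg)
  qed
  then have "(\<integral>y. std_normal_density (x + h) * indicator {x<..x+h} y \<partial>lborel)
      \<le> (\<integral>y. std_normal_density y * indicator {x<..} y \<partial>lborel)"
    by (intro integral_mono gaussian_tail_integrable integrable_mult_right integrable_real_indicator)
       (use assms in simp_all)
  then show ?thesis using assms by (simp add: gaussian_tail_eq mult.commute)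
qed

text \<open>\<open>inv\<close> returns a preimage as soon as one exists, and continuity together
  with the limits 0 and 1 provides one.\<close>

lemma std_normal_cdf_inv:
  assumes "0 < a" "a < 1"
  shows "std_normal_cdf (inv std_normal_cdf a) = a"
proof -
  interpret N: real_distribution std_normal_distribution by (rule real_dist_normal_dist)
  have cont: "isCont std_normal_cdf x" for x
    unfolding std_normal_cdf_def N.isCont_cdf
    by (subst measure_def, subst emeasure_density)
       (auto simp: nn_integral_indicator_singleton intro!: nn_integral_null_delta)
  have "\<forall>\<^sub>F x in at_bot. std_normal_cdf x < a"
    unfolding std_normal_cdf_def using N.cdf_lim_at_bot assms by (auto intro: order_tendstoD)
  moreover have "\<forall>\<^sub>F x in at_top. std_normal_cdf x > a"
    unfolding std_normal_cdf_def using N.cdf_lim_at_top_prob assms by (auto intro: order_tendstoD)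
  ultimately obtain x y where xy: "std_normal_cdf x < a" "std_normal_cdf y > a"
    by (meson eventually_happens trivial_limit_at_bot_linorder trivial_limit_at_top_linorder)
  have "x \<le> y"
    using xy N.cdf_nondecreasing[of y x] unfolding std_normal_cdf_def by linarith
  then obtain z where "std_normal_cdf z = a"
    using IVT[of std_normal_cdf x a y] xy cont by force
  then show ?thesis by (intro f_inv_into_f) auto
qed

text \<open>Here 1/m is the tail mass beyond x. The lower bound on x^2 lets the threshold dominate
  log |V_O|; the last bound says that exp (- x^2/2) exceeds the tail mass by at most a factor of
  order x.\<close>

lemma normal_quantile_bounds:
  fixes m x :: real
  assumes m: "1000 \<le> m" and x: "x = inv std_normal_cdf (1 - 1 / m)"
  shows "1 \<le> x" "x\<^sup>2 \<le> 2 * ln m" "ln m - 4 \<le> x\<^sup>2" "exp (- x\<^sup>2 / 2) \<le> 13 * x / m"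
proof -
  have cdf: "1 - std_normal_cdf x = 1 / m"
    unfolding x by (subst std_normal_cdf_inv) (use m in auto)
  interpret N: real_distribution std_normal_distribution by (rule real_dist_normal_dist)
  have s2pi: "sqrt (2 * pi) \<le> 3"
    using pi_less_4 by (intro real_le_lsqrt) auto
  show x1: "1 \<le> x"
  proof (rule ccontr)
    \<comment> \<open>For x < 1 the tail at 1 would be at most 1/1000, whereas it is at least the
      density at 2, which is at least exp (-2) / 3 >= 1/27.\<close>
    assume "\<not> 1 \<le> x"
    then have "1 - std_normal_cdf 1 \<le> 1 / m"
      using N.cdf_nondecreasing[of x 1] cdf unfolding std_normal_cdf_def by linarith
    then have "std_normal_density 2 \<le> 1 / m"
      using gaussian_tail_lower[of 1 1] by simp
    moreover have "std_normal_density 2 = exp (- 2) / sqrt (2 * pi)"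
      by (simp add: normal_density_def)
    moreover have "exp (- 2) / sqrt (2 * pi) \<ge> exp (-2) / (3::real)"
      using s2pi by (intro divide_left_mono) auto
    moreover have "exp (-2::real) \<ge> 1 / 9"
    proof -
      have "exp (2::real) = (exp 1)\<^sup>2" by (simp flip: exp_double)
      also have "\<dots> \<le> 3\<^sup>2" using exp_le by (intro power_mono) auto
      finally show ?thesis by (simp add: exp_minus field_simps)
    qed
    moreover have "1 / m \<le> 1/1000" using m by (intro divide_left_mono) auto
    ultimately show False by linarith
  qed
  have "1 / m \<le> exp (- x\<^sup>2 / 2)" using gaussian_tail_upper[of x] x1 cdf by simp
  then have "ln (1 / m) \<le> - x\<^sup>2 / 2" using m by (metis ln_exp ln_mono zero_less_divide_1_iff less_le_trans zero_less_numeral)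
  then show "x\<^sup>2 \<le> 2 * ln m" using m by (simp add: ln_div)
  \<comment> \<open>Moving from x to x + 1/x raises the exponent by at most 3/2, because (x + 1/x)^2
    <= x^2 + 3 for x >= 1; the number 13 bounds exp (3/2) sqrt (2 pi).\<close>
  define D where "D = std_normal_density (x + 1/x)"
  have "1/x * D \<le> 1 / m"
    unfolding D_def using gaussian_tail_lower[of x "1/x"] x1 cdf by simp
  then have "D \<le> x / m" using x1 m by (simp add: field_simps)
  moreover have "D \<ge> exp (- x\<^sup>2/2) / 13"
  proof -
    have "(1/x)\<^sup>2 \<le> 1" using x1 by (simp add: power_le_one)
    then have "(x + 1/x)\<^sup>2 \<le> x\<^sup>2 + 3" using x1 by (simp add: power2_sum)
    then have "exp (- (x + 1/x)\<^sup>2/2) \<ge> exp (- x\<^sup>2/2 - 3/2)" by simp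
    moreover have "exp (- x\<^sup>2/2 - 3/2) = exp (- x\<^sup>2/2) / exp (3/2)" by (simp add: exp_diff)
    moreover have "exp (3/2::real) \<le> 4.8"
    proof -
      have "(exp (3/2::real))\<^sup>2 = exp 3" by (simp flip: exp_double)
      also have "exp (3::real) = (exp 1)^3" by (simp flip: exp_of_nat_mult)
      also have "\<dots> \<le> 2.72^3" using e_less_272 by (intro power_mono) auto
      also have "\<dots> \<le> 4.8\<^sup>2" by (simp add: power2_eq_square power3_eq_cube)
      finally show ?thesis by (rule power2_le_imp_le) simp
    qed
    moreover have "exp (- x\<^sup>2/2) / exp (3/2) \<ge> exp (- x\<^sup>2/2) / 4.8"
      using calculation(3) by (intro divide_left_mono) auto
    ultimately have "exp (- (x + 1/x)\<^sup>2/2) \<ge> exp (- x\<^sup>2/2) / 4.8" by linarith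
    moreover have "sqrt (2 * pi) \<le> 2.52"
    proof (rule real_le_lsqrt)
      show "2 * pi \<le> 2.52\<^sup>2" using pi_approx by (simp add: power2_eq_square)
    qed auto
    ultimately have "exp (- x\<^sup>2/2) / 4.8 / 2.52 \<le> exp (- (x + 1/x)\<^sup>2/2) / sqrt (2 * pi)"
      by (intro frac_le) auto
    moreover have "exp (- x\<^sup>2/2) / 13 \<le> exp (- x\<^sup>2/2) / 4.8 / 2.52" by simp
    ultimately have "exp (- x\<^sup>2/2) / 13 \<le> exp (- (x + 1/x)\<^sup>2/2) / sqrt (2 * pi)" by linarith
    then show ?thesis by (simp add: D_def normal_density_def)
  qed
  ultimately show e: "exp (- x\<^sup>2 / 2) \<le> 13 * x / m"
    by simp
  have "ln (exp (- x\<^sup>2 / 2)) \<le> ln (13 * x / m)"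
    using e by (intro ln_mono) auto
  then have "- x\<^sup>2 / 2 \<le> ln 13 + ln x - ln m" using x1 m by (simp add: ln_mult ln_div)
  moreover have "ln x \<le> x\<^sup>2/2 - 1/2"
    using ln_le_minus_one[of "x\<^sup>2"] x1 by (simp add: ln_realpow)
  moreover have "ln (13::real) \<le> 4"
  proof -
    have "ln (13::real) \<le> ln (2^4)" by (intro ln_mono) auto
    also have "\<dots> = 4 * ln 2" by (subst ln_realpow) auto
    finally show ?thesis using ln_2_less_1 by linarith
  qed
  ultimately show "ln m - 4 \<le> x\<^sup>2" by linarith
qed

section \<open>Self-tuned $\ell_1$ regression and thresholding\<close>

text \<open>Cauchy-Schwarz with the weights |u l| gives (u . x)^2 <= |u|_1 times the sum of |u l| (x
  l)^2, so that only the regressors one at a time have to be controlled.\<close>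

lemma weighted_l2_le_l1:
  fixes x :: "'t \<Rightarrow> 'i \<Rightarrow> real" and w :: "'t \<Rightarrow> real"
  assumes fin: "finite I" and M: "\<And>l. l \<in> I \<Longrightarrow> (\<Sum>t\<in>T. (x t l)\<^sup>2 * (w t)\<^sup>2) \<le> m"
  shows "(\<Sum>t\<in>T. (\<Sum>l\<in>I. u l * x t l)\<^sup>2 * (w t)\<^sup>2) \<le> (\<Sum>l\<in>I. \<bar>u l\<bar>)\<^sup>2 * m"
proof -
  have cs: "(\<Sum>l\<in>I. u l * x t l)\<^sup>2 \<le> (\<Sum>l\<in>I. \<bar>u l\<bar>) * (\<Sum>l\<in>I. \<bar>u l\<bar> * (x t l)\<^sup>2)" for t
  proof -
    have eq: "(\<Sum>l\<in>I. u l * x t l) = (\<Sum>l\<in>I. sqrt \<bar>u l\<bar> * (sgn (u l) * sqrt \<bar>u l\<bar> * x t l))"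
      by (intro sum.cong refl) (auto simp: sgn_if)
    have "(\<Sum>l\<in>I. u l * x t l)\<^sup>2 \<le>
        (\<Sum>l\<in>I. (sqrt \<bar>u l\<bar>)\<^sup>2) * (\<Sum>l\<in>I. (sgn (u l) * sqrt \<bar>u l\<bar> * x t l)\<^sup>2)"
      unfolding eq by (rule Cauchy_Schwarz_ineq_sum)
    also have "(\<Sum>l\<in>I. (sgn (u l) * sqrt \<bar>u l\<bar> * x t l)\<^sup>2) = (\<Sum>l\<in>I. \<bar>u l\<bar> * (x t l)\<^sup>2)"
      by (intro sum.cong refl) (auto simp: power_mult_distrib sgn_if)
    finally show ?thesis by simp
  qed
  have "(\<Sum>t\<in>T. (\<Sum>l\<in>I. u l * x t l)\<^sup>2 * (w t)\<^sup>2)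
      \<le> (\<Sum>t\<in>T. (\<Sum>l\<in>I. \<bar>u l\<bar>) * (\<Sum>l\<in>I. \<bar>u l\<bar> * (x t l)\<^sup>2) * (w t)\<^sup>2)"
    by (intro sum_mono mult_right_mono cs) auto
  also have "\<dots> = (\<Sum>l\<in>I. \<bar>u l\<bar>) * (\<Sum>t\<in>T. \<Sum>l\<in>I. \<bar>u l\<bar> * ((x t l)\<^sup>2 * (w t)\<^sup>2))"
    by (simp add: sum_distrib_left sum_distrib_right mult_ac)
  also have "(\<Sum>t\<in>T. \<Sum>l\<in>I. \<bar>u l\<bar> * ((x t l)\<^sup>2 * (w t)\<^sup>2)) = (\<Sum>l\<in>I. \<bar>u l\<bar> * (\<Sum>t\<in>T. (x t l)\<^sup>2 * (w t)\<^sup>2))"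
    by (subst sum.swap) (simp add: sum_distrib_left)
  also have "(\<Sum>l\<in>I. \<bar>u l\<bar>) * \<dots> \<le> (\<Sum>l\<in>I. \<bar>u l\<bar>) * (\<Sum>l\<in>I. \<bar>u l\<bar> * m)"
    by (intro mult_left_mono sum_mono M sum_nonneg) auto
  finally show ?thesis by (simp add: sum_distrib_right[symmetric] power2_eq_square mult.assoc)
qed

text \<open>\<open>e\<close> is the noise, e + Delta . x the residual of the estimate, and
  \<open>zs\<close> the norm of the noise weighted by regressor \<open>j0\<close>. By the triangle
  inequality z' falls below zs by at most mn |Delta|_1. With the weight 1/(4 mn) of the slack in the
  objective this saves at most |Delta|_1 / 4, a fraction that can be absorbed; the factor 4 in tau
  serves this purpose.\<close>

lemma self_tuned_lasso_cone:
  fixes I :: "'i set" and \<theta> \<theta>' :: "'i \<Rightarrow> real" and e :: "nat \<Rightarrow> real" and x :: "nat \<Rightarrow> 'i \<Rightarrow> real"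
  defines "\<Delta> \<equiv> \<lambda>i. \<theta>' i - \<theta> i"
  defines "nrm \<equiv> \<lambda>u :: 'i \<Rightarrow> real. \<Sum>i\<in>I. \<bar>u i\<bar>"
  assumes fin: "finite I" and n: "0 < n"
    and mn: "1 \<le> mn" "\<And>l j. l \<in> I \<Longrightarrow> j \<in> I \<Longrightarrow> (1 / real n) * (\<Sum>t=1..n. (x t l)\<^sup>2 * (x t j)\<^sup>2) \<le> mn\<^sup>2"
    and feas': "\<And>j. j \<in> I \<Longrightarrow>
        sqrt ((1 / n) * (\<Sum>t=1..n. (e t + (\<Sum>i\<in>I. \<Delta> i * x t i))\<^sup>2 * (x t j)\<^sup>2)) \<le> z'"
    and zs: "j0 \<in> I" "zs = sqrt ((1 / n) * (\<Sum>t=1..n. (e t)\<^sup>2 * (x t j0)\<^sup>2))"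
    and opt: "nrm \<theta>' + 1 / (4 * mn) * z' \<le> nrm \<theta> + 1 / (4 * mn) * ((1 + d) * zs)"
    and d: "0 \<le> d"
    and S: "S \<subseteq> I" "(\<Sum>i\<in>I-S. \<bar>\<theta> i\<bar>) \<le> r"
  shows "z' \<le> (1 + d) * zs + 4 * mn * nrm \<Delta>"
    and "nrm \<Delta> \<le> (8/3) * (\<Sum>i\<in>S. \<bar>\<Delta> i\<bar>) + (8/3) * r + (1/3) * (d * zs)"
proof -
  have tri: "nrm \<theta> \<le> nrm \<theta>' + nrm \<Delta>"
    unfolding nrm_def sum.distrib[symmetric] by (intro sum_mono) (auto simp: \<Delta>_def)
  have "4 * mn * (nrm \<theta>' + 1 / (4 * mn) * z') \<le> 4 * mn * (nrm \<theta> + 1 / (4 * mn) * ((1 + d) * zs))"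
    using opt mn(1) by (intro mult_left_mono) auto
  then have "4 * mn * nrm \<theta>' + z' \<le> 4 * mn * nrm \<theta> + (1 + d) * zs"
    using mn(1) by (simp add: distrib_left)
  moreover have "4 * mn * nrm \<theta> \<le> 4 * mn * nrm \<theta>' + 4 * mn * nrm \<Delta>"
    using mult_left_mono[OF tri, of "4 * mn"] mn(1) by (simp add: distrib_left)
  ultimately show "z' \<le> (1 + d) * zs + 4 * mn * nrm \<Delta>" by linarith
  have z0: "0 \<le> zs" unfolding zs by (auto intro!: divide_nonneg_nonneg sum_nonneg)
  let ?L = "\<lambda>f. sqrt ((1 / n) * (\<Sum>t=1..n. (f t)\<^sup>2 * (x t j0)\<^sup>2))"
  have L: "?L f = L2_set (\<lambda>t. f t * x t j0 / sqrt n) {1..n}" for f :: "nat \<Rightarrow> real"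
    by (simp add: L2_set_def power_mult_distrib power_divide sum_divide_distrib)
  let ?\<Delta>x = "\<lambda>t. \<Sum>i\<in>I. \<Delta> i * x t i"
  have "zs = L2_set (\<lambda>t. (e t + ?\<Delta>x t) * x t j0 / sqrt n + (- ?\<Delta>x t) * x t j0 / sqrt n) {1..n}"
    unfolding zs L by (intro L2_set_cong refl) (simp add: algebra_simps add_divide_distrib)
  also have "\<dots> \<le> ?L (\<lambda>t. e t + ?\<Delta>x t) + ?L (\<lambda>t. - ?\<Delta>x t)"
    unfolding L by (rule L2_set_triangle_ineq)
  also have "?L (\<lambda>t. - ?\<Delta>x t) \<le> mn * nrm \<Delta>"
  proof (rule real_le_lsqrt)
    have "(\<Sum>t=1..n. (?\<Delta>x t)\<^sup>2 * (x t j0)\<^sup>2) \<le> (nrm \<Delta>)\<^sup>2 * (n * mn\<^sup>2)"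
      unfolding nrm_def using mn(2)[OF _ zs(1)] n
      by (intro weighted_l2_le_l1 fin) (simp add: divide_le_eq mult.commute)
    then show "1 / real n * (\<Sum>t = 1..n. (- ?\<Delta>x t)\<^sup>2 * (x t j0)\<^sup>2) \<le> (mn * nrm \<Delta>)\<^sup>2"
      using n by (simp add: divide_le_eq power_mult_distrib mult_ac)
  qed (use mn(1) in \<open>auto simp: nrm_def intro!: mult_nonneg_nonneg sum_nonneg\<close>)
  finally have zz: "zs \<le> z' + mn * nrm \<Delta>" using feas'[OF zs(1)] by linarith
  have "1 / (4 * mn) * ((1 + d) * zs) - 1 / (4 * mn) * z' = 1 / (4 * mn) * (zs - z') + 1 / (4 * mn) * (d * zs)"
    by (simp add: algebra_simps diff_divide_distrib add_divide_distrib)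
  also have "\<dots> \<le> 1 / (4 * mn) * (mn * nrm \<Delta>) + 1 / 4 * (d * zs)"
  proof (intro add_mono mult_left_mono mult_right_mono)
    show "1 / (4 * mn) \<le> 1 / 4" using mn(1) by (intro divide_left_mono) auto
  qed (use zz mn(1) d z0 in auto)
  finally have q: "nrm \<theta>' \<le> nrm \<theta> + nrm \<Delta> / 4 + d * zs / 4"
    using opt mn(1) by simp
  have split: "nrm f = (\<Sum>i\<in>S. \<bar>f i\<bar>) + (\<Sum>i\<in>I-S. \<bar>f i\<bar>)" for f :: "'i \<Rightarrow> real"
    unfolding nrm_def using S(1) fin by (metis sum.subset_diff add.commute)
  have a: "(\<Sum>i\<in>S. \<bar>\<theta> i\<bar>) - (\<Sum>i\<in>S. \<bar>\<Delta> i\<bar>) \<le> (\<Sum>i\<in>S. \<bar>\<theta>' i\<bar>)"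
    unfolding sum_subtractf[symmetric] by (intro sum_mono) (auto simp: \<Delta>_def)
  have b: "(\<Sum>i\<in>I-S. \<bar>\<Delta> i\<bar>) - (\<Sum>i\<in>I-S. \<bar>\<theta> i\<bar>) \<le> (\<Sum>i\<in>I-S. \<bar>\<theta>' i\<bar>)"
    unfolding sum_subtractf[symmetric] by (intro sum_mono) (auto simp: \<Delta>_def)
  \<comment> \<open>Splitting over S and I - S gives |Delta| <= 2 |Delta_S| + 2 r + |Delta|/4 + d zs
    / 4, and solving for |Delta| produces the factors 8/3 and 1/3.\<close>
  show "nrm \<Delta> \<le> (8/3) * (\<Sum>i\<in>S. \<bar>\<Delta> i\<bar>) + (8/3) * r + (1/3) * (d * zs)"
    using q a b S(2) split[of \<theta>] split[of \<theta>'] split[of \<Delta>] by linarith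
qed

text \<open>Either the part of Delta on \<open>S\<close> is at most r + d zs and the cone inequality
  already bounds the whole, or it dominates and |Delta|_1 <= 6 |Delta_S|_1, so that the l2 norm
  controls the l1 norm. The estimated slack z' has no a priori bound: it is at most a constant plus
  4 mn |Delta|_1. The quadratic term that results is absorbed by the second smallness condition, as
  the Gram error is by the first.\<close>

lemma self_tuned_lasso_l1:
  fixes I :: "'i set" and \<theta> \<theta>' :: "'i \<Rightarrow> real" and e :: "nat \<Rightarrow> real" and x :: "nat \<Rightarrow> 'i \<Rightarrow> real"
  defines "\<Delta> \<equiv> \<lambda>i. \<theta>' i - \<theta> i"
  defines "nrm \<equiv> \<lambda>u :: 'i \<Rightarrow> real. \<Sum>i\<in>I. \<bar>u i\<bar>"
  assumes fin: "finite I" and n: "0 < n"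
    and mn: "1 \<le> mn" "\<And>l j. l \<in> I \<Longrightarrow> j \<in> I \<Longrightarrow> (1 / real n) * (\<Sum>t=1..n. (x t l)\<^sup>2 * (x t j)\<^sup>2) \<le> mn\<^sup>2"
    and feas'1: "\<And>j. j \<in> I \<Longrightarrow>
        \<bar>(1 / n) * (\<Sum>t=1..n. (e t + (\<Sum>i\<in>I. \<Delta> i * x t i)) * x t j)\<bar> \<le> lam * z'"
    and feas'2: "\<And>j. j \<in> I \<Longrightarrow>
        sqrt ((1 / n) * (\<Sum>t=1..n. (e t + (\<Sum>i\<in>I. \<Delta> i * x t i))\<^sup>2 * (x t j)\<^sup>2)) \<le> z'"
    and feas: "\<And>j. j \<in> I \<Longrightarrow> \<bar>(1 / n) * (\<Sum>t=1..n. e t * x t j)\<bar> \<le> lam * ((1 + d) * zs)"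
    and zs: "j0 \<in> I" "zs = sqrt ((1 / n) * (\<Sum>t=1..n. (e t)\<^sup>2 * (x t j0)\<^sup>2))" "zs \<le> Z"
    and opt: "nrm \<theta>' + 1 / (4 * mn) * z' \<le> nrm \<theta> + 1 / (4 * mn) * ((1 + d) * zs)"
    and d: "0 \<le> d" "d \<le> 1" and lam: "0 \<le> lam"
    and S: "S \<subseteq> I" "(\<Sum>i\<in>I-S. \<bar>\<theta> i\<bar>) \<le> r" "real (card S) \<le> 2 * s" "0 < s"
    and re: "\<And>u. \<kappa> * (\<Sum>i\<in>I. (u i)\<^sup>2) - \<rho> * (nrm u)\<^sup>2 \<le> (1 / n) * (\<Sum>t=1..n. (\<Sum>i\<in>I. u i * x t i)\<^sup>2)"
    and \<kappa>: "0 < \<kappa>" and small: "72 * s * \<rho> \<le> \<kappa> / 4" "72 * s * (4 * mn * lam) \<le> \<kappa> / 4"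
  shows "nrm \<Delta> \<le> 576 * Z / \<kappa> * (s * lam) + 6 * r + 6 * Z * d"
proof -
  have cone: "z' \<le> (1 + d) * zs + 4 * mn * nrm \<Delta>"
    "nrm \<Delta> \<le> (8/3) * (\<Sum>i\<in>S. \<bar>\<Delta> i\<bar>) + (8/3) * r + (1/3) * (d * zs)"
    unfolding nrm_def \<Delta>_def
    by (rule self_tuned_lasso_cone[OF fin n mn feas'2[unfolded \<Delta>_def] zs(1,2) opt[unfolded nrm_def] d(1) S(1,2)]; assumption)+
  have z0: "0 \<le> zs" unfolding zs by (auto intro!: divide_nonneg_nonneg sum_nonneg)
  have N0: "0 \<le> nrm \<Delta>" by (auto simp: nrm_def intro: sum_nonneg)
  have r0: "0 \<le> r" using S(2) by (meson order_trans sum_nonneg abs_ge_zero)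
  have dz: "d * zs \<le> Z * d" "0 \<le> d * zs" using mult_left_mono[OF zs(3) d(1)] d z0 by (auto simp: mult.commute)
  have sl0: "0 \<le> 576 * Z / \<kappa> * (s * lam)" using \<kappa> S(4) lam z0 zs(3) by simp
  show ?thesis
  proof (cases "(\<Sum>i\<in>S. \<bar>\<Delta> i\<bar>) \<le> r + d * zs")
    case True
    then show ?thesis using cone(2) dz sl0 r0 by linarith
  next
    case False
    then have N: "nrm \<Delta> \<le> 6 * (\<Sum>i\<in>S. \<bar>\<Delta> i\<bar>)" using cone(2) dz r0 by linarith
    have "(\<Sum>i\<in>S. \<bar>\<Delta> i\<bar> * 1)\<^sup>2 \<le> (\<Sum>i\<in>S. \<bar>\<Delta> i\<bar>\<^sup>2) * (\<Sum>i\<in>S. 1\<^sup>2)"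
      by (rule Cauchy_Schwarz_ineq_sum)
    then have "(\<Sum>i\<in>S. \<bar>\<Delta> i\<bar>)\<^sup>2 \<le> (\<Sum>i\<in>S. (\<Delta> i)\<^sup>2) * card S" by simp
    also have "\<dots> \<le> (\<Sum>i\<in>I. (\<Delta> i)\<^sup>2) * (2 * s)"
      using S fin by (intro mult_mono sum_mono2) (auto intro: sum_nonneg)
    finally have S2: "(\<Sum>i\<in>S. \<bar>\<Delta> i\<bar>)\<^sup>2 \<le> (\<Sum>i\<in>I. (\<Delta> i)\<^sup>2) * (2 * s)" .
    \<comment> \<open>72 = 6^2 * 2: the square of the cone factor times the 2 from card S <= 2
      s.\<close>
    have "(nrm \<Delta>)\<^sup>2 \<le> (6 * (\<Sum>i\<in>S. \<bar>\<Delta> i\<bar>))\<^sup>2" by (intro power_mono N N0)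
    also have "\<dots> \<le> 72 * s * (\<Sum>i\<in>I. (\<Delta> i)\<^sup>2)" using S2 by (simp add: power_mult_distrib mult_ac)
    finally have N2: "(nrm \<Delta>)\<^sup>2 \<le> 72 * s * (\<Sum>i\<in>I. (\<Delta> i)\<^sup>2)" .
    let ?\<Delta>x = "\<lambda>t. \<Sum>i\<in>I. \<Delta> i * x t i"
    have "(1 / n) * (\<Sum>t=1..n. (?\<Delta>x t)\<^sup>2) = (\<Sum>j\<in>I. \<Delta> j * ((1 / n) * (\<Sum>t=1..n. ?\<Delta>x t * x t j)))"
    proof -
      have "(?\<Delta>x t)\<^sup>2 = (\<Sum>j\<in>I. \<Delta> j * (?\<Delta>x t * x t j))" for t
        by (simp add: power2_eq_square sum_distrib_left mult_ac)
      then have "(\<Sum>t=1..n. (?\<Delta>x t)\<^sup>2) = (\<Sum>j\<in>I. \<Sum>t=1..n. \<Delta> j * (?\<Delta>x t * x t j))"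
        by (simp only:) (rule sum.swap)
      then show ?thesis by (simp add: sum_distrib_left sum_divide_distrib)
    qed
    also have "\<dots> \<le> (\<Sum>j\<in>I. \<bar>\<Delta> j\<bar> * (lam * (z' + (1 + d) * zs)))"
    proof (rule sum_mono)
      fix j assume j: "j \<in> I"
      have "(1 / n) * (\<Sum>t=1..n. ?\<Delta>x t * x t j) =
          (1 / n) * (\<Sum>t=1..n. (e t + ?\<Delta>x t) * x t j) - (1 / n) * (\<Sum>t=1..n. e t * x t j)"
        by (simp add: distrib_right sum.distrib distrib_left flip: diff_divide_distrib)
      then have "\<bar>(1 / n) * (\<Sum>t=1..n. ?\<Delta>x t * x t j)\<bar> \<le> lam * z' + lam * ((1 + d) * zs)"
        using feas'1[OF j] feas[OF j] by linarith
      then have "\<bar>\<Delta> j * ((1 / n) * (\<Sum>t=1..n. ?\<Delta>x t * x t j))\<bar> \<le> \<bar>\<Delta> j\<bar> * (lam * z' + lam * ((1 + d) * zs))"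
        unfolding abs_mult by (rule mult_left_mono) simp
      then have "\<Delta> j * ((1 / n) * (\<Sum>t=1..n. ?\<Delta>x t * x t j)) \<le> \<bar>\<Delta> j\<bar> * (lam * z' + lam * ((1 + d) * zs))"
        by (rule order_trans[OF abs_ge_self])
      then show "\<Delta> j * ((1 / n) * (\<Sum>t=1..n. ?\<Delta>x t * x t j)) \<le> \<bar>\<Delta> j\<bar> * (lam * (z' + (1 + d) * zs))"
        by (simp add: distrib_left)
    qed
    also have "\<dots> = nrm \<Delta> * (lam * (z' + (1 + d) * zs))" by (simp add: nrm_def sum_distrib_right)
    also have "\<dots> \<le> nrm \<Delta> * (lam * (4 * Z + 4 * mn * nrm \<Delta>))"
    proof -
      have "(1 + d) * zs \<le> 2 * Z" using d zs(3) z0 by (intro mult_mono) auto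
      then have "z' + (1 + d) * zs \<le> 4 * Z + 4 * mn * nrm \<Delta>" using cone(1) by linarith
      then show ?thesis using N0 lam by (intro mult_left_mono)
    qed
    finally have "\<kappa> * (\<Sum>i\<in>I. (\<Delta> i)\<^sup>2) \<le> \<rho> * (nrm \<Delta>)\<^sup>2 + nrm \<Delta> * (lam * (4 * Z + 4 * mn * nrm \<Delta>))"
      using re[of \<Delta>] by linarith
    then have "72 * s * (\<kappa> * (\<Sum>i\<in>I. (\<Delta> i)\<^sup>2)) \<le> 72 * s * (\<rho> * (nrm \<Delta>)\<^sup>2 + nrm \<Delta> * (lam * (4 * Z + 4 * mn * nrm \<Delta>)))"
      using S(4) by (intro mult_left_mono) auto
    also have "\<dots> = (72 * s * \<rho>) * (nrm \<Delta>)\<^sup>2 + (72 * s * (4 * mn * lam)) * (nrm \<Delta>)\<^sup>2 + 288 * s * Z * lam * nrm \<Delta>"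
      by (simp add: algebra_simps power2_eq_square)
    also have "\<dots> \<le> \<kappa> / 4 * (nrm \<Delta>)\<^sup>2 + \<kappa> / 4 * (nrm \<Delta>)\<^sup>2 + 288 * s * Z * lam * nrm \<Delta>"
      by (rule add_right_mono, intro add_mono mult_right_mono small) auto
    finally have "\<kappa> * (72 * s * (\<Sum>i\<in>I. (\<Delta> i)\<^sup>2)) \<le> \<kappa> / 2 * (nrm \<Delta>)\<^sup>2 + 288 * s * Z * lam * nrm \<Delta>"
      by (simp add: algebra_simps)
    moreover have "\<kappa> * (nrm \<Delta>)\<^sup>2 \<le> \<kappa> * (72 * s * (\<Sum>i\<in>I. (\<Delta> i)\<^sup>2))"
      using N2 \<kappa> by (intro mult_left_mono) auto
    ultimately have "\<kappa> / 2 * (nrm \<Delta>)\<^sup>2 \<le> 288 * s * Z * lam * nrm \<Delta>" by simp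
    then have "(\<kappa> / 2 * nrm \<Delta>) * nrm \<Delta> \<le> (288 * s * Z * lam) * nrm \<Delta>"
      by (simp add: power2_eq_square mult.assoc)
    moreover have "0 < nrm \<Delta> \<or> nrm \<Delta> = 0" using N0 by auto
    ultimately have "\<kappa> / 2 * nrm \<Delta> \<le> 288 * s * Z * lam"
      using N0 order_trans[OF z0 zs(3)] S(4) lam by (auto simp: mult_le_cancel_right intro!: mult_nonneg_nonneg)
    then have "nrm \<Delta> \<le> 576 * Z / \<kappa> * (s * lam)" using \<kappa> by (simp add: field_simps)
    then show ?thesis using r0 d(1) z0 zs(3) by (smt (verit) mult_nonneg_nonneg)
  qed
qed

text \<open>A kept entry has |w| > \<mu>, which forces |h| > \<mu>/2 >= |w - h|, so keeping it is
  never worse than deleting it. A deleted entry has |h| <= |w| + |w - h| <= 3/2 \<mu>.\<close>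

lemma threshold_entry_error:
  fixes w h \<mu> :: real
  assumes "2 * \<bar>w - h\<bar> \<le> \<mu>"
  shows "\<bar>(if \<bar>w\<bar> > \<mu> then w else 0) - h\<bar> \<le> 3/2 * \<mu>"
    and "\<bar>(if \<bar>w\<bar> > \<mu> then w else 0) - h\<bar> \<le> \<bar>h\<bar>"
  using assms by (auto simp: abs_if split: if_splits)

text \<open>Off the support of \<open>b\<close> the bound |h j| equals |h j - b j|, and these terms
  add up to at most \<open>r\<close>.\<close>

lemma threshold_row_error:
  fixes h b w \<mu> :: "'i \<Rightarrow> real"
  assumes fin: "finite V" and \<mu>: "\<And>j. j \<in> V \<Longrightarrow> 2 * \<bar>w j - h j\<bar> \<le> \<mu> j \<and> \<mu> j \<le> m"
    and b: "card {j\<in>V. b j \<noteq> 0} \<le> s" "(\<Sum>j\<in>V. \<bar>h j - b j\<bar>) \<le> r" and m: "0 \<le> m"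
  shows "(\<Sum>j\<in>V. \<bar>(if \<bar>w j\<bar> > \<mu> j then w j else 0) - h j\<bar>) \<le> s * (3/2 * m) + r"
proof -
  have "\<bar>(if \<bar>w j\<bar> > \<mu> j then w j else 0) - h j\<bar> \<le> (if b j \<noteq> 0 then 3/2 * m else 0) + \<bar>h j - b j\<bar>"
    if j: "j \<in> V" for j
  proof (cases "b j = 0")
    case True
    then show ?thesis using threshold_entry_error(2)[of "w j" "h j" "\<mu> j"] \<mu>[OF j] by simp
  next
    case False
    have "\<bar>(if \<bar>w j\<bar> > \<mu> j then w j else 0) - h j\<bar> \<le> 3/2 * m + 0"
      using threshold_entry_error(1)[of "w j" "h j" "\<mu> j"] \<mu>[OF j] by linarith
    also have "\<dots> \<le> 3/2 * m + \<bar>h j - b j\<bar>" by simp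
    finally show ?thesis using False by simp
  qed
  then have "(\<Sum>j\<in>V. \<bar>(if \<bar>w j\<bar> > \<mu> j then w j else 0) - h j\<bar>)
      \<le> (\<Sum>j\<in>V. if b j \<noteq> 0 then 3/2 * m else 0) + (\<Sum>j\<in>V. \<bar>h j - b j\<bar>)"
    unfolding sum.distrib[symmetric] by (rule sum_mono)
  also have "(\<Sum>j\<in>V. if b j \<noteq> 0 then 3/2 * m else 0) = card {j\<in>V. b j \<noteq> 0} * (3/2 * m)"
    using fin by (subst sum.inter_filter[symmetric]) auto
  also have "\<dots> \<le> s * (3/2 * m)" using b m by (intro mult_right_mono) auto
  finally show ?thesis using b by linarith
qed

text \<open>
  The minimum of the Rayleigh quotient is attained at an eigenvector of \<open>A\<close>; invertibility makes
  its eigenvalue positive, and the reciprocal is an eigenvalue of the inverse.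
\<close>

lemma quadratic_form_lower_bound:
  fixes A B :: "'i \<Rightarrow> 'i \<Rightarrow> real"
  assumes fin: "finite I" and ne: "I \<noteq> {}" and inv: "inverse_mat_on I A B"
    and sym: "\<And>i j. i \<in> I \<Longrightarrow> j \<in> I \<Longrightarrow> A i j = A j i"
    and psd: "\<And>u. 0 \<le> (\<Sum>i\<in>I. \<Sum>j\<in>I. u i * A i j * u j)"
    and eig: "\<And>e. eigenvalue_on I B e \<Longrightarrow> e \<le> Ce"
  shows "0 < Ce" and "(1 / Ce) * (\<Sum>i\<in>I. (u i)\<^sup>2) \<le> (\<Sum>i\<in>I. \<Sum>j\<in>I. u i * A i j * u j)"
proof -
  define Q where "Q = (\<lambda>u v. \<Sum>i\<in>I. \<Sum>j\<in>I. u i * A i j * v j)"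
  define sq where "sq = (\<lambda>u :: 'i \<Rightarrow> real. \<Sum>i\<in>I. (u i)\<^sup>2)"
  \<comment> \<open>Coordinates outside \<open>I\<close> are pinned to 0 and those in
    \<open>I\<close> lie in [-1,1], so the cube is compact by Tychonoff and the unit sphere is a
    closed subset of it.\<close>
  define K where "K = (\<Pi>\<^sub>E i\<in>UNIV. if i \<in> I then {-1..1::real} else {0}) \<inter> {u. sq u = 1}"
  have cont_sq: "continuous_on UNIV sq" unfolding sq_def
    by (intro continuous_intros continuous_on_product_coordinates)
  have cont_Q: "continuous_on UNIV (\<lambda>u. Q u u)" unfolding Q_def
    by (intro continuous_intros continuous_on_product_coordinates)
  have "compactin (product_topology (\<lambda>_. euclidean) UNIV) (\<Pi>\<^sub>E i\<in>UNIV. if i \<in> I then {-1..1::real} else {0})"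
    unfolding compactin_PiE by auto
  then have "compact (\<Pi>\<^sub>E i\<in>UNIV. if i \<in> I then {-1..1::real} else {0})"
    by (simp add: euclidean_product_topology)
  then have "compact K" unfolding K_def
    by (intro compact_Int_closed closed_Collect_eq cont_sq continuous_on_const)
  moreover obtain i0 where i0: "i0 \<in> I" using ne by blast
  have "K \<noteq> {}"
  proof -
    let ?e = "\<lambda>i. if i \<in> I then of_bool (i = i0) else 0 :: real"
    have "sq ?e = (\<Sum>i\<in>I. if i = i0 then 1 else 0)" unfolding sq_def by (intro sum.cong) auto
    then have "?e \<in> K" using i0 fin by (auto simp: K_def)
    then show ?thesis by blast
  qed
  ultimately obtain x where x: "x \<in> K" and min: "\<And>y. y \<in> K \<Longrightarrow> Q x x \<le> Q y y"
    using continuous_attains_inf[of K "\<lambda>u. Q u u"] continuous_on_subset[OF cont_Q] by (meson subset_UNIV)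
  define m where "m = Q x x"
  have sqx: "sq x = 1" using x by (simp add: K_def)
  have m0: "0 \<le> m" unfolding m_def Q_def by (rule psd)
  have sq0: "0 \<le> sq u" for u unfolding sq_def by (intro sum_nonneg) auto
  have Qscale: "Q (\<lambda>i. c * u i) (\<lambda>i. c * u i) = c\<^sup>2 * Q u u" for c u
    by (simp add: Q_def sum_distrib_left power2_eq_square mult_ac)
  have cong: "Q u u = Q v v" "sq u = sq v" if "\<And>i. i \<in> I \<Longrightarrow> u i = v i" for u v
    using that by (auto simp: Q_def sq_def intro!: sum.cong)
  have low: "m * sq u \<le> Q u u" for u
  proof (cases "sq u = 0")
    case True
    then show ?thesis using psd[of u] by (simp add: Q_def)
  next
    case False
    then have pos: "0 < sq u" using sq0[of u] by simp
    define y where "y = (\<lambda>i. if i \<in> I then (1 / sqrt (sq u)) * u i else 0)"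
    have sqy: "sq y = 1"
    proof -
      have "sq y = sq (\<lambda>i. (1 / sqrt (sq u)) * u i)" by (rule cong(2)) (simp add: y_def)
      also have "\<dots> = (1 / sqrt (sq u))\<^sup>2 * sq u" by (simp add: sq_def power_mult_distrib sum_distrib_left power_divide)
      finally show ?thesis using pos by (simp add: power_divide)
    qed
    have "y \<in> K"
    proof -
      have "\<bar>y i\<bar> \<le> 1" if "i \<in> I" for i
      proof -
        have "(y i)\<^sup>2 \<le> sq y" unfolding sq_def by (rule member_le_sum) (use that fin in auto)
        then show ?thesis using sqy by (simp add: abs_square_le_1)
      qed
      then have "- 1 \<le> y i \<and> y i \<le> 1" if "i \<in> I" for i using that by (simp add: abs_le_iff minus_le_iff)
      moreover have "y i = 0" if "i \<notin> I" for i using that by (simp add: y_def)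
      ultimately show ?thesis using sqy by (auto simp: K_def)
    qed
    then have "m \<le> Q y y" using min by (simp add: m_def)
    also have "Q y y = Q (\<lambda>i. (1 / sqrt (sq u)) * u i) (\<lambda>i. (1 / sqrt (sq u)) * u i)"
      by (rule cong(1)) (simp add: y_def)
    also have "\<dots> = Q u u / sq u" unfolding Qscale using pos by (simp add: power_divide)
    finally show ?thesis using pos by (simp add: field_simps)
  qed
  have eigx: "(\<Sum>j\<in>I. A i j * x j) = m * x i" if i: "i \<in> I" for i
  proof -
    define b where "b = (\<Sum>j\<in>I. A i j * x j) - m * x i"
    \<comment> \<open>Minimality along x + t e_i: a quadratic in t without constant term that is
      nonnegative for all t has vanishing linear coefficient.\<close>
    have q: "0 \<le> 2 * t * b + t\<^sup>2 * (A i i - m)" for t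
    proof -
      define u where "u = (\<lambda>k. x k + t * of_bool (k = i))"
      have s1: "sq u = 1 + 2 * t * x i + t\<^sup>2"
      proof -
        have "sq u = (\<Sum>k\<in>I. (x k)\<^sup>2 + (if k = i then 2 * t * x i + t\<^sup>2 else 0))"
          unfolding sq_def u_def by (intro sum.cong) (auto simp: power2_sum algebra_simps)
        also have "\<dots> = 1 + (2 * t * x i + t\<^sup>2)"
          using sqx i fin by (simp add: sum.distrib sq_def)
        finally show ?thesis by simp
      qed
      have s2: "Q u u = m + 2 * t * (\<Sum>j\<in>I. A i j * x j) + t\<^sup>2 * A i i"
      proof -
        have inner: "(\<Sum>l\<in>I. u k * A k l * u l) = (\<Sum>l\<in>I. u k * A k l * x l) + t * u k * A k i" if "k \<in> I" for k
        proof -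
          have "(\<Sum>l\<in>I. u k * A k l * u l) = (\<Sum>l\<in>I. u k * A k l * x l + (if l = i then t * u k * A k i else 0))"
            unfolding u_def by (intro sum.cong) (auto simp: algebra_simps)
          then show ?thesis using i fin by (simp add: sum.distrib)
        qed
        have "Q u u = (\<Sum>k\<in>I. (\<Sum>l\<in>I. u k * A k l * x l) + t * u k * A k i)"
          unfolding Q_def by (intro sum.cong refl inner)
        also have "\<dots> = (\<Sum>k\<in>I. (\<Sum>l\<in>I. x k * A k l * x l) + t * x k * A k i
            + (if k = i then t * (\<Sum>l\<in>I. A i l * x l) + t\<^sup>2 * A i i else 0))"
          unfolding u_def
          by (intro sum.cong) (auto simp: algebra_simps sum.distrib sum_distrib_left power2_eq_square)
        also have "\<dots> = m + t * (\<Sum>k\<in>I. x k * A k i) + (t * (\<Sum>l\<in>I. A i l * x l) + t\<^sup>2 * A i i)"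
          using i fin by (simp add: sum.distrib m_def Q_def sum_distrib_left mult.assoc)
        also have "(\<Sum>k\<in>I. x k * A k i) = (\<Sum>k\<in>I. A i k * x k)"
          by (intro sum.cong refl) (use sym i in \<open>simp add: mult.commute\<close>)
        finally show ?thesis by simp
      qed
      show ?thesis using low[of u] unfolding s1 s2 b_def by (simp add: algebra_simps)
    qed
    have "b = 0"
    proof (rule ccontr)
      assume b: "b \<noteq> 0"
      define c where "c = \<bar>A i i - m\<bar> + 1"
      have c: "c > 0" by (simp add: c_def)
      have "0 \<le> 2 * (- b / c) * b + (- b / c)\<^sup>2 * (A i i - m)" by (rule q)
      also have "\<dots> \<le> 2 * (- b / c) * b + (- b / c)\<^sup>2 * c"
        by (intro add_left_mono mult_left_mono) (auto simp: c_def)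
      also have "\<dots> = - (b\<^sup>2 / c)" using c by (simp add: field_simps power2_eq_square)
      also have "\<dots> < 0" using b c by simp
      finally show False by simp
    qed
    then show ?thesis by (simp add: b_def)
  qed
  have Bx: "m * (\<Sum>j\<in>I. B i j * x j) = x i" if i: "i \<in> I" for i
  proof -
    have "m * (\<Sum>j\<in>I. B i j * x j) = (\<Sum>j\<in>I. B i j * (m * x j))" by (simp add: sum_distrib_left mult_ac)
    also have "\<dots> = (\<Sum>j\<in>I. B i j * (\<Sum>k\<in>I. A j k * x k))" by (intro sum.cong refl) (simp add: eigx)
    also have "\<dots> = (\<Sum>k\<in>I. (\<Sum>j\<in>I. B i j * A j k) * x k)"
      by (simp add: sum_distrib_left sum_distrib_right mult.assoc) (rule sum.swap)
    also have "\<dots> = (\<Sum>k\<in>I. if k = i then x i else 0)"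
      using inv i unfolding inverse_mat_on_def by (intro sum.cong) auto
    finally show ?thesis using i fin by simp
  qed
  obtain i1 where i1: "i1 \<in> I" "x i1 \<noteq> 0"
    using sqx unfolding sq_def by (metis (no_types, lifting) power_zero_numeral sum.neutral zero_neq_one)
  have mpos: "0 < m" using m0 Bx[OF i1(1)] i1(2) by (cases "m = 0") auto
  have "eigenvalue_on I B (1 / m)"
    unfolding eigenvalue_on_def using i1 Bx mpos by (intro exI[of _ x]) (auto simp: field_simps)
  then have "1 / m \<le> Ce" by (rule eig)
  then show C0: "0 < Ce" using mpos by (smt (verit) zero_less_divide_1_iff)
  have "1 / Ce \<le> m" using \<open>1 / m \<le> Ce\<close> C0 mpos by (simp add: field_simps)
  then have "1 / Ce * sq u \<le> m * sq u" by (rule mult_right_mono) (rule sq0)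
  also have "\<dots> \<le> Q u u" by (rule low)
  finally show "(1 / Ce) * (\<Sum>i\<in>I. (u i)\<^sup>2) \<le> (\<Sum>i\<in>I. \<Sum>j\<in>I. u i * A i j * u j)"
    by (simp add: sq_def Q_def)
qed

text \<open>With d an entry of the identity matrix this turns bounds on fourth powers of the step 2
  summands into bounds on their squared deviations, both in expectation and at a sample
  point.\<close>

lemma square_dev_le_fourth:
  fixes y :: real
  assumes "d = 0 \<or> d = 1"
  shows "(y - d)\<^sup>2 \<le> 2 * \<bar>y\<bar>^4 + 4"
proof -
  have "(y - d)\<^sup>2 + (y + d)\<^sup>2 = 2 * y\<^sup>2 + 2 * d\<^sup>2" by (simp add: power2_eq_square algebra_simps)
  moreover have "0 \<le> (y\<^sup>2 - 1)\<^sup>2 + y^4" by simp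
  then have "2 * y\<^sup>2 \<le> 2 * \<bar>y\<bar>^4 + 1"
    by (simp add: power2_diff power_even_abs)
  moreover have "d\<^sup>2 \<le> 1" using assms by auto
  ultimately show ?thesis using zero_le_power2[of "y + d"] by linarith
qed

text \<open>Sparsity and approximation quality are both two-sided, so the row estimate applies to
  the columns as well. The sign of \<open>r\<close> is recorded because it allows r to be enlarged
  to 3 r and makes the remainder bound monotone.\<close>

lemma thresholded_error:
  assumes fin: "finite V" and ne: "V \<noteq> {}" and sp: "sparse_approx_on V s r H"
    and \<mu>: "\<And>k j. k \<in> V \<Longrightarrow> j \<in> V \<Longrightarrow> 2 * \<bar>W k j - H k j\<bar> \<le> \<mu> k j \<and> \<mu> k j \<le> m" and m: "0 \<le> m"
  shows "mat_norm_inf V (\<lambda>k j. thresholded \<mu> W k j - H k j) \<le> s * (3/2 * m) + r"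
    and "mat_norm_1 V (\<lambda>k j. thresholded \<mu> W k j - H k j) \<le> s * (3/2 * m) + r"
    and "0 \<le> r"
proof -
  obtain D where D: "sparse_mat_on V s D" "mat_norm_1 V (\<lambda>i j. H i j - D i j) \<le> r"
    "mat_norm_inf V (\<lambda>i j. H i j - D i j) \<le> r"
    using sp by (auto simp: sparse_approx_on_def)
  have row: "(\<Sum>j\<in>V. \<bar>H i j - D i j\<bar>) \<le> r" if "i \<in> V" for i
    using D(3) that fin unfolding mat_norm_inf_def by (subst (asm) Max_le_iff) auto
  have col: "(\<Sum>i\<in>V. \<bar>H i j - D i j\<bar>) \<le> r" if "j \<in> V" for j
    using D(2) that fin unfolding mat_norm_1_def by (subst (asm) Max_le_iff) auto
  obtain i where i: "i \<in> V" using ne by blast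
  have "0 \<le> (\<Sum>j\<in>V. \<bar>H i j - D i j\<bar>)" by (rule sum_nonneg) simp
  then show "0 \<le> r" using row[OF i] by linarith
  show "mat_norm_inf V (\<lambda>k j. thresholded \<mu> W k j - H k j) \<le> s * (3/2 * m) + r"
    unfolding mat_norm_inf_def thresholded_def
  proof (subst Max_le_iff)
    show "\<forall>a\<in>(\<lambda>k. \<Sum>j\<in>V. \<bar>(if \<bar>W k j\<bar> > \<mu> k j then W k j else 0) - H k j\<bar>) ` V. a \<le> s * (3/2 * m) + r"
      using threshold_row_error[OF fin \<mu> _ row m] D(1) by (auto simp: sparse_mat_on_def)
  qed (use fin ne in auto)
  show "mat_norm_1 V (\<lambda>k j. thresholded \<mu> W k j - H k j) \<le> s * (3/2 * m) + r"
    unfolding mat_norm_1_def thresholded_def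
  proof (subst Max_le_iff)
    show "\<forall>a\<in>(\<lambda>j. \<Sum>k\<in>V. \<bar>(if \<bar>W k j\<bar> > \<mu> k j then W k j else 0) - H k j\<bar>) ` V. a \<le> s * (3/2 * m) + r"
      using threshold_row_error[OF fin, of "\<lambda>k. W k j" "\<lambda>k. H k j" "\<lambda>k. \<mu> k j" m "\<lambda>k. D k j" s r for j]
        \<mu> col m D(1) by (auto simp: sparse_mat_on_def)
  qed (use fin ne in auto)
qed

text \<open>Both programs have an objective that is a sum over rows, and constraints row by row. A
  competitor that changes a single row of the minimizer stays feasible when the new row does, and
  this lemma then gives optimality of that row.\<close>

lemma sum_le_imp_entry_le:
  fixes g h :: "'i \<Rightarrow> real"
  assumes "finite V" "k \<in> V" "(\<Sum>i\<in>V. g i) \<le> (\<Sum>i\<in>V. h i)" "\<And>i. i \<in> V \<Longrightarrow> i \<noteq> k \<Longrightarrow> g i = h i"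
  shows "g k \<le> h k"
proof -
  have "(\<Sum>i\<in>V-{k}. g i) = (\<Sum>i\<in>V-{k}. h i)" using assms by (intro sum.cong) auto
  then show ?thesis using assms(1-3) by (simp add: sum.remove)
qed

lemma mat_inv_on_inverse: "invertible_mat_on I A \<Longrightarrow> inverse_mat_on I A (mat_inv_on I A)"
  unfolding invertible_mat_on_def mat_inv_on_def using someI_ex[of "inverse_mat_on I A"] by simp

section \<open>Moments of the design and of the noise\<close>

text \<open>One element of the array, so that all bounds in this context are nonasymptotic;
  uniformity in the number of periods can be read off from the parameters that occur in
  them.\<close>

locale regular_network =
  fixes N :: "('v, 'w) network" and n :: nat and bM bA bL bP c C Ce Me Mp :: real
  assumes n: "1 \<le> n"
    and network: "linear_network n bM bA bL bP N"
    and data: "regular_data n N"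
    and noise: "regular_noise n c C Me N"
    and covar: "regular_covar n c C Ce Mp N"
    and c: "0 < c" "c < C"
    and Me_ge_1: "1 \<le> Me"
begin

sublocale prob_space "law N"
  using network by (simp add: linear_network_def)

text \<open>The maximum with 1 makes this a bound for every entry of (1;p), including the constant
  one.\<close>

definition "B = max 1 bP"

lemma B_ge_1: "1 \<le> B"
  by (simp add: B_def)

lemma finite_obs: "finite (agents_obs N)" and obs_nonempty: "agents_obs N \<noteq> {}"
  using network by (auto simp: linear_network_def)

lemma finite_Vbar: "finite (Vbar N)"
  by (simp add: Vbar_def finite_obs)

lemma card_Vbar: "card (Vbar N) = card (agents_obs N) + 1"
  unfolding Vbar_def by (subst card_insert_disjoint) (auto simp: finite_obs card_image)

lemma None_in_Vbar: "None \<in> Vbar N" and Some_in_Vbar: "Some i \<in> Vbar N \<longleftrightarrow> i \<in> agents_obs N"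
  by (auto simp: Vbar_def)

lemma obs_data_measurable: "t \<in> {1..n} \<Longrightarrow> obs_data N t \<in> measurable (law N) (data_space N)"
  using data unfolding regular_data_def indep_vars_def by auto

lemma indep_data:
  assumes "g \<in> borel_measurable (data_space N)"
  shows "indep_vars (\<lambda>_. borel) (\<lambda>t \<omega>. g (obs_data N t \<omega>)) {1..n}"
  by (rule indep_vars_compose2[of "\<lambda>_. data_space N"]) (use data assms in \<open>auto simp: regular_data_def\<close>)

definition cov_of :: "'v option \<Rightarrow> ('v \<Rightarrow> real) \<times> ('v \<Rightarrow> real) \<Rightarrow> real" where
  "cov_of j d = (case j of None \<Rightarrow> 1 | Some i \<Rightarrow> fst d i)"

definition eps_of :: "'v \<Rightarrow> ('v \<Rightarrow> real) \<times> ('v \<Rightarrow> real) \<Rightarrow> real" where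
  "eps_of k d = snd d k - v_obs N k + (\<Sum>j\<in>agents_obs N. H_inv N k j * fst d j)"

definition psi_of :: "'v option \<Rightarrow> ('v \<Rightarrow> real) \<times> ('v \<Rightarrow> real) \<Rightarrow> real" where
  "psi_of k d = (\<Sum>m\<in>Vbar N. Psi_bar N k m * cov_of m d)"

text \<open>
  Covariates, noise and the rows of $\bar\Psi (1;p)$ as functions of the observed data, so that
  independence and equality in law across periods carry over. \<open>ns\<close> agrees with \<open>eps\<close> only on
  the sample space.
\<close>

definition "cv t j \<omega> = cov_of j (obs_data N t \<omega>)"
definition "ns t k \<omega> = eps_of k (obs_data N t \<omega>)"
definition "ps t k \<omega> = psi_of k (obs_data N t \<omega>)"

lemma cov_of_measurable[measurable]: "j \<in> Vbar N \<Longrightarrow> cov_of j \<in> borel_measurable (data_space N)"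
  unfolding cov_of_def data_space_def
  by (cases j) (auto simp: Some_in_Vbar intro!: measurable_compose[OF measurable_fst] measurable_component_singleton)

lemma eps_of_measurable[measurable]:
  assumes k: "k \<in> agents_obs N"
  shows "eps_of k \<in> borel_measurable (data_space N)"
proof -
  have 1: "(\<lambda>d. snd d k) \<in> borel_measurable (data_space N)"
    unfolding data_space_def using k
    by (auto intro!: measurable_compose[OF measurable_snd] measurable_component_singleton)
  have 2: "(\<lambda>d. fst d j) \<in> borel_measurable (data_space N)" if "j \<in> agents_obs N" for j
    unfolding data_space_def using that
    by (auto intro!: measurable_compose[OF measurable_fst] measurable_component_singleton)
  show ?thesis unfolding eps_of_def using 1 2
    by (intro borel_measurable_add borel_measurable_diff borel_measurable_sum borel_measurable_times) auto
qed

lemma psi_of_measurable[measurable]: "psi_of k \<in> borel_measurable (data_space N)"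
  unfolding psi_of_def by (intro borel_measurable_sum borel_measurable_times) auto

lemma cv_measurable[measurable]: "t \<in> {1..n} \<Longrightarrow> j \<in> Vbar N \<Longrightarrow> cv t j \<in> borel_measurable (law N)"
  unfolding cv_def using measurable_compose[OF obs_data_measurable cov_of_measurable] by blast

lemma ns_measurable[measurable]: "t \<in> {1..n} \<Longrightarrow> k \<in> agents_obs N \<Longrightarrow> ns t k \<in> borel_measurable (law N)"
  unfolding ns_def using measurable_compose[OF obs_data_measurable eps_of_measurable] by blast

lemma ps_measurable[measurable]: "t \<in> {1..n} \<Longrightarrow> ps t k \<in> borel_measurable (law N)"
  unfolding ps_def using measurable_compose[OF obs_data_measurable psi_of_measurable] by blast

lemma one_p_eq: "j \<in> Vbar N \<Longrightarrow> one_p N t \<omega> j = cv t j \<omega>"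
  by (auto simp: one_p_def cv_def cov_of_def obs_data_def Some_in_Vbar split: option.splits)

lemma row_apply_eq: "row_apply N (Psi_bar N) t \<omega> k = ps t k \<omega>"
  unfolding row_apply_def ps_def psi_of_def cv_def[symmetric] by (intro sum.cong refl) (simp add: one_p_eq)

lemma eps_eq:
  assumes "t \<in> {1..n}" "k \<in> agents_obs N" "\<omega> \<in> space (law N)"
  shows "eps N t k \<omega> = ns t k \<omega>"
proof -
  have "outcome N t k \<omega> = v_obs N k - (\<Sum>j\<in>agents_obs N. H_inv N k j * covar N t j \<omega>) + eps N t k \<omega>"
    using data assms unfolding regular_data_def by blast
  then show ?thesis using assms by (simp add: ns_def eps_of_def obs_data_def)
qed

lemma cv_None: "cv t None \<omega> = 1"
  by (simp add: cv_def cov_of_def)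

lemma AE_cv_bounded: "AE \<omega> in law N. \<forall>t\<in>{1..n}. \<forall>j\<in>Vbar N. \<bar>cv t j \<omega>\<bar> \<le> B"
proof -
  have "AE \<omega> in law N. \<bar>cv t j \<omega>\<bar> \<le> B" if t: "t \<in> {1..n}" and j: "j \<in> Vbar N" for t j
  proof (cases j)
    case None
    then show ?thesis using B_ge_1 by (simp add: cv_None)
  next
    case (Some i)
    then have i: "i \<in> agents_obs N" using j by (simp add: Some_in_Vbar)
    then have "AE \<omega> in law N. \<bar>covar N t i \<omega>\<bar> \<le> bP"
      using network t unfolding linear_network_def agents_def by auto
    moreover have "cv t j \<omega> = covar N t i \<omega>" for \<omega>
      using i by (simp add: Some cv_def cov_of_def obs_data_def)
    ultimately show ?thesis by (auto simp: B_def elim!: eventually_mono)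
  qed
  then show ?thesis using finite_Vbar by (intro AE_finite_allI) auto
qed

lemma AE_cv_bound: "t \<in> {1..n} \<Longrightarrow> j \<in> Vbar N \<Longrightarrow> AE \<omega> in law N. \<bar>cv t j \<omega>\<bar> \<le> B"
  using AE_cv_bounded by (rule eventually_mono) auto

text \<open>This bound may grow with the network. It serves only to establish integrability and
  enters no rate.\<close>

definition "PB = (MAX k\<in>Vbar N. (\<Sum>m\<in>Vbar N. \<bar>Psi_bar N k m\<bar>)) * B"

lemma AE_ps_bound:
  assumes "t \<in> {1..n}" "k \<in> Vbar N"
  shows "AE \<omega> in law N. \<bar>ps t k \<omega>\<bar> \<le> PB"
  using AE_cv_bounded
proof (rule eventually_mono)
  fix \<omega> assume b: "\<forall>t\<in>{1..n}. \<forall>j\<in>Vbar N. \<bar>cv t j \<omega>\<bar> \<le> B"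
  have "\<bar>ps t k \<omega>\<bar> \<le> (\<Sum>m\<in>Vbar N. \<bar>Psi_bar N k m * cv t m \<omega>\<bar>)"
    unfolding ps_def psi_of_def cv_def[symmetric] by (rule sum_abs)
  also have "\<dots> \<le> (\<Sum>m\<in>Vbar N. \<bar>Psi_bar N k m\<bar> * B)"
    using b assms unfolding abs_mult by (intro sum_mono mult_left_mono) auto
  also have "\<dots> = (\<Sum>m\<in>Vbar N. \<bar>Psi_bar N k m\<bar>) * B" by (simp add: sum_distrib_right)
  also have "\<dots> \<le> PB" unfolding PB_def using B_ge_1 finite_Vbar assms
    by (intro mult_right_mono Max_ge) auto
  finally show "\<bar>ps t k \<omega>\<bar> \<le> PB" .
qed

lemma PB_nonneg: "0 \<le> PB"
proof -
  have "AE \<omega> in law N. \<bar>ps 1 None \<omega>\<bar> \<le> PB" using n None_in_Vbar by (intro AE_ps_bound) auto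
  then have "AE \<omega> in law N. 0 \<le> PB" by (rule eventually_mono) linarith
  then show ?thesis using AE_const by blast
qed

lemma AE_bounded_integrable:
  fixes f :: "'w \<Rightarrow> real"
  assumes "f \<in> borel_measurable (law N)" "AE \<omega> in law N. \<bar>f \<omega>\<bar> \<le> b"
  shows "integrable (law N) f"
  by (rule integrable_const_bound[of _ b]) (use assms in auto)

lemma cv_mult_integrable:
  assumes "t \<in> {1..n}" "i \<in> Vbar N" "j \<in> Vbar N"
  shows "integrable (law N) (\<lambda>\<omega>. cv t i \<omega> * cv t j \<omega>)"
proof (rule AE_bounded_integrable[of _ "B * B"])
  show "AE \<omega> in law N. \<bar>cv t i \<omega> * cv t j \<omega>\<bar> \<le> B * B"
    using AE_cv_bound[OF assms(1,2)] AE_cv_bound[OF assms(1,3)]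
    by eventually_elim (auto simp: abs_mult intro!: mult_mono)
qed (use assms in measurable)

lemma expectation_data_eq:
  fixes g :: "_ \<Rightarrow> real"
  assumes g: "g \<in> borel_measurable (data_space N)" and t: "t \<in> {1..n}"
  shows "expectation (\<lambda>\<omega>. g (obs_data N t \<omega>)) = expectation (\<lambda>\<omega>. g (obs_data N 1 \<omega>))"
proof -
  have 1: "1 \<in> {1..n}" using n by simp
  have "expectation (\<lambda>\<omega>. g (obs_data N t' \<omega>)) = integral\<^sup>L (distr (law N) (data_space N) (obs_data N t')) g"
    if "t' \<in> {1..n}" for t'
    by (rule integral_distr[symmetric]) (use obs_data_measurable[OF that] g in auto)
  moreover have "distr (law N) (data_space N) (obs_data N t) = distr (law N) (data_space N) (obs_data N 1)"
    using data t 1 unfolding regular_data_def by blast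
  ultimately show ?thesis using t 1 by simp
qed

section \<open>Second-moment matrix of the design\<close>

lemma second_moment_eq:
  assumes t: "t \<in> {1..n}" and ij: "i \<in> Vbar N" "j \<in> Vbar N"
  shows "expectation (\<lambda>\<omega>. cv t i \<omega> * cv t j \<omega>) = second_moment N i j"
proof -
  have "expectation (\<lambda>\<omega>. cv t i \<omega> * cv t j \<omega>) = expectation (\<lambda>\<omega>. cv 1 i \<omega> * cv 1 j \<omega>)"
    unfolding cv_def
    by (rule expectation_data_eq[where g = "\<lambda>d. cov_of i d * cov_of j d"]) (use t ij in auto)
  then show ?thesis using ij by (simp add: second_moment_def one_p_eq)
qed

lemma second_moment_quadratic:
  "expectation (\<lambda>\<omega>. (\<Sum>i\<in>Vbar N. u i * cv 1 i \<omega>)\<^sup>2) = (\<Sum>i\<in>Vbar N. \<Sum>j\<in>Vbar N. u i * second_moment N i j * u j)"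
proof -
  have 1: "1 \<in> {1..n}" using n by simp
  have "expectation (\<lambda>\<omega>. (\<Sum>i\<in>Vbar N. u i * cv 1 i \<omega>)\<^sup>2)
      = expectation (\<lambda>\<omega>. \<Sum>i\<in>Vbar N. \<Sum>j\<in>Vbar N. u i * (cv 1 i \<omega> * cv 1 j \<omega>) * u j)"
    by (simp add: power2_eq_square sum_product mult_ac)
  also have "\<dots> = (\<Sum>i\<in>Vbar N. \<Sum>j\<in>Vbar N. u i * expectation (\<lambda>\<omega>. cv 1 i \<omega> * cv 1 j \<omega>) * u j)"
    using cv_mult_integrable[OF 1] by simp
  finally show ?thesis using second_moment_eq[OF 1] by simp
qed

lemma Ce_pos: "0 < Ce"
  and second_moment_lower: "(1 / Ce) * (\<Sum>i\<in>Vbar N. (u i)\<^sup>2)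
    \<le> (\<Sum>i\<in>Vbar N. \<Sum>j\<in>Vbar N. u i * second_moment N i j * u j)"
proof -
  have inv: "inverse_mat_on (Vbar N) (second_moment N) (Psi_bar N)"
    using covar unfolding Psi_bar_def by (intro mat_inv_on_inverse) (simp add: regular_covar_def)
  have sym: "second_moment N i j = second_moment N j i" for i j
    by (simp add: second_moment_def mult.commute)
  have psd: "0 \<le> (\<Sum>i\<in>Vbar N. \<Sum>j\<in>Vbar N. u i * second_moment N i j * u j)" for u
    unfolding second_moment_quadratic[symmetric] by (intro Bochner_Integration.integral_nonneg) auto
  have eig: "e \<le> Ce" if "eigenvalue_on (Vbar N) (Psi_bar N) e" for e
    using covar that by (simp add: regular_covar_def)
  have ne: "Vbar N \<noteq> {}" using None_in_Vbar by blast
  note * = quadratic_form_lower_bound[OF finite_Vbar ne inv sym psd eig]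
  show "0 < Ce" by (rule *(1))
  show "(1 / Ce) * (\<Sum>i\<in>Vbar N. (u i)\<^sup>2)
    \<le> (\<Sum>i\<in>Vbar N. \<Sum>j\<in>Vbar N. u i * second_moment N i j * u j)" by (rule *(2))
qed

text \<open>The quadratic form is tested on a unit vector. This keeps every regressor away from 0 in
  mean square, which the variance of the scores needs.\<close>

lemma second_moment_diag:
  assumes j: "j \<in> Vbar N"
  shows "1 / Ce \<le> second_moment N j j"
proof -
  let ?u = "\<lambda>i. of_bool (i = j) :: real"
  have "(\<Sum>i\<in>Vbar N. (?u i)\<^sup>2) = (\<Sum>i\<in>Vbar N. if i = j then 1 else 0)"
    by (intro sum.cong) auto
  moreover have "(\<Sum>i\<in>Vbar N. \<Sum>k\<in>Vbar N. ?u i * second_moment N i k * ?u k)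
      = (\<Sum>i\<in>Vbar N. if i = j then (\<Sum>k\<in>Vbar N. if k = j then second_moment N j j else 0) else 0)"
    by (intro sum.cong) (auto intro!: sum.cong sum.neutral)
  ultimately show ?thesis using second_moment_lower[of ?u] j finite_Vbar by simp
qed

lemma expectation_ps_cv:
  assumes t: "t \<in> {1..n}" and kj: "k \<in> Vbar N" "j \<in> Vbar N"
  shows "expectation (\<lambda>\<omega>. ps t k \<omega> * cv t j \<omega>) = of_bool (k = j)"
proof -
  have inv: "inverse_mat_on (Vbar N) (second_moment N) (Psi_bar N)"
    using covar unfolding Psi_bar_def by (intro mat_inv_on_inverse) (simp add: regular_covar_def)
  have "expectation (\<lambda>\<omega>. ps t k \<omega> * cv t j \<omega>)
      = expectation (\<lambda>\<omega>. \<Sum>m\<in>Vbar N. Psi_bar N k m * (cv t m \<omega> * cv t j \<omega>))"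
    unfolding ps_def psi_of_def cv_def[symmetric] by (simp add: sum_distrib_right mult.assoc)
  also have "\<dots> = (\<Sum>m\<in>Vbar N. Psi_bar N k m * second_moment N m j)"
    using cv_mult_integrable[OF t _ kj(2)] second_moment_eq[OF t _ kj(2)] by simp
  finally show ?thesis using inv kj by (simp add: inverse_mat_on_def)
qed

section \<open>Conditional moments given the covariates\<close>

lemma sigma_covar_subalgebra:
  assumes T: "T \<subseteq> {1..n}"
  shows "subalgebra (law N) (sigma_covar N T)"
proof -
  have "(\<lambda>\<omega>. \<lambda>(t, j)\<in>T \<times> agents_obs N. covar N t j \<omega>)
      \<in> measurable (law N) (PiM (T \<times> agents_obs N) (\<lambda>_. borel))"
  proof (rule measurable_restrict)
    fix p assume "p \<in> T \<times> agents_obs N"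
    then show "(\<lambda>\<omega>. case p of (t, j) \<Rightarrow> covar N t j \<omega>) \<in> borel_measurable (law N)"
      using network T unfolding linear_network_def agents_def by (auto simp: split_beta)
  qed
  then show ?thesis
    unfolding subalgebra_def sigma_covar_def
    by (simp add: measurable_iff_sets)
qed

lemma sigma_covar_sigma_finite:
  "T \<subseteq> {1..n} \<Longrightarrow> sigma_finite_subalgebra (law N) (sigma_covar N T)"
  by (intro finite_measure_subalgebra_is_sigma_finite finite_measure_subalgebra.intro
      finite_measure_subalgebra_axioms.intro sigma_covar_subalgebra) unfold_locales

lemma cv_sigma_covar_measurable:
  assumes "t \<in> T" "j \<in> Vbar N"
  shows "cv t j \<in> borel_measurable (sigma_covar N T)"
proof (cases j)
  case None
  then have "cv t j = (\<lambda>_. 1)" by (auto simp: cv_None)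
  then show ?thesis by simp
next
  case (Some i)
  then have i: "i \<in> agents_obs N" using assms by (simp add: Some_in_Vbar)
  let ?f = "\<lambda>\<omega>. \<lambda>(t, j)\<in>T \<times> agents_obs N. covar N t j \<omega>"
  have "?f \<in> measurable (sigma_covar N T) (PiM (T \<times> agents_obs N) (\<lambda>_. borel))"
    unfolding sigma_covar_def
    by (rule measurable_vimage_algebra1) (auto simp: space_PiM)
  then have "(\<lambda>\<omega>. ?f \<omega> (t, i)) \<in> borel_measurable (sigma_covar N T)"
    by (rule measurable_compose[OF _ measurable_component_singleton]) (use assms i in auto)
  moreover have "(\<lambda>\<omega>. ?f \<omega> (t, i)) = cv t j"
    using assms i by (auto simp: Some cv_def cov_of_def obs_data_def)
  ultimately show ?thesis by simp
qed

lemma eps_measurable: "t \<in> {1..n} \<Longrightarrow> k \<in> agents_obs N \<Longrightarrow> eps N t k \<in> borel_measurable (law N)"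
  using measurable_cong[of "law N" "eps N t k" "ns t k" borel] eps_eq ns_measurable by auto

text \<open>\<open>nc\<close> is the summand of the step 1 score at the true coefficients, with mean
  0; \<open>pc\<close> is the summand of the step 2 constraint at Psi-bar, whose mean is the
  identity matrix.\<close>

definition "nc t k j \<omega> = ns t k \<omega> * cv t j \<omega>"
definition "pc t k j \<omega> = ps t k \<omega> * cv t j \<omega>"

lemma nc_measurable[measurable]:
  "t \<in> {1..n} \<Longrightarrow> k \<in> agents_obs N \<Longrightarrow> j \<in> Vbar N \<Longrightarrow> nc t k j \<in> borel_measurable (law N)"
  unfolding nc_def by measurable

lemma pc_measurable[measurable]:
  "t \<in> {1..n} \<Longrightarrow> j \<in> Vbar N \<Longrightarrow> pc t k j \<in> borel_measurable (law N)"
  unfolding pc_def by measurable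

lemma nc_data: "nc t k j \<omega> = eps_of k (obs_data N t \<omega>) * cov_of j (obs_data N t \<omega>)"
  by (simp add: nc_def ns_def cv_def)

lemma pc_data: "pc t k j \<omega> = psi_of k (obs_data N t \<omega>) * cov_of j (obs_data N t \<omega>)"
  by (simp add: pc_def ps_def cv_def)

text \<open>Given the covariates the noise has second moment at least \<open>c\<close>, and the
  squared regressor has mean at least 1/Ce. Integrability of the product is not yet known at this
  point, hence the computation with nonnegative integrals.\<close>

lemma nc_second_moment_nn:
  assumes t: "t \<in> {1..n}" and k: "k \<in> agents_obs N" and j: "j \<in> Vbar N"
  shows "ennreal (c / Ce) \<le> (\<integral>\<^sup>+\<omega>. ennreal ((nc t k j \<omega>)\<^sup>2) \<partial>law N)"
proof -
  interpret F: sigma_finite_subalgebra "law N" "sigma_covar N {t}"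
    by (rule sigma_covar_sigma_finite) (use t in auto)
  have [measurable]: "cv t j \<in> borel_measurable (sigma_covar N {t})"
    by (rule cv_sigma_covar_measurable) (use j in auto)
  note [measurable] = eps_measurable[OF t k] cv_measurable[OF t j]
  have i: "integrable (law N) (\<lambda>\<omega>. cv t j \<omega> * cv t j \<omega>)" by (rule cv_mult_integrable[OF t j j])
  have "ennreal (c / Ce) \<le> ennreal (c * second_moment N j j)"
    using second_moment_diag[OF j] c by (intro ennreal_leI) (simp add: mult_left_mono divide_inverse)
  also have "\<dots> = ennreal c * ennreal (second_moment N j j)" using c by (simp add: ennreal_mult')
  also have "ennreal (second_moment N j j) = (\<integral>\<^sup>+\<omega>. ennreal ((cv t j \<omega>)\<^sup>2) \<partial>law N)"
    unfolding second_moment_eq[OF t j j, symmetric] power2_eq_square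
    by (rule nn_integral_eq_integral[symmetric, OF i]) simp
  also have "ennreal c * \<dots> = (\<integral>\<^sup>+\<omega>. ennreal ((cv t j \<omega>)\<^sup>2) * ennreal c \<partial>law N)"
    by (subst mult.commute) (rule nn_integral_multc[symmetric], measurable)
  also have "\<dots> \<le> (\<integral>\<^sup>+\<omega>. ennreal ((cv t j \<omega>)\<^sup>2) *
      nn_cond_exp (law N) (sigma_covar N {t}) (\<lambda>\<omega>. ennreal ((eps N t k \<omega>)\<^sup>2)) \<omega> \<partial>law N)"
  proof (rule nn_integral_mono_AE)
    have "AE \<omega> in law N. ennreal c \<le> nn_cond_exp (law N) (sigma_covar N {t}) (\<lambda>\<omega>. ennreal ((eps N t k \<omega>)\<^sup>2)) \<omega>"
      using noise t k unfolding regular_noise_def by auto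
    then show "AE \<omega> in law N. ennreal ((cv t j \<omega>)\<^sup>2) * ennreal c \<le> ennreal ((cv t j \<omega>)\<^sup>2) *
      nn_cond_exp (law N) (sigma_covar N {t}) (\<lambda>\<omega>. ennreal ((eps N t k \<omega>)\<^sup>2)) \<omega>"
      by (rule eventually_mono) (auto intro: mult_left_mono)
  qed
  also have "\<dots> = (\<integral>\<^sup>+\<omega>. ennreal ((cv t j \<omega>)\<^sup>2) * ennreal ((eps N t k \<omega>)\<^sup>2) \<partial>law N)"
    by (rule F.nn_cond_exp_intg) measurable
  also have "\<dots> = (\<integral>\<^sup>+\<omega>. ennreal ((nc t k j \<omega>)\<^sup>2) \<partial>law N)"
    by (intro nn_integral_cong) (simp add: eps_eq[OF t k] nc_def power_mult_distrib ennreal_mult' mult.commute)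
  finally show ?thesis .
qed

text \<open>The covariate factor is measurable for the conditioning sigma-algebra and bounded by
  \<open>B\<close>, so the conditional fourth moment of the noise suffices. Finiteness of this
  integral is the source of all integrability of \<open>nc\<close> and its powers.\<close>

lemma nc_fourth_moment_nn:
  assumes t: "t \<in> {1..n}" and k: "k \<in> agents_obs N" and j: "j \<in> Vbar N"
  shows "(\<integral>\<^sup>+\<omega>. ennreal ((nc t k j \<omega>)^4) \<partial>law N) \<le> ennreal (C * B^4)"
proof -
  interpret F: sigma_finite_subalgebra "law N" "sigma_covar N {t}"
    by (rule sigma_covar_sigma_finite) (use t in auto)
  have [measurable]: "cv t j \<in> borel_measurable (sigma_covar N {t})"
    by (rule cv_sigma_covar_measurable) (use j in auto)
  note [measurable] = eps_measurable[OF t k] cv_measurable[OF t j]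
  have "(\<integral>\<^sup>+\<omega>. ennreal ((nc t k j \<omega>)^4) \<partial>law N)
      = (\<integral>\<^sup>+\<omega>. ennreal ((cv t j \<omega>)^4) * ennreal (\<bar>eps N t k \<omega>\<bar>^4) \<partial>law N)"
  proof (rule nn_integral_cong)
    fix \<omega> assume "\<omega> \<in> space (law N)"
    then have "(nc t k j \<omega>)^4 = (cv t j \<omega>)^4 * \<bar>eps N t k \<omega>\<bar>^4"
      by (simp add: eps_eq[OF t k] nc_def power_mult_distrib power_even_abs mult.commute)
    then show "ennreal ((nc t k j \<omega>)^4) = ennreal ((cv t j \<omega>)^4) * ennreal (\<bar>eps N t k \<omega>\<bar>^4)"
      by (simp add: ennreal_mult')
  qed
  also have "\<dots> = (\<integral>\<^sup>+\<omega>. ennreal ((cv t j \<omega>)^4) *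
      nn_cond_exp (law N) (sigma_covar N {t}) (\<lambda>\<omega>. ennreal (\<bar>eps N t k \<omega>\<bar>^4)) \<omega> \<partial>law N)"
    by (rule F.nn_cond_exp_intg[symmetric]) measurable
  also have "\<dots> \<le> (\<integral>\<^sup>+\<omega>. ennreal (C * B^4) \<partial>law N)"
  proof (rule nn_integral_mono_AE)
    have "AE \<omega> in law N. nn_cond_exp (law N) (sigma_covar N {t}) (\<lambda>\<omega>. ennreal (\<bar>eps N t k \<omega>\<bar>^4)) \<omega> \<le> ennreal C"
      using noise t k unfolding regular_noise_def by auto
    then show "AE \<omega> in law N. ennreal ((cv t j \<omega>)^4) *
      nn_cond_exp (law N) (sigma_covar N {t}) (\<lambda>\<omega>. ennreal (\<bar>eps N t k \<omega>\<bar>^4)) \<omega> \<le> ennreal (C * B^4)"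
      using AE_cv_bound[OF t j]
    proof eventually_elim
      case (elim \<omega>)
      have "(cv t j \<omega>)^4 \<le> B^4" using power_mono[OF elim(2), of 4] by (simp add: power_even_abs)
      then have "ennreal ((cv t j \<omega>)^4) *
        nn_cond_exp (law N) (sigma_covar N {t}) (\<lambda>\<omega>. ennreal (\<bar>eps N t k \<omega>\<bar>^4)) \<omega> \<le> ennreal (B^4) * ennreal C"
        by (intro mult_mono elim ennreal_leI) auto
      also have "\<dots> = ennreal (C * B^4)" using B_ge_1 by (subst ennreal_mult'[symmetric]) (auto simp: mult.commute)
      finally show ?case .
    qed
  qed
  also have "\<dots> = ennreal (C * B^4)" by (simp add: emeasure_space_1)
  finally show ?thesis .
qed

lemma C_pos: "0 < C" and C4_pos: "0 < C * B^4"
  using c B_ge_1 by auto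

lemma nc_moments:
  assumes t: "t \<in> {1..n}" and k: "k \<in> agents_obs N" and j: "j \<in> Vbar N"
  shows nc_int4: "integrable (law N) (\<lambda>\<omega>. ((nc t k j \<omega>)\<^sup>2)\<^sup>2)"
    and nc_int2: "integrable (law N) (\<lambda>\<omega>. (nc t k j \<omega>)\<^sup>2)"
    and nc_int: "integrable (law N) (nc t k j)"
    and nc_E4: "expectation (\<lambda>\<omega>. ((nc t k j \<omega>)\<^sup>2)\<^sup>2) \<le> C * B^4"
    and nc_E2_lower: "c / Ce \<le> expectation (\<lambda>\<omega>. (nc t k j \<omega>)\<^sup>2)"
    and nc_E2_upper: "expectation (\<lambda>\<omega>. (nc t k j \<omega>)\<^sup>2) \<le> 1 + C * B^4"
    and nc_E: "expectation (nc t k j) = 0"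
proof -
  note [measurable] = nc_measurable[OF t k j]
  have p4: "(y\<^sup>2)\<^sup>2 = y^4" for y :: real by simp
  note nn4 = nc_fourth_moment_nn[OF t k j]
  show i4: "integrable (law N) (\<lambda>\<omega>. ((nc t k j \<omega>)\<^sup>2)\<^sup>2)"
    unfolding p4 by (rule integrableI_nonneg) (use le_less_trans[OF nn4] in auto)
  show i2: "integrable (law N) (\<lambda>\<omega>. (nc t k j \<omega>)\<^sup>2)"
  proof (rule Bochner_Integration.integrable_bound)
    show "integrable (law N) (\<lambda>\<omega>. 1 + ((nc t k j \<omega>)\<^sup>2)\<^sup>2)" using i4 by simp
    have "\<bar>y\<^sup>2\<bar> \<le> \<bar>1 + (y\<^sup>2)\<^sup>2\<bar>" for y :: real
      using sum_power2_ge_zero[of "y\<^sup>2 - 1" 0] by (simp add: power2_diff)  (smt (verit) zero_le_power2)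
    then show "AE \<omega> in law N. norm ((nc t k j \<omega>)\<^sup>2) \<le> norm (1 + ((nc t k j \<omega>)\<^sup>2)\<^sup>2)" by simp
  qed measurable
  show i1: "integrable (law N) (nc t k j)"
    by (rule square_integrable_imp_integrable[OF _ i2]) measurable
  show "expectation (\<lambda>\<omega>. ((nc t k j \<omega>)\<^sup>2)\<^sup>2) \<le> C * B^4"
  proof -
    have "ennreal (expectation (\<lambda>\<omega>. ((nc t k j \<omega>)\<^sup>2)\<^sup>2)) \<le> ennreal (C * B^4)"
      using nn4 by (subst nn_integral_eq_integral[symmetric, OF i4]) auto
    then show ?thesis using C4_pos by simp
  qed
  note E4 = this
  show "c / Ce \<le> expectation (\<lambda>\<omega>. (nc t k j \<omega>)\<^sup>2)"
  proof -
    have "ennreal (c / Ce) \<le> ennreal (expectation (\<lambda>\<omega>. (nc t k j \<omega>)\<^sup>2))"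
      using nc_second_moment_nn[OF t k j] by (subst nn_integral_eq_integral[symmetric, OF i2]) auto
    then show ?thesis by (simp add: Bochner_Integration.integral_nonneg)
  qed
  show "expectation (\<lambda>\<omega>. (nc t k j \<omega>)\<^sup>2) \<le> 1 + C * B^4"
  proof -
    have "(y\<^sup>2) \<le> 1 + (y\<^sup>2)\<^sup>2" for y :: real
      using sum_power2_ge_zero[of "y\<^sup>2 - 1" 0] by (simp add: power2_diff) (smt (verit) zero_le_power2)
    then have "expectation (\<lambda>\<omega>. (nc t k j \<omega>)\<^sup>2) \<le> expectation (\<lambda>\<omega>. 1 + ((nc t k j \<omega>)\<^sup>2)\<^sup>2)"
      using i2 i4 by (intro integral_mono) auto
    also have "\<dots> = 1 + expectation (\<lambda>\<omega>. ((nc t k j \<omega>)\<^sup>2)\<^sup>2)" using i4 by (simp add: prob_space)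
    finally show ?thesis using E4 by linarith
  qed
  interpret F: sigma_finite_subalgebra "law N" "sigma_covar N {t}"
    by (rule sigma_covar_sigma_finite) (use t in auto)
  have [measurable]: "cv t j \<in> borel_measurable (sigma_covar N {t})"
    by (rule cv_sigma_covar_measurable) (use j in auto)
  note [measurable] = eps_measurable[OF t k] cv_measurable[OF t j]
  have nceq: "cv t j \<omega> * eps N t k \<omega> = nc t k j \<omega>" if "\<omega> \<in> space (law N)" for \<omega>
    using that by (simp add: eps_eq[OF t k] nc_def)
  have int: "integrable (law N) (\<lambda>\<omega>. cv t j \<omega> * eps N t k \<omega>)"
    using i1 by (subst Bochner_Integration.integrable_cong[OF refl nceq]) auto
  have "expectation (nc t k j) = expectation (\<lambda>\<omega>. cv t j \<omega> * eps N t k \<omega>)"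
    by (rule Bochner_Integration.integral_cong[OF refl nceq[symmetric]])
  also have "\<dots> = expectation (\<lambda>\<omega>. cv t j \<omega> * real_cond_exp (law N) (sigma_covar N {t}) (eps N t k) \<omega>)"
    by (rule F.real_cond_exp_intg(2)[symmetric, OF int]) measurable
  also have "\<dots> = 0"
  proof (rule integral_eq_zero_AE)
    have "AE \<omega> in law N. real_cond_exp (law N) (sigma_covar N {t}) (eps N t k) \<omega> = 0"
      using data t k unfolding regular_data_def by blast
    then show "AE \<omega> in law N. cv t j \<omega> * real_cond_exp (law N) (sigma_covar N {t}) (eps N t k) \<omega> = 0"
      by (rule eventually_mono) simp
  qed
  finally show "expectation (nc t k j) = 0" .
qed

text \<open>Integrating the conditional envelope bound over the covariates gives an unconditional
  one, and Markov's inequality does the rest. Everything stays in \<open>ennreal\<close> because the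
  envelope is a conditional expectation of that kind.\<close>

lemma ns_max_tail:
  assumes u: "0 < u"
  shows "{\<omega>\<in>space (law N). \<exists>t\<in>{1..n}. \<exists>k\<in>agents_obs N. u \<le> \<bar>ns t k \<omega>\<bar>^4} \<in> events"
    and "prob {\<omega>\<in>space (law N). \<exists>t\<in>{1..n}. \<exists>k\<in>agents_obs N. u \<le> \<bar>ns t k \<omega>\<bar>^4} \<le> Me / u"
proof -
  interpret F: sigma_finite_subalgebra "law N" "sigma_covar N {1..n}"
    by (rule sigma_covar_sigma_finite) auto
  let ?A = "{\<omega>\<in>space (law N). \<exists>t\<in>{1..n}. \<exists>k\<in>agents_obs N. u \<le> \<bar>ns t k \<omega>\<bar>^4}"
  show A: "?A \<in> events"
  proof (rule sets.sets_Collect_finite_Ex)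
    fix t assume t: "t \<in> {1..n}"
    show "{\<omega>\<in>space (law N). \<exists>k\<in>agents_obs N. u \<le> \<bar>ns t k \<omega>\<bar>^4} \<in> events"
      using t by (intro sets.sets_Collect_finite_Ex finite_obs) measurable
  qed simp
  let ?I = "{1..n} \<times> agents_obs N"
  let ?g = "\<lambda>\<omega>. MAX (t, j)\<in>?I. \<bar>eps N t j \<omega>\<bar>^4"
  have finI: "finite ?I" by (simp add: finite_obs)
  have g: "?g \<in> borel_measurable (law N)"
    using eps_measurable by (intro borel_measurable_Max finI) (auto simp: split_beta)
  have "(\<integral>\<^sup>+\<omega>. ennreal (?g \<omega>) \<partial>law N) = (\<integral>\<^sup>+\<omega>. 1 * ennreal (?g \<omega>) \<partial>law N)" by simp
  also have "\<dots> = (\<integral>\<^sup>+\<omega>. 1 * nn_cond_exp (law N) (sigma_covar N {1..n}) (\<lambda>\<omega>. ennreal (?g \<omega>)) \<omega> \<partial>law N)"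
    by (rule F.nn_cond_exp_intg[symmetric]) (use g in auto)
  also have "\<dots> \<le> (\<integral>\<^sup>+\<omega>. ennreal Me \<partial>law N)"
    using noise unfolding regular_noise_def by (intro nn_integral_mono_AE) (auto simp: split_beta)
  finally have gMe: "(\<integral>\<^sup>+\<omega>. ennreal (?g \<omega>) \<partial>law N) \<le> ennreal Me" by (simp add: emeasure_space_1)
  have "?A \<subseteq> {\<omega>\<in>space (law N). 1 \<le> ennreal (1/u) * ennreal (?g \<omega>)}"
  proof
    fix \<omega> assume "\<omega> \<in> ?A"
    then obtain t k where \<omega>: "\<omega> \<in> space (law N)" "t \<in> {1..n}" "k \<in> agents_obs N" "u \<le> \<bar>ns t k \<omega>\<bar>^4" by blast
    have "(\<lambda>(t, j). \<bar>eps N t j \<omega>\<bar>^4) (t, k) \<le> ?g \<omega>"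
      by (rule Max_ge) (use finI \<omega> in auto)
    then have "u \<le> ?g \<omega>" using \<omega> by (simp add: eps_eq)
    then have "1 \<le> 1/u * ?g \<omega>" using u by (simp add: field_simps)
    then have "ennreal 1 \<le> ennreal (1/u * ?g \<omega>)" by (rule ennreal_leI)
    moreover have "ennreal (1/u * ?g \<omega>) = ennreal (1/u) * ennreal (?g \<omega>)"
      by (rule ennreal_mult') (use u in simp)
    ultimately show "\<omega> \<in> {\<omega>\<in>space (law N). 1 \<le> ennreal (1/u) * ennreal (?g \<omega>)}"
      using \<omega>(1) by (simp only: ennreal_1 mem_Collect_eq)
  qed
  then have "emeasure (law N) ?A \<le> emeasure (law N) {\<omega>\<in>space (law N). 1 \<le> ennreal (1/u) * ennreal (?g \<omega>)}"
    using g by (intro emeasure_mono) auto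
  also have "\<dots> \<le> ennreal (1/u) * (\<integral>\<^sup>+\<omega>. ennreal (?g \<omega>) * indicator (space (law N)) \<omega> \<partial>law N)"
    by (rule nn_integral_Markov_inequality) (use g in auto)
  also have "(\<integral>\<^sup>+\<omega>. ennreal (?g \<omega>) * indicator (space (law N)) \<omega> \<partial>law N) = (\<integral>\<^sup>+\<omega>. ennreal (?g \<omega>) \<partial>law N)"
    by (intro nn_integral_cong) simp
  also have "ennreal (1/u) * \<dots> \<le> ennreal (1/u) * ennreal Me" by (intro mult_left_mono gMe) auto
  also have "\<dots> = ennreal (Me / u)" using u by (simp add: ennreal_mult'[symmetric])
  finally show "prob ?A \<le> Me / u"
    using u Me_ge_1 by (simp add: emeasure_eq_measure)
qed

lemma AE_pc_bound:
  assumes "t \<in> {1..n}" "k \<in> Vbar N" "j \<in> Vbar N"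
  shows "AE \<omega> in law N. \<bar>pc t k j \<omega>\<bar> \<le> PB * B"
  using AE_ps_bound[OF assms(1,2)] AE_cv_bound[OF assms(1,3)]
  by eventually_elim (auto simp: pc_def abs_mult intro!: mult_mono PB_nonneg)

lemma pc_moments:
  assumes t: "t \<in> {1..n}" and k: "k \<in> Vbar N" and j: "j \<in> Vbar N"
  shows pc_int: "integrable (law N) (pc t k j)"
    and pc_int4: "integrable (law N) (\<lambda>\<omega>. \<bar>pc t k j \<omega>\<bar>^4)"
    and pc_int2: "integrable (law N) (\<lambda>\<omega>. (pc t k j \<omega> - of_bool (k = j))\<^sup>2)"
    and pc_E: "expectation (\<lambda>\<omega>. pc t k j \<omega> - of_bool (k = j)) = 0"
    and pc_E4: "expectation (\<lambda>\<omega>. \<bar>pc t k j \<omega>\<bar>^4) \<le> C"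
    and pc_E2: "expectation (\<lambda>\<omega>. (pc t k j \<omega> - of_bool (k = j))\<^sup>2) \<le> 2 * C + 4"
proof -
  note [measurable] = pc_measurable[OF t j]
  note b = AE_pc_bound[OF t k j]
  show i1: "integrable (law N) (pc t k j)" by (rule AE_bounded_integrable[OF _ b]) measurable
  have "AE \<omega> in law N. \<bar>\<bar>pc t k j \<omega>\<bar>^4\<bar> \<le> (PB * B)^4"
    using b
  proof (rule eventually_mono)
    fix \<omega> assume "\<bar>pc t k j \<omega>\<bar> \<le> PB * B"
    then have "\<bar>pc t k j \<omega>\<bar>^4 \<le> (PB * B)^4" by (rule power_mono) simp
    then show "\<bar>\<bar>pc t k j \<omega>\<bar>^4\<bar> \<le> (PB * B)^4" by simp
  qed
  then show i4: "integrable (law N) (\<lambda>\<omega>. \<bar>pc t k j \<omega>\<bar>^4)" by (rule AE_bounded_integrable[rotated]) measurable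
  have "AE \<omega> in law N. \<bar>(pc t k j \<omega> - of_bool (k = j))\<^sup>2\<bar> \<le> (PB * B + 1)\<^sup>2"
    using b
  proof (rule eventually_mono)
    fix \<omega> assume "\<bar>pc t k j \<omega>\<bar> \<le> PB * B"
    then have "\<bar>pc t k j \<omega> - of_bool (k = j)\<bar> \<le> PB * B + 1" by (cases "k = j") auto
    then have "\<bar>pc t k j \<omega> - of_bool (k = j)\<bar>\<^sup>2 \<le> (PB * B + 1)\<^sup>2" by (rule power_mono) simp
    then show "\<bar>(pc t k j \<omega> - of_bool (k = j))\<^sup>2\<bar> \<le> (PB * B + 1)\<^sup>2" by simp
  qed
  then show i2: "integrable (law N) (\<lambda>\<omega>. (pc t k j \<omega> - of_bool (k = j))\<^sup>2)"
    by (rule AE_bounded_integrable[rotated]) measurable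
  have "expectation (pc t k j) = of_bool (k = j)" using expectation_ps_cv[OF t k j] by (simp add: pc_def[abs_def])
  then show "expectation (\<lambda>\<omega>. pc t k j \<omega> - of_bool (k = j)) = 0"
    using i1 by (simp add: prob_space)
  show E4: "expectation (\<lambda>\<omega>. \<bar>pc t k j \<omega>\<bar>^4) \<le> C"
  proof -
    have "expectation (\<lambda>\<omega>. \<bar>row_apply N (Psi_bar N) t \<omega> k * one_p N t \<omega> j\<bar>^4) \<le> C"
      using covar t k j unfolding regular_covar_def by blast
    then show ?thesis using j by (simp add: row_apply_eq one_p_eq pc_def)
  qed
  have "(pc t k j \<omega> - of_bool (k = j))\<^sup>2 \<le> 2 * \<bar>pc t k j \<omega>\<bar>^4 + 4" for \<omega>
    by (rule square_dev_le_fourth) auto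
  then have "expectation (\<lambda>\<omega>. (pc t k j \<omega> - of_bool (k = j))\<^sup>2) \<le> expectation (\<lambda>\<omega>. 2 * \<bar>pc t k j \<omega>\<bar>^4 + 4)"
    using i2 i4 by (intro integral_mono) auto
  also have "\<dots> = 2 * expectation (\<lambda>\<omega>. \<bar>pc t k j \<omega>\<bar>^4) + 4" using i4 by (simp add: prob_space del: power_even_abs)
  finally show "expectation (\<lambda>\<omega>. (pc t k j \<omega> - of_bool (k = j))\<^sup>2) \<le> 2 * C + 4" using E4 by linarith
qed

text \<open>The envelope is a Bochner integral, so the maximum must first be shown to be integrable
  before Markov's inequality applies; the almost sure bound \<open>PB * B\<close> supplies
  this.\<close>

lemma pc_max_tail:
  assumes u: "0 < u"
  shows "{\<omega>\<in>space (law N). \<exists>t\<in>{1..n}. \<exists>k\<in>Vbar N. \<exists>j\<in>Vbar N. u \<le> \<bar>pc t k j \<omega>\<bar>^4} \<in> events"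
    and "prob {\<omega>\<in>space (law N). \<exists>t\<in>{1..n}. \<exists>k\<in>Vbar N. \<exists>j\<in>Vbar N. u \<le> \<bar>pc t k j \<omega>\<bar>^4} \<le> Mp / u"
proof -
  let ?A = "{\<omega>\<in>space (law N). \<exists>t\<in>{1..n}. \<exists>k\<in>Vbar N. \<exists>j\<in>Vbar N. u \<le> \<bar>pc t k j \<omega>\<bar>^4}"
  show "?A \<in> events"
    by (intro sets.sets_Collect_finite_Ex finite_Vbar finite_atLeastAtMost) measurable
  let ?I = "{1..n} \<times> Vbar N \<times> Vbar N"
  let ?g = "\<lambda>\<omega>. MAX (t, j, k)\<in>?I. \<bar>pc t k j \<omega>\<bar>^4"
  have finI: "finite ?I" by (simp add: finite_Vbar)
  have neI: "?I \<noteq> {}" using n None_in_Vbar by auto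
  have g: "?g \<in> borel_measurable (law N)"
    by (intro borel_measurable_Max finI) (auto simp: split_beta)
  have g0: "0 \<le> ?g \<omega>" for \<omega>
    using finI neI by (subst Max_ge_iff) auto
  have "AE \<omega> in law N. \<forall>t\<in>{1..n}. \<forall>k\<in>Vbar N. \<forall>j\<in>Vbar N. \<bar>pc t k j \<omega>\<bar> \<le> PB * B"
    using AE_pc_bound finite_Vbar by (intro AE_finite_allI) auto
  then have "AE \<omega> in law N. \<bar>?g \<omega>\<bar> \<le> (PB * B)^4"
  proof (rule eventually_mono)
    fix \<omega> assume *: "\<forall>t\<in>{1..n}. \<forall>k\<in>Vbar N. \<forall>j\<in>Vbar N. \<bar>pc t k j \<omega>\<bar> \<le> PB * B"
    have "\<bar>pc t k j \<omega>\<bar>^4 \<le> (PB * B)^4" if "t \<in> {1..n}" "k \<in> Vbar N" "j \<in> Vbar N" for t k j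
      by (rule power_mono) (use * that in auto)
    then have "?g \<omega> \<le> (PB * B)^4"
      using finI neI by (subst Max_le_iff) auto
    then show "\<bar>?g \<omega>\<bar> \<le> (PB * B)^4" using g0[of \<omega>] by linarith
  qed
  then have gi: "integrable (law N) ?g" by (rule AE_bounded_integrable[OF g])
  have "expectation (\<lambda>\<omega>. MAX (t, j, k)\<in>?I. \<bar>row_apply N (Psi_bar N) t \<omega> k * one_p N t \<omega> j\<bar>^4) \<le> Mp"
    using covar unfolding regular_covar_def by blast
  moreover have "(MAX (t, j, k)\<in>?I. \<bar>row_apply N (Psi_bar N) t \<omega> k * one_p N t \<omega> j\<bar>^4) = ?g \<omega>" for \<omega>
    by (intro arg_cong[where f = Max] image_cong refl) (auto simp: row_apply_eq one_p_eq pc_def)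
  ultimately have gMp: "expectation ?g \<le> Mp" by simp
  have "prob ?A \<le> prob {\<omega>\<in>space (law N). u \<le> ?g \<omega>}"
  proof (rule finite_measure_mono)
    show "?A \<subseteq> {\<omega>\<in>space (law N). u \<le> ?g \<omega>}"
    proof
      fix \<omega> assume "\<omega> \<in> ?A"
      then obtain t k j where \<omega>: "\<omega> \<in> space (law N)" "t \<in> {1..n}" "k \<in> Vbar N" "j \<in> Vbar N" "u \<le> \<bar>pc t k j \<omega>\<bar>^4" by blast
      have "(\<lambda>(t, j, k). \<bar>pc t k j \<omega>\<bar>^4) (t, j, k) \<le> ?g \<omega>"
        by (rule Max_ge[OF finite_imageI[OF finI] imageI]) (use \<omega> in simp)
      then show "\<omega> \<in> {\<omega>\<in>space (law N). u \<le> ?g \<omega>}" using \<omega> by simp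
    qed
  qed (use g in measurable)
  also have "\<dots> \<le> expectation ?g / u"
    by (rule integral_Markov_inequality_measure[OF gi, where A = "space (law N)"]) (use g0 u in auto)
  also have "\<dots> \<le> Mp / u" using gMp u by (intro divide_right_mono) auto
  finally show "prob ?A \<le> Mp / u" .
qed

section \<open>Concentration\<close>

definition "nq k j = (\<Sum>t=1..n. expectation (\<lambda>\<omega>. (nc t k j \<omega>)\<^sup>2))"

definition bad :: "'i set \<Rightarrow> 'j set \<Rightarrow> ('i \<Rightarrow> 'j \<Rightarrow> 'w \<Rightarrow> bool) \<Rightarrow> 'w set" where
  "bad I J P = {\<omega>\<in>space (law N). \<exists>i\<in>I. \<exists>j\<in>J. P i j \<omega>}"

lemma indep_nc:
  assumes "k \<in> agents_obs N" "j \<in> Vbar N"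
  shows "indep_vars (\<lambda>_. borel) (\<lambda>t. nc t k j) {1..n}"
    and "indep_vars (\<lambda>_. borel) (\<lambda>t \<omega>. (nc t k j \<omega>)\<^sup>2) {1..n}"
  unfolding nc_data[abs_def]
  by (intro indep_data indep_data[of "\<lambda>d. (eps_of k d * cov_of j d)\<^sup>2"]; use assms in measurable)+

lemma indep_pc:
  assumes "j \<in> Vbar N"
  shows "indep_vars (\<lambda>_. borel) (\<lambda>t \<omega>. pc t k j \<omega> - of_bool (k = j)) {1..n}"
    and "indep_vars (\<lambda>_. borel) (\<lambda>t \<omega>. \<bar>pc t k j \<omega>\<bar>^4) {1..n}"
  unfolding pc_data
  by (intro indep_data[of "\<lambda>d. psi_of k d * cov_of j d - of_bool (k = j)"]
      indep_data[of "\<lambda>d. \<bar>psi_of k d * cov_of j d\<bar>^4"]; use assms in measurable)+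

lemma indep_gram:
  assumes "i \<in> Vbar N" "j \<in> Vbar N"
  shows "indep_vars (\<lambda>_. borel) (\<lambda>t \<omega>. cv t i \<omega> * cv t j \<omega> - second_moment N i j) {1..n}"
  unfolding cv_def
  by (rule indep_data[of "\<lambda>d. cov_of i d * cov_of j d - second_moment N i j"]) (use assms in measurable)

lemma nq_bounds:
  assumes "k \<in> agents_obs N" "j \<in> Vbar N"
  shows "n * (c / Ce) \<le> nq k j" "nq k j \<le> n * (1 + C * B^4)" "0 < nq k j"
proof -
  have "(\<Sum>t=1..n. c / Ce) \<le> nq k j"
    unfolding nq_def by (intro sum_mono nc_E2_lower assms)
  then show 1: "n * (c / Ce) \<le> nq k j" by simp
  have "0 < n * (c / Ce)" using n c Ce_pos by simp
  then show "0 < nq k j" using 1 by linarith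
  have "nq k j \<le> (\<Sum>t=1..n. 1 + C * B^4)"
    unfolding nq_def by (intro sum_mono nc_E2_upper assms)
  then show "nq k j \<le> n * (1 + C * B^4)" by simp
qed

text \<open>The deviation event carries the range of the sum of squares in which its exponential
  inequality is valid. Leaving this range is a separate event: \<open>lower_dev\<close> below,
  \<open>upper_dev\<close> above. The same pattern recurs in \<open>gram_dev\<close> and
  \<open>psi_dev\<close>, where the range is guaranteed at the sample point by other bounds.\<close>

definition score_dev :: "real \<Rightarrow> real \<Rightarrow> 'v \<Rightarrow> 'v option \<Rightarrow> 'w \<Rightarrow> bool" where
  "score_dev x d k j \<omega> \<longleftrightarrow> x * (1 + d) * sqrt (\<Sum>t=1..n. (nc t k j \<omega>)\<^sup>2) \<le> \<bar>\<Sum>t=1..n. nc t k j \<omega>\<bar> \<and>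
           (1 - d) * nq k j \<le> (\<Sum>t=1..n. (nc t k j \<omega>)\<^sup>2) \<and> (\<Sum>t=1..n. (nc t k j \<omega>)\<^sup>2) \<le> 25 * nq k j"

lemma nc_score_tail:
  assumes x: "0 \<le> x" and d: "0 \<le> d" "d \<le> 1/2"
  shows "bad (agents_obs N) (Vbar N) (score_dev x d) \<in> events" (is ?ev)
    and "prob (bad (agents_obs N) (Vbar N) (score_dev x d)) \<le> card (agents_obs N) * (card (Vbar N) * (2 * exp (- x\<^sup>2 / 2)))" (is ?pr)
proof -
  have ev: "{\<omega>\<in>space (law N). score_dev x d k j \<omega>} \<in> events" if "k \<in> agents_obs N" "j \<in> Vbar N" for k j
    unfolding score_dev_def using that by measurable
  have le: "prob {\<omega>\<in>space (law N). score_dev x d k j \<omega>} \<le> 2 * exp (- x\<^sup>2 / 2)" if kj: "k \<in> agents_obs N" "j \<in> Vbar N" for k j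
    unfolding score_dev_def
    by (rule self_normalized_tail[OF finite_atLeastAtMost indep_nc(1)[OF kj] nc_int[OF _ kj] nc_int2[OF _ kj]
          nc_E[OF _ kj] nq_def[symmetric] nq_bounds(3)[OF kj] x d])
  show ?ev unfolding bad_def by (rule prob_bex2_le(1)[OF finite_obs finite_Vbar ev le])
  show ?pr unfolding bad_def by (rule prob_bex2_le(2)[OF finite_obs finite_Vbar ev le])
qed

definition lower_dev :: "real \<Rightarrow> 'v \<Rightarrow> 'v option \<Rightarrow> 'w \<Rightarrow> bool" where
  "lower_dev d k j \<omega> \<longleftrightarrow> (\<Sum>t=1..n. (nc t k j \<omega>)\<^sup>2) \<le> nq k j - d * nq k j"

lemma nc_lower_tail:
  fixes d :: real
  assumes d: "0 \<le> d"
  shows "bad (agents_obs N) (Vbar N) (lower_dev d) \<in> events" (is ?ev)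
    and "prob (bad (agents_obs N) (Vbar N) (lower_dev d)) \<le> card (agents_obs N) * (card (Vbar N) * exp (- (d\<^sup>2 * n * (c / Ce)\<^sup>2 / (2 * (C * B^4)))))" (is ?pr)
proof -
  have ev: "{\<omega>\<in>space (law N). lower_dev d k j \<omega>} \<in> events" if "k \<in> agents_obs N" "j \<in> Vbar N" for k j
    unfolding lower_dev_def using that by measurable
  have le: "prob {\<omega>\<in>space (law N). lower_dev d k j \<omega>} \<le> exp (- (d\<^sup>2 * n * (c / Ce)\<^sup>2 / (2 * (C * B^4))))"
    if kj: "k \<in> agents_obs N" "j \<in> Vbar N" for k j
  proof -
    have q: "(\<Sum>t=1..n. expectation (\<lambda>\<omega>. ((nc t k j \<omega>)\<^sup>2)\<^sup>2)) \<le> n * (C * B^4)"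
      using sum_mono[of "{1..n}" "\<lambda>t. expectation (\<lambda>\<omega>. ((nc t k j \<omega>)\<^sup>2)\<^sup>2)" "\<lambda>_. C * B^4"] nc_E4[OF _ kj] by simp
    have "prob {\<omega>\<in>space (law N). lower_dev d k j \<omega>} \<le> exp (- (d * nq k j)\<^sup>2 / (2 * (n * (C * B^4))))"
      unfolding lower_dev_def nq_def
    proof (rule nonneg_sum_lower_tail[OF finite_atLeastAtMost indep_nc(2)[OF kj] nc_int2[OF _ kj] nc_int4[OF _ kj] _ q])
      show "0 \<le> d * (\<Sum>t=1..n. expectation (\<lambda>\<omega>. (nc t k j \<omega>)\<^sup>2))"
        using d nq_bounds(3)[OF kj] by (simp add: nq_def)
      show "0 < real n * (C * B ^ 4)" using n C4_pos by simp
    qed simp_all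
    also have "\<dots> \<le> exp (- (d\<^sup>2 * n * (c / Ce)\<^sup>2 / (2 * (C * B^4))))"
    proof -
      have "(n * (c / Ce))\<^sup>2 \<le> (nq k j)\<^sup>2"
        by (rule power_mono[OF nq_bounds(1)[OF kj]]) (use c Ce_pos in simp)
      then have "d\<^sup>2 * (n * (c / Ce))\<^sup>2 / (2 * (n * (C * B^4))) \<le> d\<^sup>2 * (nq k j)\<^sup>2 / (2 * (n * (C * B^4)))"
        using C4_pos by (intro divide_right_mono mult_left_mono) auto
      moreover have "d\<^sup>2 * (n * (c / Ce))\<^sup>2 / (2 * (n * (C * B^4))) = d\<^sup>2 * n * (c / Ce)\<^sup>2 / (2 * (C * B^4))"
        using n by (simp add: power2_eq_square mult_ac)
      ultimately show ?thesis by (simp add: power_mult_distrib)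
    qed
    finally show ?thesis .
  qed
  show ?ev unfolding bad_def by (rule prob_bex2_le(1)[OF finite_obs finite_Vbar ev le])
  show ?pr unfolding bad_def by (rule prob_bex2_le(2)[OF finite_obs finite_Vbar ev le])
qed

definition upper_dev :: "real \<Rightarrow> 'v \<Rightarrow> 'v option \<Rightarrow> 'w \<Rightarrow> bool" where
  "upper_dev U k j \<omega> \<longleftrightarrow> 25 * nq k j \<le> (\<Sum>t=1..n. (nc t k j \<omega>)\<^sup>2) \<and> (\<forall>t\<in>{1..n}. (nc t k j \<omega>)\<^sup>2 \<le> U)"

lemma nc_upper_tail:
  assumes U: "0 < U"
  shows "bad (agents_obs N) (Vbar N) (upper_dev U) \<in> events" (is ?ev)
    and "prob (bad (agents_obs N) (Vbar N) (upper_dev U)) \<le> card (agents_obs N) * (card (Vbar N) * exp (- (23 * (n * (c / Ce)) / U)))" (is ?pr)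
proof -
  have ev: "{\<omega>\<in>space (law N). upper_dev U k j \<omega>} \<in> events" if "k \<in> agents_obs N" "j \<in> Vbar N" for k j
    unfolding upper_dev_def using that by measurable
  have le: "prob {\<omega>\<in>space (law N). upper_dev U k j \<omega>} \<le> exp (- (23 * (n * (c / Ce)) / U))"
    if kj: "k \<in> agents_obs N" "j \<in> Vbar N" for k j
  proof -
    have "prob {\<omega>\<in>space (law N). upper_dev U k j \<omega>} \<le> exp ((2 * nq k j - 25 * nq k j) / U)"
      unfolding upper_dev_def nq_def
      by (rule nonneg_sum_upper_tail[OF finite_atLeastAtMost indep_nc(2)[OF kj] nc_int2[OF _ kj] _ U]) simp_all
    also have "\<dots> \<le> exp (- (23 * (n * (c / Ce)) / U))"
    proof -
      have "23 * (n * (c / Ce)) / U \<le> 23 * nq k j / U"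
        using nq_bounds(1)[OF kj] U by (intro divide_right_mono mult_left_mono) auto
      moreover have "(2 * nq k j - 25 * nq k j) / U = - (23 * nq k j / U)" by simp
      ultimately show ?thesis by (simp only: exp_le_cancel_iff)
    qed
    finally show ?thesis .
  qed
  show ?ev unfolding bad_def by (rule prob_bex2_le(1)[OF finite_obs finite_Vbar ev le])
  show ?pr unfolding bad_def by (rule prob_bex2_le(2)[OF finite_obs finite_Vbar ev le])
qed

section \<open>Deviations of the Gram matrix and of the step 2 summands\<close>

lemma AE_gram_bound:
  assumes "t \<in> {1..n}" "i \<in> Vbar N" "j \<in> Vbar N"
  shows "AE \<omega> in law N. \<bar>cv t i \<omega> * cv t j \<omega>\<bar> \<le> B\<^sup>2"
  using AE_cv_bound[OF assms(1,2)] AE_cv_bound[OF assms(1,3)]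
  by eventually_elim (auto simp: abs_mult power2_eq_square intro!: mult_mono)

lemma second_moment_abs_le:
  assumes "i \<in> Vbar N" "j \<in> Vbar N"
  shows "\<bar>second_moment N i j\<bar> \<le> B\<^sup>2"
proof -
  have 1: "1 \<in> {1..n}" using n by simp
  have "\<bar>second_moment N i j\<bar> \<le> expectation (\<lambda>\<omega>. \<bar>cv 1 i \<omega> * cv 1 j \<omega>\<bar>)"
    unfolding second_moment_eq[OF 1 assms, symmetric] by (rule integral_abs_bound)
  also have "\<dots> \<le> expectation (\<lambda>_. B\<^sup>2)"
    by (rule integral_mono_AE) (use cv_mult_integrable[OF 1 assms] AE_gram_bound[OF 1 assms] in auto)
  finally show ?thesis by (simp add: prob_space)
qed

lemma gram_dev_square_le:
  assumes "i \<in> Vbar N" "j \<in> Vbar N" "\<bar>y\<bar> \<le> B\<^sup>2"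
  shows "(y - second_moment N i j)\<^sup>2 \<le> 4 * B^4"
proof -
  have "\<bar>y - second_moment N i j\<bar> \<le> 2 * B\<^sup>2" using second_moment_abs_le[OF assms(1,2)] assms(3) by linarith
  then have "\<bar>y - second_moment N i j\<bar>\<^sup>2 \<le> (2 * B\<^sup>2)\<^sup>2" by (rule power_mono) simp
  then show ?thesis by (simp add: power_mult_distrib)
qed

definition gram_dev :: "real \<Rightarrow> 'v option \<Rightarrow> 'v option \<Rightarrow> 'w \<Rightarrow> bool" where
  "gram_dev u i j \<omega> \<longleftrightarrow> u \<le> \<bar>\<Sum>t=1..n. cv t i \<omega> * cv t j \<omega> - second_moment N i j\<bar> \<and>
      (\<Sum>t=1..n. (cv t i \<omega> * cv t j \<omega> - second_moment N i j)\<^sup>2) \<le> n * (4 * B^4)"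

lemma gram_tail:
  assumes u: "0 \<le> u"
  shows "bad (Vbar N) (Vbar N) (gram_dev u) \<in> events" (is ?ev)
    and "prob (bad (Vbar N) (Vbar N) (gram_dev u)) \<le> card (Vbar N) * (card (Vbar N) * (2 * exp (- u\<^sup>2 / (2 * (n * (4 * B^4))))))" (is ?pr)
proof -
  have ev: "{\<omega>\<in>space (law N). gram_dev u i j \<omega>} \<in> events" if "i \<in> Vbar N" "j \<in> Vbar N" for i j
    unfolding gram_dev_def using that by measurable
  have le: "prob {\<omega>\<in>space (law N). gram_dev u i j \<omega>} \<le> 2 * exp (- u\<^sup>2 / (2 * (n * (4 * B^4))))"
    if ij: "i \<in> Vbar N" "j \<in> Vbar N" for i j
    unfolding gram_dev_def
  proof (rule centered_sum_tail[OF finite_atLeastAtMost indep_gram[OF ij]])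
    have b: "AE \<omega> in law N. (cv t i \<omega> * cv t j \<omega> - second_moment N i j)\<^sup>2 \<le> 4 * B^4" if "t \<in> {1..n}" for t
      using AE_gram_bound[OF that ij] by (rule eventually_mono) (rule gram_dev_square_le[OF ij])
    show int2: "integrable (law N) (\<lambda>\<omega>. (cv t i \<omega> * cv t j \<omega> - second_moment N i j)\<^sup>2)" if t: "t \<in> {1..n}" for t
      by (rule AE_bounded_integrable[of _ "4 * B^4"]) (use t ij b[OF t] in auto)
    have "(\<Sum>t=1..n. expectation (\<lambda>\<omega>. (cv t i \<omega> * cv t j \<omega> - second_moment N i j)\<^sup>2)) \<le> (\<Sum>t=1..n. 4 * B^4)"
    proof (rule sum_mono)
      fix t assume t: "t \<in> {1..n}"
      have "expectation (\<lambda>\<omega>. (cv t i \<omega> * cv t j \<omega> - second_moment N i j)\<^sup>2) \<le> expectation (\<lambda>_. 4 * B^4)"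
        by (rule integral_mono_AE) (use int2[OF t] b[OF t] in auto)
      then show "expectation (\<lambda>\<omega>. (cv t i \<omega> * cv t j \<omega> - second_moment N i j)\<^sup>2) \<le> 4 * B^4"
        by (simp add: prob_space)
    qed
    then show "(\<Sum>t=1..n. expectation (\<lambda>\<omega>. (cv t i \<omega> * cv t j \<omega> - second_moment N i j)\<^sup>2)) \<le> n * (4 * B^4)"
      by simp
    show "0 < n * (4 * B^4)" using n B_ge_1 by simp
  qed (use ij u in \<open>simp_all add: cv_mult_integrable second_moment_eq prob_space\<close>)
  show ?ev unfolding bad_def by (rule prob_bex2_le(1)[OF finite_Vbar finite_Vbar ev le])
  show ?pr unfolding bad_def by (rule prob_bex2_le(2)[OF finite_Vbar finite_Vbar ev le])
qed

text \<open>4 C + 12 = 2 (2 C + 4) + 4 is what \<open>square_dev_le_fourth\<close> yields from the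
  bound on the fourth powers in \<open>psi4_dev\<close>; it also dominates the expected
  squares.\<close>

definition psi_dev :: "real \<Rightarrow> 'v option \<Rightarrow> 'v option \<Rightarrow> 'w \<Rightarrow> bool" where
  "psi_dev u k j \<omega> \<longleftrightarrow> u \<le> \<bar>\<Sum>t=1..n. pc t k j \<omega> - of_bool (k = j)\<bar> \<and>
      (\<Sum>t=1..n. (pc t k j \<omega> - of_bool (k = j))\<^sup>2) \<le> n * (4 * C + 12)"

lemma pc_mean_tail:
  assumes u: "0 \<le> u"
  shows "bad (Vbar N) (Vbar N) (psi_dev u) \<in> events" (is ?ev)
    and "prob (bad (Vbar N) (Vbar N) (psi_dev u)) \<le> card (Vbar N) * (card (Vbar N) * (2 * exp (- u\<^sup>2 / (2 * (n * (4 * C + 12))))))" (is ?pr)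
proof -
  have ev: "{\<omega>\<in>space (law N). psi_dev u k j \<omega>} \<in> events" if "k \<in> Vbar N" "j \<in> Vbar N" for k j
    unfolding psi_dev_def using that by measurable
  have le: "prob {\<omega>\<in>space (law N). psi_dev u k j \<omega>} \<le> 2 * exp (- u\<^sup>2 / (2 * (n * (4 * C + 12))))"
    if kj: "k \<in> Vbar N" "j \<in> Vbar N" for k j
    unfolding psi_dev_def
  proof (rule centered_sum_tail[OF finite_atLeastAtMost indep_pc(1)[OF kj(2)]])
    have "(\<Sum>t=1..n. expectation (\<lambda>\<omega>. (pc t k j \<omega> - of_bool (k = j))\<^sup>2)) \<le> (\<Sum>t=1..n. 4 * C + 12)"
      using pc_E2[OF _ kj] C_pos by (intro sum_mono) (smt (verit))
    then show "(\<Sum>t=1..n. expectation (\<lambda>\<omega>. (pc t k j \<omega> - of_bool (k = j))\<^sup>2)) \<le> n * (4 * C + 12)"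
      by simp
    show "0 < n * (4 * C + 12)" using n C_pos by simp
    show "integrable (law N) (\<lambda>\<omega>. pc t k j \<omega> - of_bool (k = j))" if "t \<in> {1..n}" for t
      using pc_int[OF that kj] by simp
  qed (use pc_int2[OF _ kj] pc_E[OF _ kj] u in auto)
  show ?ev unfolding bad_def by (rule prob_bex2_le(1)[OF finite_Vbar finite_Vbar ev le])
  show ?pr unfolding bad_def by (rule prob_bex2_le(2)[OF finite_Vbar finite_Vbar ev le])
qed

text \<open>The part 2 C n covers the doubled mean of the fourth powers, and the additional 4 n
  produces the exponent 4 n / U.\<close>

definition psi4_dev :: "real \<Rightarrow> 'v option \<Rightarrow> 'v option \<Rightarrow> 'w \<Rightarrow> bool" where
  "psi4_dev U k j \<omega> \<longleftrightarrow> n * (2 * C + 4) \<le> (\<Sum>t=1..n. \<bar>pc t k j \<omega>\<bar>^4) \<and> (\<forall>t\<in>{1..n}. \<bar>pc t k j \<omega>\<bar>^4 \<le> U)"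

lemma pc_fourth_tail:
  assumes U: "0 < U"
  shows "bad (Vbar N) (Vbar N) (psi4_dev U) \<in> events" (is ?ev)
    and "prob (bad (Vbar N) (Vbar N) (psi4_dev U)) \<le> card (Vbar N) * (card (Vbar N) * exp (- (4 * n / U)))" (is ?pr)
proof -
  have ev: "{\<omega>\<in>space (law N). psi4_dev U k j \<omega>} \<in> events" if "k \<in> Vbar N" "j \<in> Vbar N" for k j
    unfolding psi4_dev_def using that by measurable
  have le: "prob {\<omega>\<in>space (law N). psi4_dev U k j \<omega>} \<le> exp (- (4 * n / U))"
    if kj: "k \<in> Vbar N" "j \<in> Vbar N" for k j
  proof -
    let ?m = "\<Sum>t=1..n. expectation (\<lambda>\<omega>. \<bar>pc t k j \<omega>\<bar>^4)"
    have "prob {\<omega>\<in>space (law N). psi4_dev U k j \<omega>} \<le> exp ((2 * ?m - n * (2 * C + 4)) / U)"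
      unfolding psi4_dev_def
      by (rule nonneg_sum_upper_tail[OF finite_atLeastAtMost indep_pc(2)[OF kj(2)] pc_int4[OF _ kj] _ U]) simp_all
    also have "?m \<le> (\<Sum>t=1..n. C)" by (intro sum_mono pc_E4 kj)
    then have "2 * ?m - n * (2 * C + 4) \<le> - (4 * real n)" by (simp add: algebra_simps)
    then have "exp ((2 * ?m - n * (2 * C + 4)) / U) \<le> exp (- (4 * n / U))"
      using U divide_right_mono by fastforce
    finally show ?thesis .
  qed
  show ?ev unfolding bad_def by (rule prob_bex2_le(1)[OF finite_Vbar finite_Vbar ev le])
  show ?pr unfolding bad_def by (rule prob_bex2_le(2)[OF finite_Vbar finite_Vbar ev le])
qed

section \<open>The good event and its probability\<close>

definition "L = ln (real (card (agents_obs N)))"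

text \<open>The two square-root bounds are chosen so that the exponential inequalities give 2 exp (-
  4 L) = 2 p^(-4), with p the number of observable agents; a union over at most (2 p)^2 index pairs
  leaves order p^(-2). The score bound alone is tied to the quantile x.\<close>

definition good :: "real \<Rightarrow> real \<Rightarrow> 'w \<Rightarrow> bool" where
  "good x d \<omega> \<longleftrightarrow>
     (\<forall>t\<in>{1..n}. \<forall>j\<in>Vbar N. \<bar>cv t j \<omega>\<bar> \<le> B) \<and>
     (\<forall>i\<in>Vbar N. \<forall>j\<in>Vbar N.
        \<bar>\<Sum>t=1..n. cv t i \<omega> * cv t j \<omega> - second_moment N i j\<bar> \<le> sqrt (32 * B^4 * n * L)) \<and>
     (\<forall>k\<in>Vbar N. \<forall>j\<in>Vbar N.
        (\<Sum>t=1..n. \<bar>pc t k j \<omega>\<bar>^4) \<le> n * (2 * C + 4) \<and>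
        (\<Sum>t=1..n. (pc t k j \<omega> - of_bool (k = j))\<^sup>2) \<le> n * (4 * C + 12) \<and>
        \<bar>\<Sum>t=1..n. pc t k j \<omega> - of_bool (k = j)\<bar> \<le> sqrt (8 * (4 * C + 12) * n * L)) \<and>
     (\<forall>k\<in>agents_obs N. \<forall>j\<in>Vbar N.
        (\<Sum>t=1..n. (nc t k j \<omega>)\<^sup>2) \<le> 25 * nq k j \<and>
        \<bar>\<Sum>t=1..n. nc t k j \<omega>\<bar> \<le> x * (1 + d) * sqrt (\<Sum>t=1..n. (nc t k j \<omega>)\<^sup>2))"

text \<open>The exceptional probability consists of union bounds of order p^(-2), Markov bounds at
  the two truncation levels, and the score tail. The value of \<open>d\<close> makes the exponent in
  the lower tail of the squared scores equal to 4 L.\<close>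

lemma good_event:
  assumes p: "2 \<le> card (agents_obs N)" and x: "0 \<le> x"
    and d: "d = sqrt (8 * (C * B^4) * L / (n * (c / Ce)\<^sup>2))" "d \<le> 1/2"
  obtains A where "A \<in> events" "\<And>\<omega>. \<omega> \<in> A \<Longrightarrow> good x d \<omega>"
    "1 - (28 / (card (agents_obs N))\<^sup>2 + Mp * L / n + Me * (B\<^sup>2 * L / (n * (c / Ce)))\<^sup>2
        + 4 * (card (agents_obs N))\<^sup>2 * exp (- x\<^sup>2 / 2)) \<le> prob A"
proof -
  define p where "p = real (card (agents_obs N))"
  have p2: "2 \<le> p" using p by (simp add: p_def)
  have L0: "0 < L" using p2 by (simp add: L_def p_def)
  have n0: "0 < real n" using n by simp
  have c0: "0 < c / Ce" using c Ce_pos by simp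
  have d0: "0 \<le> d" using L0 c0 C4_pos unfolding d by simp
  have e4: "exp (- (4 * L)) = 1 / p^4"
  proof -
    have "exp (4 * L) = (exp L)^4" using exp_of_nat_mult[of 4 L] by simp
    also have "exp L = p" using p2 by (simp add: L_def p_def)
    finally show ?thesis by (simp add: exp_minus inverse_eq_divide)
  qed
  have cV: "real (card (Vbar N)) \<le> 2 * p" using p2 by (simp add: card_Vbar p_def)
  have pp: "real (card (Vbar N)) * (card (Vbar N) * (a / p^4)) \<le> 4 * a / p\<^sup>2"
    "p * (card (Vbar N) * (a / p^4)) \<le> 4 * a / p\<^sup>2" if a: "0 \<le> a" for a
  proof -
    have "real (card (Vbar N)) * (card (Vbar N) * (a / p^4)) \<le> 2 * p * (2 * p * (a / p^4))"
      using cV p2 a by (intro mult_mono) auto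
    also have "\<dots> = 4 * a / p\<^sup>2" using p2 by (simp add: field_simps power2_eq_square power4_eq_xxxx)
    finally show "real (card (Vbar N)) * (card (Vbar N) * (a / p^4)) \<le> 4 * a / p\<^sup>2" .
    have "p * (card (Vbar N) * (a / p^4)) \<le> 2 * p * (2 * p * (a / p^4))"
      using cV p2 a by (intro mult_mono) auto
    also have "\<dots> = 4 * a / p\<^sup>2" using p2 by (simp add: field_simps power2_eq_square power4_eq_xxxx)
    finally show "p * (card (Vbar N) * (a / p^4)) \<le> 4 * a / p\<^sup>2" .
  qed
  define u1 where "u1 = sqrt (32 * B^4 * n * L)"
  define u2 where "u2 = sqrt (8 * (4 * C + 12) * n * L)"
  \<comment> \<open>Squared scores are cut at \<open>U\<close> and fourth powers of the step 2
    summands at n / L, which turns means of order n into exponents of at least 4 L. The bound (U /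
    B^2)^2 on the fourth power of \<open>ns\<close> implies the cut for \<open>nc\<close>, since
    |cv| <= B.\<close>
  define U where "U = n * (c / Ce) / L"
  have u1: "0 \<le> u1" "u1\<^sup>2 = 32 * B^4 * n * L" using L0 by (auto simp: u1_def)
  have u2: "0 \<le> u2" "u2\<^sup>2 = 8 * (4 * C + 12) * n * L" using L0 C_pos by (auto simp: u2_def)
  have U: "0 < U" and nL: "0 < n / L" using n0 c Ce_pos L0 by (auto simp: U_def)
  have UB: "0 < (U / B\<^sup>2)\<^sup>2" using U B_ge_1 by simp
  let ?S = "space (law N)"
  define S0 where "S0 = {\<omega>\<in>?S. \<not> (\<forall>t\<in>{1..n}. \<forall>j\<in>Vbar N. \<bar>cv t j \<omega>\<bar> \<le> B)}"
  define S1 where "S1 = bad (Vbar N) (Vbar N) (gram_dev u1)"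
  define S2 where "S2 = {\<omega>\<in>?S. \<exists>t\<in>{1..n}. \<exists>k\<in>Vbar N. \<exists>j\<in>Vbar N. n / L \<le> \<bar>pc t k j \<omega>\<bar>^4}"
  define S3 where "S3 = bad (Vbar N) (Vbar N) (psi4_dev (n / L))"
  define S4 where "S4 = bad (Vbar N) (Vbar N) (psi_dev u2)"
  define S5 where "S5 = {\<omega>\<in>?S. \<exists>t\<in>{1..n}. \<exists>k\<in>agents_obs N. (U / B\<^sup>2)\<^sup>2 \<le> \<bar>ns t k \<omega>\<bar>^4}"
  define S6 where "S6 = bad (agents_obs N) (Vbar N) (upper_dev U)"
  define S7 where "S7 = bad (agents_obs N) (Vbar N) (lower_dev d)"
  define S8 where "S8 = bad (agents_obs N) (Vbar N) (score_dev x d)"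
  note defs = S0_def S1_def S2_def S3_def S4_def S5_def S6_def S7_def S8_def
  have ev: "S1 \<in> events" "S2 \<in> events" "S3 \<in> events" "S4 \<in> events" "S5 \<in> events" "S6 \<in> events" "S7 \<in> events" "S8 \<in> events"
    unfolding defs
    by (rule gram_tail(1)[OF u1(1)] pc_max_tail(1)[OF nL] pc_fourth_tail(1)[OF nL] pc_mean_tail(1)[OF u2(1)]
        ns_max_tail(1)[OF UB] nc_upper_tail(1)[OF U] nc_lower_tail(1)[OF d0] nc_score_tail(1)[OF x d0 d(2)])+
  have ev0: "S0 \<in> events"
    unfolding S0_def
    by (intro sets.sets_Collect_neg sets.sets_Collect_finite_All finite_Vbar finite_atLeastAtMost) measurable
  have P0: "prob S0 = 0"
  proof -
    have "AE \<omega> in law N. \<omega> \<notin> S0" using AE_cv_bounded by (rule eventually_mono) (auto simp: S0_def)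
    then show ?thesis using ev0 by (simp add: prob_eq_0)
  qed
  have P1: "prob S1 \<le> 8 / p\<^sup>2"
  proof -
    have "prob S1 \<le> card (Vbar N) * (card (Vbar N) * (2 * exp (- u1\<^sup>2 / (2 * (n * (4 * B^4))))))"
      unfolding S1_def by (rule gram_tail(2)[OF u1(1)])
    also have "- u1\<^sup>2 / (2 * (n * (4 * B^4))) = - (4 * L)"
      unfolding u1(2) using n0 B_ge_1 by (simp add: field_simps)
    finally show ?thesis using pp(1)[of 2] by (simp add: e4)
  qed
  have P2: "prob S2 \<le> Mp * L / n"
    using pc_max_tail(2)[OF nL] unfolding S2_def by simp
  have P3: "prob S3 \<le> 4 / p\<^sup>2"
  proof -
    have "prob S3 \<le> card (Vbar N) * (card (Vbar N) * exp (- (4 * n / (n / L))))"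
      unfolding S3_def by (rule pc_fourth_tail(2)[OF nL])
    also have "4 * n / (n / L) = 4 * L" using n0 by simp
    finally show ?thesis using pp(1)[of 1] by (simp add: e4)
  qed
  have P4: "prob S4 \<le> 8 / p\<^sup>2"
  proof -
    have "prob S4 \<le> card (Vbar N) * (card (Vbar N) * (2 * exp (- u2\<^sup>2 / (2 * (n * (4 * C + 12))))))"
      unfolding S4_def by (rule pc_mean_tail(2)[OF u2(1)])
    also have "- u2\<^sup>2 / (2 * (n * (4 * C + 12))) = - (4 * L)"
    proof -
      have "0 < 4 * C + 12" using C_pos by simp
      then show ?thesis unfolding u2(2) using n0 by (simp add: divide_eq_eq)
    qed
    finally show ?thesis using pp(1)[of 2] by (simp add: e4)
  qed
  have P5: "prob S5 \<le> Me * (B\<^sup>2 * L / (n * (c / Ce)))\<^sup>2"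
  proof -
    have "prob S5 \<le> Me / (U / B\<^sup>2)\<^sup>2" unfolding S5_def by (rule ns_max_tail(2)[OF UB])
    also have "\<dots> = Me * (B\<^sup>2 * L / (n * (c / Ce)))\<^sup>2"
      by (simp add: U_def power_divide power_mult_distrib)
    finally show ?thesis .
  qed
  have P6: "prob S6 \<le> 4 / p\<^sup>2"
  proof -
    have "prob S6 \<le> p * (card (Vbar N) * exp (- (23 * (n * (c / Ce)) / U)))"
      unfolding S6_def p_def by (rule nc_upper_tail(2)[OF U])
    also have "23 * (n * (c / Ce)) / U = 23 * L" using n0 c Ce_pos by (simp add: U_def)
    also have "p * (card (Vbar N) * exp (- (23 * L))) \<le> p * (card (Vbar N) * exp (- (4 * L)))"
      using L0 p2 by (intro mult_left_mono) auto
    finally show ?thesis using pp(2)[of 1] by (simp add: e4)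
  qed
  have P7: "prob S7 \<le> 4 / p\<^sup>2"
  proof -
    have "prob S7 \<le> p * (card (Vbar N) * exp (- (d\<^sup>2 * n * (c / Ce)\<^sup>2 / (2 * (C * B^4)))))"
      unfolding S7_def p_def by (rule nc_lower_tail(2)[OF d0])
    also have "d\<^sup>2 = 8 * (C * B^4) * L / (n * (c / Ce)\<^sup>2)"
      unfolding d using C4_pos L0 by simp
    also have "8 * (C * B^4) * L / (n * (c / Ce)\<^sup>2) * n * (c / Ce)\<^sup>2 / (2 * (C * B^4)) = 4 * L"
    proof -
      have "(c / Ce)\<^sup>2 \<noteq> 0" "C * B^4 \<noteq> 0" using c0 C4_pos by (auto simp del: mult_eq_0_iff)
      moreover have "8 * a * L / (n * q) * n * q / (2 * a) = 4 * L" if "q \<noteq> 0" "a \<noteq> 0" for a q :: real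
        using that n0 by (simp add: field_simps)
      ultimately show ?thesis by blast
    qed
    finally show ?thesis using pp(2)[of 1] by (simp add: e4)
  qed
  have P8: "prob S8 \<le> 4 * p\<^sup>2 * exp (- x\<^sup>2 / 2)"
  proof -
    have "prob S8 \<le> p * (card (Vbar N) * (2 * exp (- x\<^sup>2 / 2)))"
      unfolding S8_def p_def by (rule nc_score_tail(2)[OF x d0 d(2)])
    also have "\<dots> \<le> p * (2 * p * (2 * exp (- x\<^sup>2 / 2)))"
      using cV p2 by (intro mult_left_mono mult_right_mono) auto
    finally show ?thesis by (simp add: power2_eq_square mult_ac)
  qed
  let ?T = "S0 \<union> S1 \<union> S2 \<union> S3 \<union> S4 \<union> S5 \<union> S6 \<union> S7 \<union> S8"
  have T: "?T \<in> events" using ev ev0 by simp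
  have "prob ?T \<le> prob S0 + prob S1 + prob S2 + prob S3 + prob S4 + prob S5 + prob S6 + prob S7 + prob S8"
    by (intro order_trans[OF measure_Un_le] add_mono order_refl sets.Un ev ev0)
  then have PT: "prob ?T \<le> 28 / p\<^sup>2 + Mp * L / n + Me * (B\<^sup>2 * L / (n * (c / Ce)))\<^sup>2 + 4 * p\<^sup>2 * exp (- x\<^sup>2 / 2)"
    using P0 P1 P2 P3 P4 P5 P6 P7 P8 by simp
  show ?thesis
  proof (rule that[of "?S - ?T"])
    show "?S - ?T \<in> events" using T by blast
    show "1 - (28 / (card (agents_obs N))\<^sup>2 + Mp * L / n + Me * (B\<^sup>2 * L / (n * (c / Ce)))\<^sup>2
        + 4 * (card (agents_obs N))\<^sup>2 * exp (- x\<^sup>2 / 2)) \<le> prob (?S - ?T)"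
      using PT prob_compl[OF T] by (simp add: p_def)
  next
    fix \<omega> assume "\<omega> \<in> ?S - ?T"
    then have \<omega>: "\<omega> \<in> ?S" and nin: "\<omega> \<notin> S0" "\<omega> \<notin> S1" "\<omega> \<notin> S2" "\<omega> \<notin> S3" "\<omega> \<notin> S4" "\<omega> \<notin> S5" "\<omega> \<notin> S6" "\<omega> \<notin> S7" "\<omega> \<notin> S8"
      by auto
    have b: "\<bar>cv t j \<omega>\<bar> \<le> B" if "t \<in> {1..n}" "j \<in> Vbar N" for t j
      using nin(1) \<omega> that by (auto simp: S0_def)
    have g1: "\<bar>\<Sum>t=1..n. cv t i \<omega> * cv t j \<omega> - second_moment N i j\<bar> \<le> u1"
      if ij: "i \<in> Vbar N" "j \<in> Vbar N" for i j
    proof -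
      have "(\<Sum>t=1..n. (cv t i \<omega> * cv t j \<omega> - second_moment N i j)\<^sup>2) \<le> (\<Sum>t=1..n. 4 * B^4)"
      proof (rule sum_mono)
        fix t assume t: "t \<in> {1..n}"
        have "\<bar>cv t i \<omega> * cv t j \<omega>\<bar> \<le> B\<^sup>2"
          unfolding abs_mult power2_eq_square using b[OF t] ij B_ge_1 by (intro mult_mono) auto
        then show "(cv t i \<omega> * cv t j \<omega> - second_moment N i j)\<^sup>2 \<le> 4 * B^4"
          by (rule gram_dev_square_le[OF ij])
      qed
      then have "(\<Sum>t=1..n. (cv t i \<omega> * cv t j \<omega> - second_moment N i j)\<^sup>2) \<le> n * (4 * B^4)" by simp
      then have "\<not> u1 \<le> \<bar>\<Sum>t=1..n. cv t i \<omega> * cv t j \<omega> - second_moment N i j\<bar>"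
        using nin(2) \<omega> ij unfolding S1_def bad_def gram_dev_def by blast
      then show ?thesis by linarith
    qed
    have g2: "(\<Sum>t=1..n. \<bar>pc t k j \<omega>\<bar>^4) \<le> n * (2 * C + 4)" if kj: "k \<in> Vbar N" "j \<in> Vbar N" for k j
    proof -
      have "\<forall>t\<in>{1..n}. \<bar>pc t k j \<omega>\<bar>^4 \<le> n / L"
        using nin(3) \<omega> kj unfolding S2_def by (auto simp del: power_even_abs) (meson atLeastAtMost_iff linear)
      then have "\<not> n * (2 * C + 4) \<le> (\<Sum>t=1..n. \<bar>pc t k j \<omega>\<bar>^4)"
        using nin(4) \<omega> kj unfolding S3_def bad_def psi4_dev_def by blast
      then show ?thesis by linarith
    qed
    have g3: "(\<Sum>t=1..n. (pc t k j \<omega> - of_bool (k = j))\<^sup>2) \<le> n * (4 * C + 12)"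
      if kj: "k \<in> Vbar N" "j \<in> Vbar N" for k j
    proof -
      have "(\<Sum>t=1..n. (pc t k j \<omega> - of_bool (k = j))\<^sup>2) \<le> (\<Sum>t=1..n. 2 * \<bar>pc t k j \<omega>\<bar>^4 + 4)"
        by (intro sum_mono square_dev_le_fourth) auto
      also have "\<dots> = 2 * (\<Sum>t=1..n. \<bar>pc t k j \<omega>\<bar>^4) + 4 * n"
        by (simp add: sum.distrib sum_distrib_left del: power_even_abs)
      finally show ?thesis using g2[OF kj] by (simp add: algebra_simps del: power_even_abs)
    qed
    have g4: "\<bar>\<Sum>t=1..n. pc t k j \<omega> - of_bool (k = j)\<bar> \<le> u2"
      if kj: "k \<in> Vbar N" "j \<in> Vbar N" for k j
    proof -
      have "\<not> u2 \<le> \<bar>\<Sum>t=1..n. pc t k j \<omega> - of_bool (k = j)\<bar>"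
        using nin(5) \<omega> kj g3[OF kj] unfolding S4_def bad_def psi_dev_def by blast
      then show ?thesis by linarith
    qed
    have g5: "(\<Sum>t=1..n. (nc t k j \<omega>)\<^sup>2) \<le> 25 * nq k j" if kj: "k \<in> agents_obs N" "j \<in> Vbar N" for k j
    proof -
      have "(nc t k j \<omega>)\<^sup>2 \<le> U" if t: "t \<in> {1..n}" for t
      proof -
        have "\<not> (U / B\<^sup>2)\<^sup>2 \<le> \<bar>ns t k \<omega>\<bar>^4" using nin(6) \<omega> kj t unfolding S5_def by blast
        then have "((ns t k \<omega>)\<^sup>2)\<^sup>2 \<le> (U / B\<^sup>2)\<^sup>2" by (simp add: power_even_abs)
        then have "(ns t k \<omega>)\<^sup>2 \<le> U / B\<^sup>2" by (rule power2_le_imp_le) (use U in simp)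
        moreover have "(cv t j \<omega>)\<^sup>2 \<le> B\<^sup>2" using power_mono[OF b[OF t kj(2)], of 2] by simp
        ultimately have "(ns t k \<omega>)\<^sup>2 * (cv t j \<omega>)\<^sup>2 \<le> U / B\<^sup>2 * B\<^sup>2"
          using U by (intro mult_mono) auto
        then show ?thesis using B_ge_1 by (simp add: nc_def power_mult_distrib)
      qed
      then have "\<not> 25 * nq k j \<le> (\<Sum>t=1..n. (nc t k j \<omega>)\<^sup>2)"
        using nin(7) \<omega> kj unfolding S6_def bad_def upper_dev_def by blast
      then show ?thesis by linarith
    qed
    have g6: "\<bar>\<Sum>t=1..n. nc t k j \<omega>\<bar> \<le> x * (1 + d) * sqrt (\<Sum>t=1..n. (nc t k j \<omega>)\<^sup>2)"
      if kj: "k \<in> agents_obs N" "j \<in> Vbar N" for k j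
    proof -
      have "\<not> (\<Sum>t=1..n. (nc t k j \<omega>)\<^sup>2) \<le> nq k j - d * nq k j"
        using nin(8) \<omega> kj unfolding S7_def bad_def lower_dev_def by blast
      then have "(1 - d) * nq k j \<le> (\<Sum>t=1..n. (nc t k j \<omega>)\<^sup>2)" by (simp add: left_diff_distrib)
      then have "\<not> x * (1 + d) * sqrt (\<Sum>t=1..n. (nc t k j \<omega>)\<^sup>2) \<le> \<bar>\<Sum>t=1..n. nc t k j \<omega>\<bar>"
        using nin(9) \<omega> kj g5[OF kj] unfolding S8_def bad_def score_dev_def by blast
      then show ?thesis by linarith
    qed
    show "good x d \<omega>"
      unfolding good_def u1_def[symmetric] u2_def[symmetric]
      by (intro conjI ballI b g1 g2 g3 g4 g5 g6)
  qed
qed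

section \<open>The estimators on the good event\<close>

lemma sum_Vbar: "(\<Sum>i\<in>Vbar N. f i) = f None + (\<Sum>i\<in>agents_obs N. f (Some i))"
  unfolding Vbar_def by (subst sum.insert) (auto simp: finite_obs sum.reindex)

section \<open>Slack of the debiasing matrix\<close>

definition "zeta_bound = root 4 (2 * C + 4) + sqrt (8 * (4 * C + 12))"

text \<open>Row k of the minimizer is exchanged for that of Psi-bar. The fourth-root part of the
  objective is nonnegative, so the value of the k-th summand at Psi-bar bounds the slack
  alone.\<close>

lemma step2_bound:
  assumes good: "good x d \<omega>" and x: "0 \<le> x" "L \<le> x\<^sup>2" and lam: "tun_lambda n N = x / sqrt n"
    and opt: "is_arg_min (step2_objective n N \<omega>) (step2_feasible n N \<omega>) (z, \<Psi>)"
    and k: "k \<in> Vbar N"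
  shows "z k \<le> zeta_bound"
proof -
  have n0: "0 < real n" using n by simp
  \<comment> \<open>One level has to serve both constraints. The mean constraint, where L <= x^2
    enters, asks for sqrt (8 (4 C + 12)); the second-moment constraint asks for sqrt (4 C +
    12).\<close>
  define z2 where "z2 = sqrt (8 * (4 * C + 12))"
  define z' where "z' = (\<lambda>i. if i = k then z2 else z i)"
  define \<Psi>' where "\<Psi>' = (\<lambda>i. if i = k then Psi_bar N k else \<Psi> i)"
  have feas: "step2_feasible n N \<omega> (z, \<Psi>)" using opt by (auto simp: is_arg_min_def)
  have row: "row_apply N \<Psi>' t \<omega> i = (if i = k then ps t k \<omega> else row_apply N \<Psi> t \<omega> i)" for t i
    by (simp add: \<Psi>'_def row_apply_eq[symmetric] row_apply_def)
  have gram: "(\<Sum>m\<in>Vbar N. Psi_bar N k m * sigma_hat n N \<omega> m j) = (1 / n) * (\<Sum>t=1..n. pc t k j \<omega>)"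
    if j: "j \<in> Vbar N" for j
  proof -
    have "(\<Sum>m\<in>Vbar N. Psi_bar N k m * sigma_hat n N \<omega> m j) =
        (1 / n) * (\<Sum>m\<in>Vbar N. \<Sum>t=1..n. Psi_bar N k m * (one_p N t \<omega> m * one_p N t \<omega> j))"
      by (simp add: sigma_hat_def sum_distrib_left sum_divide_distrib)
    also have "(\<Sum>m\<in>Vbar N. \<Sum>t=1..n. Psi_bar N k m * (one_p N t \<omega> m * one_p N t \<omega> j)) = (\<Sum>t=1..n. pc t k j \<omega>)"
      by (subst sum.swap)
         (use j in \<open>simp add: pc_def row_apply_eq[symmetric] row_apply_def sum_distrib_right one_p_eq mult.assoc\<close>)
    finally show ?thesis .
  qed
  have feas': "step2_feasible n N \<omega> (z', \<Psi>')"
    unfolding step2_feasible_def prod.case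
  proof (intro ballI)
    fix i j assume ij: "i \<in> Vbar N" "j \<in> Vbar N"
    show "\<bar>(\<Sum>m\<in>Vbar N. \<Psi>' i m * sigma_hat n N \<omega> m j) - of_bool (i = j)\<bar> \<le> tun_lambda n N * z' i \<and>
       sqrt ((1 / n) * (\<Sum>t=1..n. (row_apply N \<Psi>' t \<omega> i * one_p N t \<omega> j - of_bool (i = j))^2)) \<le> z' i"
    proof (cases "i = k")
      case False
      then have "z' i = z i" "\<Psi>' i = \<Psi> i" "\<And>t. row_apply N \<Psi>' t \<omega> i = row_apply N \<Psi> t \<omega> i"
        by (simp_all add: z'_def \<Psi>'_def row_apply_def)
      then show ?thesis using feas ij by (simp only: step2_feasible_def prod.case)
    next
      case True
      have "(\<Sum>m\<in>Vbar N. \<Psi>' i m * sigma_hat n N \<omega> m j) - of_bool (i = j)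
          = (1 / n) * (\<Sum>t=1..n. pc t k j \<omega> - of_bool (k = j))"
        using gram[OF ij(2)] n0 True by (simp add: \<Psi>'_def sum_subtractf diff_divide_distrib)
      also have "\<bar>\<dots>\<bar> \<le> (1 / n) * sqrt (8 * (4 * C + 12) * n * L)"
        using good k ij(2) n0 unfolding good_def abs_mult by (intro mult_mono) auto
      also have "\<dots> \<le> (1 / n) * sqrt (8 * (4 * C + 12) * n * x\<^sup>2)"
        using x C_pos by (intro mult_left_mono real_sqrt_le_mono) auto
      also have "\<dots> = x / sqrt n * z2"
      proof -
        have "sqrt (8 * (4 * C + 12) * n * x\<^sup>2) = z2 * sqrt n * x"
          using x by (simp only: z2_def real_sqrt_mult real_sqrt_abs abs_of_nonneg)
        moreover have "sqrt n * sqrt n = n" using n0 by simp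
        then have "1 / n * (z2 * sqrt n * x) = x / sqrt n * z2" using n0 by (simp add: field_simps)
        ultimately show ?thesis by simp
      qed
      finally have 1: "\<bar>(\<Sum>m\<in>Vbar N. \<Psi>' i m * sigma_hat n N \<omega> m j) - of_bool (i = j)\<bar> \<le> tun_lambda n N * z' i"
        using True by (simp add: lam z'_def)
      have "(\<Sum>t=1..n. (row_apply N \<Psi>' t \<omega> i * one_p N t \<omega> j - of_bool (i = j))^2) = (\<Sum>t=1..n. (pc t k j \<omega> - of_bool (k = j))\<^sup>2)"
        using True ij by (simp add: row pc_def one_p_eq)
      also have "\<dots> \<le> n * (4 * C + 12)" using good k ij(2) by (auto simp: good_def)
      finally have "(1 / n) * (\<Sum>t=1..n. (row_apply N \<Psi>' t \<omega> i * one_p N t \<omega> j - of_bool (i = j))^2) \<le> (1 / n) * (n * (4 * C + 12))"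
        using n0 by (intro mult_left_mono) auto
      also have "\<dots> \<le> 8 * (4 * C + 12)" using n0 C_pos by simp
      finally have "sqrt ((1 / n) * (\<Sum>t=1..n. (row_apply N \<Psi>' t \<omega> i * one_p N t \<omega> j - of_bool (i = j))^2)) \<le> z2"
        unfolding z2_def by (rule real_sqrt_le_mono)
      moreover have "z' i = z2" using True by (simp add: z'_def)
      ultimately show ?thesis using 1 by (simp only:)
    qed
  qed
  have "(\<Sum>i\<in>Vbar N. root 4 ((1 / n) * (\<Sum>t=1..n. \<bar>row_apply N \<Psi> t \<omega> i\<bar>^4)) + z i)
      \<le> (\<Sum>i\<in>Vbar N. root 4 ((1 / n) * (\<Sum>t=1..n. \<bar>row_apply N \<Psi>' t \<omega> i\<bar>^4)) + z' i)"
    using opt feas' by (auto simp: is_arg_min_def step2_objective_def not_less)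
  then have "root 4 ((1 / n) * (\<Sum>t=1..n. \<bar>row_apply N \<Psi> t \<omega> k\<bar>^4)) + z k
      \<le> root 4 ((1 / n) * (\<Sum>t=1..n. \<bar>row_apply N \<Psi>' t \<omega> k\<bar>^4)) + z' k"
    by (rule sum_le_imp_entry_le[OF finite_Vbar k]) (simp add: row z'_def)
  moreover have "0 \<le> root 4 ((1 / n) * (\<Sum>t=1..n. \<bar>row_apply N \<Psi> t \<omega> k\<bar>^4))"
    by (intro real_root_ge_zero mult_nonneg_nonneg sum_nonneg) auto
  moreover have "root 4 ((1 / n) * (\<Sum>t=1..n. \<bar>row_apply N \<Psi>' t \<omega> k\<bar>^4)) \<le> root 4 (2 * C + 4)"
  proof -
    \<comment> \<open>The constant regressor equals 1, so the fourth moment of the row itself is the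
      entry j = \<open>None\<close> of \<open>pc\<close>.\<close>
    have "(\<Sum>t=1..n. \<bar>row_apply N \<Psi>' t \<omega> k\<bar>^4) = (\<Sum>t=1..n. \<bar>pc t k None \<omega>\<bar>^4)"
      by (simp add: row pc_def cv_None)
    also have "\<dots> \<le> n * (2 * C + 4)" using good k None_in_Vbar unfolding good_def by blast
    finally show ?thesis using n0 by (intro real_root_le_mono) (auto simp: divide_le_eq mult.commute)
  qed
  moreover have "z' k = z2" by (simp add: z'_def)
  ultimately show ?thesis unfolding zeta_bound_def z2_def[symmetric] by linarith
qed

section \<open>Error decomposition of the debiased estimator\<close>

definition "Delta v W k i = stacked v W k i - stacked (v_obs N) (H_inv N) k i"

lemma residual_eq:
  assumes "t \<in> {1..n}" "k \<in> agents_obs N" "\<omega> \<in> space (law N)"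
  shows "residual N v W t \<omega> k = ns t k \<omega> + (\<Sum>i\<in>Vbar N. Delta v W k i * cv t i \<omega>)"
proof -
  have "outcome N t k \<omega> = v_obs N k - (\<Sum>j\<in>agents_obs N. H_inv N k j * covar N t j \<omega>) + eps N t k \<omega>"
    using data assms unfolding regular_data_def by blast
  moreover have "cv t (Some j) \<omega> = covar N t j \<omega>" if "j \<in> agents_obs N" for j
    using that one_p_eq[of "Some j" t \<omega>] by (simp add: one_p_def Some_in_Vbar)
  ultimately show ?thesis using assms
    by (simp add: residual_def sum_Vbar Delta_def stacked_def cv_None eps_eq left_diff_distrib sum_subtractf)
qed

text \<open>This is algebra at every sample point, for arbitrary first-step values and an arbitrary
  debiasing matrix. Optimality and the good event matter only for the size of the last term.\<close>

lemma debias_identity: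
  assumes k: "k \<in> agents_obs N" and j: "j \<in> Vbar N" and \<omega>: "\<omega> \<in> space (law N)"
  shows "sqrt n * (debiased n N \<omega> W v \<Psi> k j - stacked (v_obs N) (H_inv N) k j) =
      - (\<Sum>m\<in>Vbar N. \<Psi> j m * ((1 / sqrt n) * (\<Sum>t=1..n. eps N t k \<omega> * one_p N t \<omega> m)))
      + sqrt n * (\<Sum>i\<in>Vbar N. Delta v W k i * (of_bool (j = i) - (\<Sum>m\<in>Vbar N. \<Psi> j m * sigma_hat n N \<omega> m i)))"
proof -
  have n0: "0 < real n" using n by simp
  have sn: "sqrt n * (1 / n) = 1 / sqrt n" using n0 by (simp add: real_div_sqrt field_simps)
  let ?e = "\<lambda>m. \<Sum>t=1..n. eps N t k \<omega> * one_p N t \<omega> m"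
  have r: "(1 / n) * (\<Sum>t=1..n. one_p N t \<omega> m * residual N v W t \<omega> k)
      = (1 / n) * ?e m + (\<Sum>i\<in>Vbar N. Delta v W k i * sigma_hat n N \<omega> m i)" if m: "m \<in> Vbar N" for m
  proof -
    have "(\<Sum>t=1..n. one_p N t \<omega> m * residual N v W t \<omega> k) =
        (\<Sum>t=1..n. eps N t k \<omega> * one_p N t \<omega> m + (\<Sum>i\<in>Vbar N. Delta v W k i * (one_p N t \<omega> m * one_p N t \<omega> i)))"
      by (intro sum.cong refl) (use m in \<open>simp add: residual_eq[OF _ k \<omega>] eps_eq[OF _ k \<omega>] one_p_eq sum_distrib_left algebra_simps\<close>)
    also have "\<dots> = ?e m + (\<Sum>i\<in>Vbar N. Delta v W k i * (\<Sum>t=1..n. one_p N t \<omega> m * one_p N t \<omega> i))"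
      by (simp add: sum.distrib) (subst sum.swap, simp add: sum_distrib_left)
    finally show ?thesis
      by (simp add: sigma_hat_def distrib_left sum_distrib_left sum_divide_distrib add_divide_distrib)
  qed
  have "(\<Sum>m\<in>Vbar N. \<Psi> j m * ((1 / n) * (\<Sum>t=1..n. one_p N t \<omega> m * residual N v W t \<omega> k)))
      = (\<Sum>m\<in>Vbar N. \<Psi> j m * ((1 / n) * ?e m)) + (\<Sum>m\<in>Vbar N. \<Psi> j m * (\<Sum>i\<in>Vbar N. Delta v W k i * sigma_hat n N \<omega> m i))"
    unfolding sum.distrib[symmetric] by (intro sum.cong refl) (simp only: r distrib_left)
  also have "(\<Sum>m\<in>Vbar N. \<Psi> j m * (\<Sum>i\<in>Vbar N. Delta v W k i * sigma_hat n N \<omega> m i))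
      = (\<Sum>i\<in>Vbar N. Delta v W k i * (\<Sum>m\<in>Vbar N. \<Psi> j m * sigma_hat n N \<omega> m i))"
    by (simp only: sum_distrib_left) (subst sum.swap, simp add: mult_ac)
  finally have s: "(\<Sum>m\<in>Vbar N. \<Psi> j m * ((1 / n) * (\<Sum>t=1..n. one_p N t \<omega> m * residual N v W t \<omega> k)))
      = (\<Sum>m\<in>Vbar N. \<Psi> j m * ((1 / n) * ?e m)) + (\<Sum>i\<in>Vbar N. Delta v W k i * (\<Sum>m\<in>Vbar N. \<Psi> j m * sigma_hat n N \<omega> m i))" .
  have dj: "Delta v W k j = (\<Sum>i\<in>Vbar N. Delta v W k i * of_bool (j = i))"
    using j finite_Vbar by (simp add: of_bool_def if_distrib cong: if_cong)
  have "debiased n N \<omega> W v \<Psi> k j - stacked (v_obs N) (H_inv N) k j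
      = Delta v W k j - (\<Sum>m\<in>Vbar N. \<Psi> j m * ((1 / n) * (\<Sum>t=1..n. one_p N t \<omega> m * residual N v W t \<omega> k)))"
    by (simp add: debiased_def Delta_def)
  also have "\<dots> = - (\<Sum>m\<in>Vbar N. \<Psi> j m * ((1 / n) * ?e m))
      + (\<Sum>i\<in>Vbar N. Delta v W k i * (of_bool (j = i) - (\<Sum>m\<in>Vbar N. \<Psi> j m * sigma_hat n N \<omega> m i)))"
    unfolding s dj by (simp only: right_diff_distrib sum_subtractf)
  finally have "sqrt n * (debiased n N \<omega> W v \<Psi> k j - stacked (v_obs N) (H_inv N) k j)
      = sqrt n * (- (\<Sum>m\<in>Vbar N. \<Psi> j m * ((1 / n) * ?e m))
      + (\<Sum>i\<in>Vbar N. Delta v W k i * (of_bool (j = i) - (\<Sum>m\<in>Vbar N. \<Psi> j m * sigma_hat n N \<omega> m i))))"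
    by (rule arg_cong)
  also have "\<dots> = - (sqrt n * (\<Sum>m\<in>Vbar N. \<Psi> j m * ((1 / n) * ?e m)))
      + sqrt n * (\<Sum>i\<in>Vbar N. Delta v W k i * (of_bool (j = i) - (\<Sum>m\<in>Vbar N. \<Psi> j m * sigma_hat n N \<omega> m i)))"
    by (simp only: distrib_left mult_minus_right)
  also have "sqrt n * (\<Sum>m\<in>Vbar N. \<Psi> j m * ((1 / n) * ?e m)) = (\<Sum>m\<in>Vbar N. \<Psi> j m * ((sqrt n * (1 / n)) * ?e m))"
    by (simp only: sum_distrib_left mult_ac)
  finally show ?thesis unfolding sn .
qed

section \<open>The l1 error of the first step\<close>

definition "mn \<omega> = sqrt (max 1 (MAX k\<in>agents_obs N. (1 / n) * (\<Sum>t=1..n. (covar N t k \<omega>)^4)))"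

text \<open>Mixed moments follow from pure ones by 2 a b <= a^2 + b^2. The maximum with 1 accounts
  for the constant regressor, which the maximum over agents leaves out.\<close>

lemma mn_bounds:
  assumes b: "\<And>t j. t \<in> {1..n} \<Longrightarrow> j \<in> Vbar N \<Longrightarrow> \<bar>cv t j \<omega>\<bar> \<le> B"
  shows "1 \<le> mn \<omega>" "mn \<omega> \<le> B\<^sup>2"
    and "\<And>l j. l \<in> Vbar N \<Longrightarrow> j \<in> Vbar N \<Longrightarrow> (1 / real n) * (\<Sum>t=1..n. (cv t l \<omega>)\<^sup>2 * (cv t j \<omega>)\<^sup>2) \<le> (mn \<omega>)\<^sup>2"
proof -
  have n0: "0 < real n" using n by simp
  show "1 \<le> mn \<omega>" by (simp add: mn_def)
  have cov: "covar N t k \<omega> = cv t (Some k) \<omega>" if "k \<in> agents_obs N" for t k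
    using that one_p_eq[of "Some k" t \<omega>] by (simp add: one_p_def Some_in_Vbar)
  have B4: "1 \<le> B^4" using B_ge_1 by simp
  have "(1 / n) * (\<Sum>t=1..n. (covar N t k \<omega>)^4) \<le> B^4" if k: "k \<in> agents_obs N" for k
  proof -
    have "(\<Sum>t=1..n. (covar N t k \<omega>)^4) \<le> (\<Sum>t=1..n. B^4)"
    proof (rule sum_mono)
      fix t assume "t \<in> {1..n}"
      then have "\<bar>covar N t k \<omega>\<bar>^4 \<le> B^4" using b k by (intro power_mono) (auto simp: cov Some_in_Vbar)
      then show "(covar N t k \<omega>)^4 \<le> B^4" by (simp add: power_even_abs)
    qed
    then show ?thesis using n0 by (simp add: divide_le_eq mult.commute)
  qed
  then have "max 1 (MAX k\<in>agents_obs N. (1 / n) * (\<Sum>t=1..n. (covar N t k \<omega>)^4)) \<le> B^4"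
    using finite_obs obs_nonempty B4 by (subst max.bounded_iff, subst Max_le_iff) auto
  then have "mn \<omega> \<le> sqrt (B^4)" unfolding mn_def by (rule real_sqrt_le_mono)
  also have "sqrt (B^4) = B\<^sup>2" using B_ge_1 by (intro real_sqrt_unique) auto
  finally show "mn \<omega> \<le> B\<^sup>2" .
  have mn2: "(mn \<omega>)\<^sup>2 = max 1 (MAX k\<in>agents_obs N. (1 / n) * (\<Sum>t=1..n. (covar N t k \<omega>)^4))"
    unfolding mn_def by (intro real_sqrt_pow2) simp
  have 4: "(1 / n) * (\<Sum>t=1..n. (cv t l \<omega>)^4) \<le> (mn \<omega>)\<^sup>2" if l: "l \<in> Vbar N" for l
  proof (cases l)
    case None
    then show ?thesis using n0 by (simp add: cv_None mn2)
  next
    case (Some k)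
    then have k: "k \<in> agents_obs N" using l by (simp add: Some_in_Vbar)
    have "(1 / n) * (\<Sum>t=1..n. (covar N t k \<omega>)^4) \<le> (MAX k\<in>agents_obs N. (1 / n) * (\<Sum>t=1..n. (covar N t k \<omega>)^4))"
      by (rule Max_ge) (use finite_obs k in auto)
    then show ?thesis using Some cov[OF k] by (simp add: mn2)
  qed
  fix l j assume lj: "l \<in> Vbar N" "j \<in> Vbar N"
  have "(\<Sum>t=1..n. (cv t l \<omega>)\<^sup>2 * (cv t j \<omega>)\<^sup>2) \<le> (\<Sum>t=1..n. ((cv t l \<omega>)^4 + (cv t j \<omega>)^4) / 2)"
  proof (rule sum_mono)
    fix t
    have "0 \<le> ((cv t l \<omega>)\<^sup>2 - (cv t j \<omega>)\<^sup>2)\<^sup>2" by simp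
    then show "(cv t l \<omega>)\<^sup>2 * (cv t j \<omega>)\<^sup>2 \<le> ((cv t l \<omega>)^4 + (cv t j \<omega>)^4) / 2"
      by (simp add: power2_diff)
  qed
  then have "(1 / n) * (\<Sum>t=1..n. (cv t l \<omega>)\<^sup>2 * (cv t j \<omega>)\<^sup>2) \<le> (1 / n) * (\<Sum>t=1..n. ((cv t l \<omega>)^4 + (cv t j \<omega>)^4) / 2)"
    using n0 by (intro mult_left_mono) auto
  also have "\<dots> = ((1 / n) * (\<Sum>t=1..n. (cv t l \<omega>)^4) + (1 / n) * (\<Sum>t=1..n. (cv t j \<omega>)^4)) / 2"
    by (simp add: sum_divide_distrib[symmetric] sum.distrib add_divide_distrib)
  also have "\<dots> \<le> (mn \<omega>)\<^sup>2" using add_mono[OF 4[OF lj(1)] 4[OF lj(2)]] by simp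
  finally show "(1 / real n) * (\<Sum>t=1..n. (cv t l \<omega>)\<^sup>2 * (cv t j \<omega>)\<^sup>2) \<le> (mn \<omega>)\<^sup>2" .
qed

text \<open>The population form is at least |u|_2^2 / Ce, and an error \<open>b\<close> in every
  entry of the Gram sums changes the empirical form by at most b |u|_1^2 / n. On the cone |u|_1^2 is
  at most a multiple of s |u|_2^2, which makes this a genuine lower bound.\<close>

lemma gram_restricted_eigenvalue:
  assumes g: "\<And>i j. i \<in> Vbar N \<Longrightarrow> j \<in> Vbar N \<Longrightarrow>
      \<bar>\<Sum>t\<in>{1..n}. cv t i \<omega> * cv t j \<omega> - second_moment N i j\<bar> \<le> b"
  shows "(1 / Ce) * (\<Sum>i\<in>Vbar N. (u i)\<^sup>2) - b / n * (\<Sum>i\<in>Vbar N. \<bar>u i\<bar>)\<^sup>2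
      \<le> (1 / n) * (\<Sum>t=1..n. (\<Sum>i\<in>Vbar N. u i * cv t i \<omega>)\<^sup>2)"
proof -
  have n0: "0 < real n" using n by simp
  let ?D = "\<lambda>i j. \<Sum>t\<in>{1..n}. cv t i \<omega> * cv t j \<omega> - second_moment N i j"
  have "(\<Sum>t=1..n. (\<Sum>i\<in>Vbar N. u i * cv t i \<omega>)\<^sup>2) = (\<Sum>t=1..n. \<Sum>i\<in>Vbar N. \<Sum>j\<in>Vbar N. u i * u j * (cv t i \<omega> * cv t j \<omega>))"
    by (simp add: power2_eq_square sum_product mult_ac)
  also have "\<dots> = (\<Sum>i\<in>Vbar N. \<Sum>j\<in>Vbar N. \<Sum>t=1..n. u i * u j * (cv t i \<omega> * cv t j \<omega>))"
    by (subst sum.swap) (intro sum.cong refl sum.swap)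
  also have "\<dots> = (\<Sum>i\<in>Vbar N. \<Sum>j\<in>Vbar N. u i * u j * (?D i j + n * second_moment N i j))"
    by (intro sum.cong refl) (simp add: sum_subtractf sum_distrib_left)
  also have "\<dots> = (\<Sum>i\<in>Vbar N. \<Sum>j\<in>Vbar N. u i * u j * ?D i j) + n * (\<Sum>i\<in>Vbar N. \<Sum>j\<in>Vbar N. u i * second_moment N i j * u j)"
    by (simp add: distrib_left sum.distrib sum_distrib_left mult_ac)
  finally have eq: "(\<Sum>t=1..n. (\<Sum>i\<in>Vbar N. u i * cv t i \<omega>)\<^sup>2)
      = (\<Sum>i\<in>Vbar N. \<Sum>j\<in>Vbar N. u i * u j * ?D i j) + n * (\<Sum>i\<in>Vbar N. \<Sum>j\<in>Vbar N. u i * second_moment N i j * u j)" .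
  have "- (\<Sum>i\<in>Vbar N. \<Sum>j\<in>Vbar N. u i * u j * ?D i j) \<le> (\<Sum>i\<in>Vbar N. \<Sum>j\<in>Vbar N. \<bar>u i\<bar> * \<bar>u j\<bar> * b)"
    unfolding sum_negf[symmetric]
  proof (intro sum_mono)
    fix i j assume ij: "i \<in> Vbar N" "j \<in> Vbar N"
    have "- (u i * u j * ?D i j) \<le> \<bar>u i * u j * ?D i j\<bar>" by (rule abs_ge_minus_self)
    also have "\<dots> = \<bar>u i * u j\<bar> * \<bar>?D i j\<bar>" by (rule abs_mult)
    also have "\<dots> \<le> \<bar>u i * u j\<bar> * b" by (rule mult_left_mono[OF g[OF ij]]) simp
    finally show "- (u i * u j * ?D i j) \<le> \<bar>u i\<bar> * \<bar>u j\<bar> * b" by (simp only: abs_mult)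
  qed
  also have "\<dots> = b * (\<Sum>i\<in>Vbar N. \<bar>u i\<bar>)\<^sup>2"
    by (simp add: power2_eq_square sum_product sum_distrib_left mult_ac)
  finally have "n * ((1 / Ce) * (\<Sum>i\<in>Vbar N. (u i)\<^sup>2)) - b * (\<Sum>i\<in>Vbar N. \<bar>u i\<bar>)\<^sup>2 \<le> (\<Sum>t=1..n. (\<Sum>i\<in>Vbar N. u i * cv t i \<omega>)\<^sup>2)"
    using mult_left_mono[OF second_moment_lower[of u], of "real n"] n0 unfolding eq by linarith
  then have "(1 / n) * (n * ((1 / Ce) * (\<Sum>i\<in>Vbar N. (u i)\<^sup>2)) - b * (\<Sum>i\<in>Vbar N. \<bar>u i\<bar>)\<^sup>2) \<le> (1 / n) * (\<Sum>t=1..n. (\<Sum>i\<in>Vbar N. u i * cv t i \<omega>)\<^sup>2)"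
    using n0 by (intro mult_left_mono) auto
  then show ?thesis using n0 by (simp add: right_diff_distrib)
qed

definition "noise_bound = 5 * sqrt (1 + C * B^4)"

text \<open>Row k alone is exchanged for the truth, so the comparison reduces to a single
  regression. The largest norm zs is attained at an index j0, and that index is what the triangle
  inequality of the cone lemma uses; \<open>noise_bound\<close> is the square root of the bound 25
  (1 + C B^4) on zs^2.\<close>

lemma step1_l1:
  assumes \<omega>: "\<omega> \<in> space (law N)" and good: "good x d \<omega>" and x: "0 \<le> x"
    and lam: "tun_lambda n N = x / sqrt n" and d: "0 \<le> d" "d \<le> 1"
    and s: "1 \<le> s" and sp: "sparse_approx_on (agents_obs N) s r (H_inv N)"
    and small: "72 * s * (sqrt (32 * B^4 * n * L) / n) \<le> 1 / Ce / 4" "72 * s * (4 * B\<^sup>2 * (x / sqrt n)) \<le> 1 / Ce / 4"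
    and opt: "is_arg_min (step1_objective n N \<omega>) (step1_feasible n N \<omega>) (W, v, z)"
    and k: "k \<in> agents_obs N"
  shows "(\<Sum>i\<in>Vbar N. \<bar>Delta v W k i\<bar>) \<le> 576 * noise_bound / (1 / Ce) * (s * (x / sqrt n)) + 6 * r + 6 * noise_bound * d"
proof -
  have n0: "0 < real n" using n by simp
  let ?V = "agents_obs N" and ?I = "Vbar N"
  define \<theta> where "\<theta> = stacked (v_obs N) (H_inv N) k"
  define \<theta>' where "\<theta>' = stacked v W k"
  have \<Delta>: "Delta v W k i = \<theta>' i - \<theta> i" for i by (simp add: Delta_def \<theta>_def \<theta>'_def)
  define f where "f = (\<lambda>j. sqrt ((1 / n) * (\<Sum>t=1..n. (nc t k j \<omega>)\<^sup>2)))"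
  have "Max (f ` ?I) \<in> f ` ?I" using finite_Vbar None_in_Vbar by (intro Max_in) auto
  then obtain j0 where j0: "j0 \<in> ?I" "f j0 = Max (f ` ?I)" by auto
  define zs where "zs = f j0"
  have fmax: "f j \<le> zs" if "j \<in> ?I" for j
    unfolding zs_def j0(2) by (rule Max_ge) (use that finite_Vbar in auto)
  have zs0: "0 \<le> zs" unfolding zs_def f_def by (intro real_sqrt_ge_zero mult_nonneg_nonneg sum_nonneg) auto
  have bnd: "\<bar>cv t j \<omega>\<bar> \<le> B" if "t \<in> {1..n}" "j \<in> ?I" for t j
    using good that by (auto simp: good_def)
  note mn = mn_bounds[OF bnd]
  have zsZ: "zs \<le> noise_bound"
  proof -
    have "(\<Sum>t=1..n. (nc t k j0 \<omega>)\<^sup>2) \<le> 25 * nq k j0" using good k j0 by (auto simp: good_def)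
    also have "\<dots> \<le> 25 * (n * (1 + C * B^4))" using nq_bounds(2)[OF k j0(1)] by simp
    finally have "(1 / n) * (\<Sum>t=1..n. (nc t k j0 \<omega>)\<^sup>2) \<le> (1 / n) * (25 * (n * (1 + C * B^4)))"
      using n0 by (intro mult_left_mono) auto
    also have "\<dots> = 25 * (1 + C * B^4)" using n0 by simp
    finally have "zs \<le> sqrt (25 * (1 + C * B^4))" unfolding zs_def f_def by (rule real_sqrt_le_mono)
    also have "sqrt (25 * (1 + C * B^4)) = noise_bound" unfolding noise_bound_def real_sqrt_mult by simp
    finally show ?thesis .
  qed
  have score: "\<bar>(1 / n) * (\<Sum>t=1..n. nc t k j \<omega>)\<bar> \<le> x / sqrt n * ((1 + d) * zs)" if j: "j \<in> ?I" for j
  proof -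
    have "\<bar>\<Sum>t=1..n. nc t k j \<omega>\<bar> \<le> x * (1 + d) * sqrt (\<Sum>t=1..n. (nc t k j \<omega>)\<^sup>2)"
      using good k j unfolding good_def by blast
    also have "sqrt (\<Sum>t=1..n. (nc t k j \<omega>)\<^sup>2) = sqrt n * f j"
      unfolding f_def real_sqrt_mult[symmetric] using n0 by simp
    also have "x * (1 + d) * (sqrt n * f j) \<le> x * (1 + d) * (sqrt n * zs)"
      using fmax[OF j] x d by (intro mult_left_mono) auto
    finally have "(1 / n) * \<bar>\<Sum>t=1..n. nc t k j \<omega>\<bar> \<le> (1 / n) * (x * (1 + d) * (sqrt n * zs))"
      using n0 by (intro mult_left_mono) auto
    moreover have "sqrt n * sqrt n = n" using n0 by simp
    then have "(1 / n) * (x * (1 + d) * (sqrt n * zs)) = x / sqrt n * ((1 + d) * zs)"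
      using n0 by (simp add: field_simps)
    ultimately show ?thesis using n0 by (simp add: abs_mult)
  qed
  have feas: "step1_feasible n N \<omega> (W, v, z)" using opt by (auto simp: is_arg_min_def)
  have sq_nc: "(nc t k j \<omega>)\<^sup>2 = (ns t k \<omega>)\<^sup>2 * (cv t j \<omega>)\<^sup>2" for t j
    by (simp add: nc_def power_mult_distrib)
  let ?e = "\<lambda>t. ns t k \<omega> + (\<Sum>i\<in>?I. (\<theta>' i - \<theta> i) * cv t i \<omega>)"
  have feas'1: "\<bar>(1 / n) * (\<Sum>t=1..n. ?e t * cv t j \<omega>)\<bar> \<le> x / sqrt n * z k"
    and feas'2: "sqrt ((1 / n) * (\<Sum>t=1..n. (?e t)\<^sup>2 * (cv t j \<omega>)\<^sup>2)) \<le> z k"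
    if j: "j \<in> ?I" for j
  proof -
    have r: "residual N v W t \<omega> k = ns t k \<omega> + (\<Sum>i\<in>?I. (\<theta>' i - \<theta> i) * cv t i \<omega>)" if "t \<in> {1..n}" for t
      using residual_eq[OF that k \<omega>] by (simp add: \<Delta>)
    have e1: "(\<Sum>t=1..n. residual N v W t \<omega> k * one_p N t \<omega> j) = (\<Sum>t=1..n. ?e t * cv t j \<omega>)"
      by (intro sum.cong refl) (simp only: r one_p_eq[OF j])
    have e2: "(\<Sum>t=1..n. (residual N v W t \<omega> k)\<^sup>2 * (one_p N t \<omega> j)\<^sup>2) = (\<Sum>t=1..n. (?e t)\<^sup>2 * (cv t j \<omega>)\<^sup>2)"
      by (intro sum.cong refl) (simp only: r one_p_eq[OF j])
    have "\<bar>(1 / n) * (\<Sum>t=1..n. residual N v W t \<omega> k * one_p N t \<omega> j)\<bar> \<le> tun_lambda n N * z k \<and>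
       sqrt ((1 / n) * (\<Sum>t=1..n. (residual N v W t \<omega> k)^2 * (one_p N t \<omega> j)^2)) \<le> z k"
      using feas k j unfolding step1_feasible_def prod.case by blast
    then show "\<bar>(1 / n) * (\<Sum>t=1..n. ?e t * cv t j \<omega>)\<bar> \<le> x / sqrt n * z k"
      "sqrt ((1 / n) * (\<Sum>t=1..n. (?e t)\<^sup>2 * (cv t j \<omega>)\<^sup>2)) \<le> z k"
      unfolding e1 e2 lam by blast+
  qed
  define W1 where "W1 = W(k := H_inv N k)"
  define v1 where "v1 = v(k := v_obs N k)"
  define z1 where "z1 = z(k := (1 + d) * zs)"
  have feas1: "step1_feasible n N \<omega> (W1, v1, z1)"
    unfolding step1_feasible_def prod.case
  proof (intro ballI)
    fix i j assume i: "i \<in> ?V" and j: "j \<in> ?I"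
    show "\<bar>(1 / n) * (\<Sum>t=1..n. residual N v1 W1 t \<omega> i * one_p N t \<omega> j)\<bar> \<le> tun_lambda n N * z1 i \<and>
       sqrt ((1 / n) * (\<Sum>t=1..n. (residual N v1 W1 t \<omega> i)^2 * (one_p N t \<omega> j)^2)) \<le> z1 i"
    proof (cases "i = k")
      case False
      then have "residual N v1 W1 t \<omega> i = residual N v W t \<omega> i" "z1 i = z i" for t
        by (simp_all add: residual_def v1_def W1_def z1_def)
      then show ?thesis using feas i j unfolding step1_feasible_def prod.case by (simp only:)
    next
      case True
      have "Delta v1 W1 k i = 0" for i by (simp add: Delta_def stacked_def v1_def W1_def split: option.split)
      then have r: "residual N v1 W1 t \<omega> k = ns t k \<omega>" if "t \<in> {1..n}" for t
        using residual_eq[OF that k \<omega>] by simp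
      have e1: "(\<Sum>t=1..n. residual N v1 W1 t \<omega> k * one_p N t \<omega> j) = (\<Sum>t=1..n. nc t k j \<omega>)"
        by (intro sum.cong refl) (simp only: r one_p_eq[OF j] nc_def)
      have e2: "(\<Sum>t=1..n. (residual N v1 W1 t \<omega> k)\<^sup>2 * (one_p N t \<omega> j)\<^sup>2) = (\<Sum>t=1..n. (nc t k j \<omega>)\<^sup>2)"
        by (intro sum.cong refl) (simp only: r one_p_eq[OF j] sq_nc)
      have z1: "z1 k = (1 + d) * zs" by (simp add: z1_def)
      have "zs \<le> (1 + d) * zs" using d zs0 by (simp add: distrib_right)
      then have "f j \<le> (1 + d) * zs" using fmax[OF j] by linarith
      then show ?thesis using score[OF j] unfolding True e1 e2 lam z1 f_def by blast
    qed
  qed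
  have tau: "tun_tau n N \<omega> = 1 / (4 * mn \<omega>)" by (simp add: tun_tau_def mn_def)
  have "(\<Sum>i\<in>?V. (\<bar>v i\<bar> + (\<Sum>j\<in>?V. \<bar>W i j\<bar>)) + tun_tau n N \<omega> * z i)
      \<le> (\<Sum>i\<in>?V. (\<bar>v1 i\<bar> + (\<Sum>j\<in>?V. \<bar>W1 i j\<bar>)) + tun_tau n N \<omega> * z1 i)"
    using opt feas1 by (auto simp: is_arg_min_def step1_objective_def not_less)
  then have "(\<bar>v k\<bar> + (\<Sum>j\<in>?V. \<bar>W k j\<bar>)) + tun_tau n N \<omega> * z k
      \<le> (\<bar>v1 k\<bar> + (\<Sum>j\<in>?V. \<bar>W1 k j\<bar>)) + tun_tau n N \<omega> * z1 k"
    by (rule sum_le_imp_entry_le[OF finite_obs k]) (simp add: v1_def W1_def z1_def)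
  then have optk: "(\<Sum>i\<in>?I. \<bar>\<theta>' i\<bar>) + 1 / (4 * mn \<omega>) * z k \<le> (\<Sum>i\<in>?I. \<bar>\<theta> i\<bar>) + 1 / (4 * mn \<omega>) * ((1 + d) * zs)"
    by (simp add: sum_Vbar \<theta>_def \<theta>'_def stacked_def v1_def W1_def z1_def tau)
  obtain D where D: "sparse_mat_on ?V s D" "mat_norm_inf ?V (\<lambda>i j. H_inv N i j - D i j) \<le> r"
    using sp by (auto simp: sparse_approx_on_def)
  define T where "T = {j\<in>?V. D k j \<noteq> 0}"
  \<comment> \<open>The intercept is put into the support, so that its size does not enter r; this
    costs one index, and s + 1 <= 2 s.\<close>
  define S where "S = insert None (Some ` T)"
  have finT: "finite T" using finite_obs by (simp add: T_def)
  have SI: "S \<subseteq> ?I" by (auto simp: S_def T_def Vbar_def)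
  have "card T \<le> s" using D(1) k by (auto simp: sparse_mat_on_def T_def)
  then have cS: "real (card S) \<le> 2 * real s"
    using s finT unfolding S_def by (subst card_insert_disjoint) (auto simp: card_image)
  have Sr: "(\<Sum>i\<in>?I-S. \<bar>\<theta> i\<bar>) \<le> r"
  proof -
    have "?I - S = Some ` (?V - T)" by (auto simp: S_def Vbar_def)
    then have "(\<Sum>i\<in>?I-S. \<bar>\<theta> i\<bar>) = (\<Sum>j\<in>?V-T. \<bar>H_inv N k j\<bar>)"
      by (simp add: sum.reindex \<theta>_def stacked_def)
    also have "\<dots> = (\<Sum>j\<in>?V-T. \<bar>H_inv N k j - D k j\<bar>)" by (intro sum.cong refl) (simp add: T_def)
    also have "\<dots> \<le> (\<Sum>j\<in>?V. \<bar>H_inv N k j - D k j\<bar>)" using finite_obs by (intro sum_mono2) auto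
    also have "\<dots> \<le> mat_norm_inf ?V (\<lambda>i j. H_inv N i j - D i j)"
      unfolding mat_norm_inf_def by (rule Max_ge) (use finite_obs k in auto)
    finally show ?thesis using D(2) by linarith
  qed
  have re: "1 / Ce * (\<Sum>i\<in>?I. (u i)\<^sup>2) - sqrt (32 * B^4 * n * L) / n * (\<Sum>i\<in>?I. \<bar>u i\<bar>)\<^sup>2
      \<le> (1 / n) * (\<Sum>t=1..n. (\<Sum>i\<in>?I. u i * cv t i \<omega>)\<^sup>2)" for u
    by (rule gram_restricted_eigenvalue) (use good in \<open>auto simp: good_def\<close>)
  have small2: "72 * real s * (4 * mn \<omega> * (x / sqrt n)) \<le> 1 / Ce / 4"
  proof -
    have "72 * real s * (4 * mn \<omega> * (x / sqrt n)) \<le> 72 * real s * (4 * B\<^sup>2 * (x / sqrt n))"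
      using mn(2) x by (intro mult_left_mono mult_right_mono) auto
    then show ?thesis using small(2) by linarith
  qed
  have lam0: "0 \<le> x / sqrt n" using x by simp
  have s0: "0 < real s" using s by simp
  have k0: "0 < 1 / Ce" using Ce_pos by simp
  have zs_eq: "zs = sqrt ((1 / n) * (\<Sum>t=1..n. (ns t k \<omega>)\<^sup>2 * (cv t j0 \<omega>)\<^sup>2))"
    unfolding zs_def f_def sq_nc ..
  have sc: "\<bar>(1 / n) * (\<Sum>t=1..n. ns t k \<omega> * cv t j \<omega>)\<bar> \<le> x / sqrt n * ((1 + d) * zs)" if "j \<in> ?I" for j
    using score[OF that] unfolding nc_def .
  have "0 < n" using n by simp
  show ?thesis
    unfolding \<Delta>
    by (rule self_tuned_lasso_l1[OF finite_Vbar \<open>0 < n\<close> mn(1) mn(3) feas'1 feas'2 sc j0(1) zs_eq zsZ optk d lam0 SI Sr cS s0 re k0 small(1) small2])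
qed

lemma remainder_bound:
  assumes \<omega>: "\<omega> \<in> space (law N)" and good: "good x d \<omega>" and x: "0 \<le> x" "L \<le> x\<^sup>2"
    and lam: "tun_lambda n N = x / sqrt n" and d: "0 \<le> d" "d \<le> 1"
    and s: "1 \<le> s" and sp: "sparse_approx_on (agents_obs N) s r (H_inv N)"
    and small: "72 * s * (sqrt (32 * B^4 * n * L) / n) \<le> 1 / Ce / 4" "72 * s * (4 * B\<^sup>2 * (x / sqrt n)) \<le> 1 / Ce / 4"
    and opt1: "is_arg_min (step1_objective n N \<omega>) (step1_feasible n N \<omega>) (W, v, z)"
    and opt2: "is_arg_min (step2_objective n N \<omega>) (step2_feasible n N \<omega>) (\<zeta>, \<Psi>)"
    and k: "k \<in> agents_obs N" and j: "j \<in> Vbar N"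
  shows "\<bar>sqrt n * (\<Sum>i\<in>Vbar N. Delta v W k i * (of_bool (j = i) - (\<Sum>m\<in>Vbar N. \<Psi> j m * sigma_hat n N \<omega> m i)))\<bar>
    \<le> x * zeta_bound * (576 * noise_bound / (1 / Ce) * (s * (x / sqrt n)) + 6 * r + 6 * noise_bound * d)"
proof -
  have n0: "0 < real n" using n by simp
  have lz: "\<bar>of_bool (j = i) - (\<Sum>m\<in>Vbar N. \<Psi> j m * sigma_hat n N \<omega> m i)\<bar> \<le> x / sqrt n * zeta_bound"
    if i: "i \<in> Vbar N" for i
  proof -
    have "\<bar>(\<Sum>m\<in>Vbar N. \<Psi> j m * sigma_hat n N \<omega> m i) - of_bool (j = i)\<bar> \<le> tun_lambda n N * \<zeta> j"
      using opt2 i j by (auto simp: is_arg_min_def step2_feasible_def)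
    also have "\<dots> \<le> x / sqrt n * zeta_bound"
      unfolding lam using step2_bound[OF good x lam opt2 j] x by (intro mult_left_mono) auto
    finally show ?thesis by (simp add: abs_minus_commute)
  qed
  have "\<bar>\<Sum>i\<in>Vbar N. Delta v W k i * (of_bool (j = i) - (\<Sum>m\<in>Vbar N. \<Psi> j m * sigma_hat n N \<omega> m i))\<bar>
      \<le> (\<Sum>i\<in>Vbar N. \<bar>Delta v W k i\<bar> * (x / sqrt n * zeta_bound))"
    by (rule order_trans[OF sum_abs]) (unfold abs_mult, intro sum_mono mult_left_mono lz abs_ge_zero)
  also have "\<dots> = (x / sqrt n * zeta_bound) * (\<Sum>i\<in>Vbar N. \<bar>Delta v W k i\<bar>)"
    by (simp add: sum_distrib_left mult.commute)
  also have "\<dots> \<le> (x / sqrt n * zeta_bound) * (576 * noise_bound / (1 / Ce) * (s * (x / sqrt n)) + 6 * r + 6 * noise_bound * d)"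
  proof (rule mult_left_mono[OF step1_l1[OF \<omega> good x(1) lam d s sp small opt1 k]])
    show "0 \<le> x / sqrt n * zeta_bound" using x C_pos by (simp add: zeta_bound_def)
  qed
  finally have "sqrt n * \<bar>\<Sum>i\<in>Vbar N. Delta v W k i * (of_bool (j = i) - (\<Sum>m\<in>Vbar N. \<Psi> j m * sigma_hat n N \<omega> m i))\<bar>
      \<le> sqrt n * ((x / sqrt n * zeta_bound) * (576 * noise_bound / (1 / Ce) * (s * (x / sqrt n)) + 6 * r + 6 * noise_bound * d))"
    by (rule mult_left_mono) simp
  also have "\<dots> = (sqrt n * (x / sqrt n)) * zeta_bound * (576 * noise_bound / (1 / Ce) * (s * (x / sqrt n)) + 6 * r + 6 * noise_bound * d)"
    by (simp only: mult.assoc)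
  also have "sqrt n * (x / sqrt n) = x" using n0 by simp
  finally show ?thesis by (simp add: abs_mult)
qed

end

section \<open>Asymptotics\<close>

text \<open>log p dominates a multiple of log n and therefore diverges, and p with it. The quantity
  g is the order of d and of the tuning parameter; s g tends to 0, which is what the smallness
  conditions of the regression require.\<close>

lemma regular_design_rates:
  fixes p :: "nat \<Rightarrow> real" and s :: "nat \<Rightarrow> nat"
  defines "g \<equiv> \<lambda>n. sqrt (ln (p n) / real n)"
  assumes p: "\<And>n. 1 \<le> n \<Longrightarrow> 1 \<le> p n" and s: "\<And>n. 1 \<le> n \<Longrightarrow> 1 \<le> s n"
    and C': "0 < C'" "\<And>n. 1 \<le> n \<Longrightarrow> ln n \<le> C' * ln (p n)"
    and o1: "(\<lambda>n. (real (s n))^2 * ln (p n) * (ln n)^3) \<in> o(\<lambda>n. real n)"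
  shows "filterlim (\<lambda>n. ln (p n)) at_top sequentially" and "filterlim p at_top sequentially"
    and "(\<lambda>n. real (s n) * g n) \<longlonglongrightarrow> 0" and "g \<longlonglongrightarrow> 0"
proof -
  show L: "filterlim (\<lambda>n. ln (p n)) at_top sequentially"
  proof (rule filterlim_at_top_mono)
    show "filterlim (\<lambda>n. (1 / C') * ln (real n)) at_top sequentially"
      by (rule filterlim_tendsto_pos_mult_at_top[OF tendsto_const])
         (use C'(1) in \<open>auto intro: filterlim_compose[OF ln_at_top filterlim_real_sequentially]\<close>)
    show "\<forall>\<^sub>F n in sequentially. (1 / C') * ln (real n) \<le> ln (p n)"
      using eventually_ge_at_top[of 1]
      by eventually_elim (use C' in \<open>auto simp: field_simps\<close>)
  qed
  show "filterlim p at_top sequentially"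
  proof (rule filterlim_at_top_mono[OF L])
    show "\<forall>\<^sub>F n in sequentially. ln (p n) \<le> p n"
      using eventually_ge_at_top[of 1]
    proof eventually_elim
      case (elim n)
      then show ?case using p[of n] ln_le_minus_one[of "p n"] by linarith
    qed
  qed
  have lim: "(\<lambda>n. (real (s n))^2 * ln (p n) * (ln n)^3 / real n) \<longlonglongrightarrow> 0"
    using smalloD_tendsto[OF o1] by simp
  have L0: "0 \<le> ln (p n) / real n" if "1 \<le> n" for n using p[OF that] by simp
  have "(\<lambda>n. (real (s n) * g n)\<^sup>2) \<longlonglongrightarrow> 0"
  proof (rule tendsto_sandwich[OF _ _ tendsto_const lim])
    show "\<forall>\<^sub>F n in sequentially. (real (s n) * g n)\<^sup>2 \<le> (real (s n))^2 * ln (p n) * (ln n)^3 / real n"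
      \<comment> \<open>From n = 3 on log n is at least 1, so s^2 log p / n is bounded by the
        assumed rate.\<close>
      using eventually_ge_at_top[of 3]
    proof eventually_elim
      case (elim n)
      have "exp 1 \<le> real n" using elim exp_le by linarith
      then have "1 \<le> ln (real n)" using elim by (simp add: ln_ge_iff)
      then have "1 \<le> (ln (real n))^3" by simp
      then have "(real (s n))\<^sup>2 * (ln (p n) / n) * 1 \<le> (real (s n))\<^sup>2 * (ln (p n) / n) * (ln n)^3"
        using L0[of n] elim by (intro mult_left_mono mult_nonneg_nonneg) auto
      moreover have "(g n)\<^sup>2 = ln (p n) / n" using L0[of n] elim unfolding g_def by simp
      ultimately show ?case by (simp add: power_mult_distrib)
    qed
  qed simp
  from tendsto_real_sqrt[OF this, unfolded real_sqrt_zero]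
  show sg: "(\<lambda>n. real (s n) * g n) \<longlonglongrightarrow> 0"
  proof (rule Lim_transform_eventually)
    show "\<forall>\<^sub>F n in sequentially. sqrt ((real (s n) * g n)\<^sup>2) = real (s n) * g n"
      using eventually_ge_at_top[of 1] by eventually_elim (use L0 in \<open>auto simp: g_def\<close>)
  qed
  show "g \<longlonglongrightarrow> 0"
  proof (rule tendsto_sandwich[OF _ _ tendsto_const sg])
    show "\<forall>\<^sub>F n in sequentially. 0 \<le> g n"
      using eventually_ge_at_top[of 1] by eventually_elim (use L0 in \<open>auto simp: g_def\<close>)
    show "\<forall>\<^sub>F n in sequentially. g n \<le> real (s n) * g n"
      using eventually_ge_at_top[of 1]
    proof eventually_elim
      case (elim n)
      have "0 \<le> g n" using L0[OF elim] by (simp add: g_def)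
      moreover have "1 \<le> real (s n)" using s[OF elim] by simp
      ultimately show ?case using mult_right_mono[of 1 "real (s n)" "g n"] by simp
    qed
  qed
qed

theorem theorem1:
  fixes N :: "nat \<Rightarrow> ('v, 'w) network"
    and s :: "nat \<Rightarrow> nat" and r :: "nat \<Rightarrow> real"
    and bM bA bL bP :: real
    and W_hat :: "nat \<Rightarrow> 'w \<Rightarrow> 'v \<Rightarrow> 'v \<Rightarrow> real"
    and v_hat z_hat :: "nat \<Rightarrow> 'w \<Rightarrow> 'v \<Rightarrow> real"
    and \<Psi>_hat :: "nat \<Rightarrow> 'w \<Rightarrow> 'v option \<Rightarrow> 'v option \<Rightarrow> real"
    and \<zeta>_hat :: "nat \<Rightarrow> 'w \<Rightarrow> 'v option \<Rightarrow> real"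
  assumes network: "\<And>n. n \<ge> 1 \<Longrightarrow> linear_network n bM bA bL bP (N n)"
    and regular: "regular_design N s r"
    and step1: "\<And>n \<omega>. n \<ge> 1 \<Longrightarrow> \<omega> \<in> space (law (N n)) \<Longrightarrow>
      is_arg_min (step1_objective n (N n) \<omega>) (step1_feasible n (N n) \<omega>)
        (W_hat n \<omega>, v_hat n \<omega>, z_hat n \<omega>)"
    and step2: "\<And>n \<omega>. n \<ge> 1 \<Longrightarrow> \<omega> \<in> space (law (N n)) \<Longrightarrow>
      is_arg_min (step2_objective n (N n) \<omega>) (step2_feasible n (N n) \<omega>)
        (\<zeta>_hat n \<omega>, \<Psi>_hat n \<omega>)"
  shows "\<exists>K::real>0. \<forall>C1::real>0. \<exists>C2::real>0. \<exists>A.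
    (\<forall>n. A n \<in> sets (law (N n))) \<and>
    (\<lambda>n. measure (law (N n)) (A n)) \<longlonglongrightarrow> 1 \<and>
    (\<forall>n\<ge>1. \<forall>\<omega>\<in>A n.
      let V = agents_obs (N n);
          \<theta>_check = debiased n (N n) \<omega> (W_hat n \<omega>) (v_hat n \<omega>) (\<Psi>_hat n \<omega>);
          W_check = debiased_W n (N n) \<omega> (W_hat n \<omega>) (v_hat n \<omega>) (\<Psi>_hat n \<omega>)
      in
        (\<exists>R :: 'v \<Rightarrow> 'v option \<Rightarrow> real. \<forall>k\<in>V.
          (\<forall>j\<in>Vbar (N n).
            sqrt n * (\<theta>_check k j - stacked (v_obs (N n)) (H_inv (N n)) k j) =
              - (\<Sum>m\<in>Vbar (N n). \<Psi>_hat n \<omega> j m *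
                   ((1 / sqrt n) * (\<Sum>t=1..n. eps (N n) t k \<omega> * one_p (N n) t \<omega> m))) + R k j) \<and>
          (MAX j\<in>Vbar (N n). \<bar>R k j\<bar>)
            \<le> K * (s n * ln (card V) / sqrt n + r n * sqrt (ln (card V)))) \<and>
        (\<forall>\<mu> :: 'v \<Rightarrow> 'v \<Rightarrow> real.
          (\<forall>k\<in>V. \<forall>j\<in>V. 2 * \<bar>W_check k j - H_inv (N n) k j\<bar> \<le> \<mu> k j \<and>
             \<mu> k j \<le> C1 * sqrt (ln (card V) / n)) \<longrightarrow>
          mat_norm_inf V (\<lambda>k j. thresholded \<mu> W_check k j - H_inv (N n) k j)
            \<le> real (s n) * C2 * sqrt (ln (card V) / n) + 3 * r n \<and>
          mat_norm_1 V (\<lambda>k j. thresholded \<mu> W_check k j - H_inv (N n) k j)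
            \<le> real (s n) * C2 * sqrt (ln (card V) / n) + 3 * r n))"
proof -
  obtain c C C' Ce Me Mp where c: "0 < c" "c < C" and C'0: "0 < C'"
    and reg': "\<forall>n\<ge>1. Me n \<ge> 1 \<and> Mp n \<ge> 1 \<and>
           regular_data n (N n) \<and> regular_noise n c C (Me n) (N n) \<and>
           regular_covar n c C Ce (Mp n) (N n) \<and>
           C' * ln (card (agents_obs (N n))) \<ge> ln n"
    and o1: "(\<lambda>n. (real (s n))^2 * ln (card (agents_obs (N n))) * (ln n)^3) \<in> o(\<lambda>n. real n)"
    and o2: "(\<lambda>n. Me n * Mp n * ln (card (agents_obs (N n)))) \<in> o(\<lambda>n. real n)"
    using regular unfolding regular_design_def by (elim conjE exE) (rule that; assumption)
  note reg = reg'[rule_format]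
  have sparse: "s n \<ge> 1" "sparse_approx_on (agents_obs (N n)) (s n) (r n) (H_inv (N n))" if "n \<ge> 1" for n
    using regular that unfolding regular_design_def by blast+
  have rn: "regular_network (N n) n bM bA bL bP c C Ce (Me n) (Mp n)" if "1 \<le> n" for n
    using reg[OF that] network[OF that] c that unfolding regular_network_def by (elim conjE) (intro conjI; assumption)
  define p where "p = (\<lambda>n. real (card (agents_obs (N n))))"
  define bB where "bB = max 1 bP"
  define g where "g = (\<lambda>n. sqrt (ln (p n) / real n))"
  define x where "x = (\<lambda>n. inv std_normal_cdf (1 - 1 / (3 * real n * (p n)\<^sup>2)))"
  define D where "D = sqrt (8 * (C * bB^4) / (c / Ce)\<^sup>2)"
  define Z where "Z = 5 * sqrt (1 + C * bB^4)"
  define \<zeta> where "\<zeta> = root 4 (2 * C + 4) + sqrt (8 * (4 * C + 12))"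
  \<comment> \<open>From x^2 <= 2 log (3 n p^2) and log n <= C' log p one gets x^2 <= 4 + (2 C' + 4)
    log p, and the 4 is absorbed once log p >= 4.\<close>
  define q where "q = sqrt (2 * C' + 5)"
  \<comment> \<open>The factor x contributes q sqrt (log p) in front and once more inside the l1
    bound; the bracket adds up the coefficients of the three error terms. C1 does not enter, so K
    can be fixed before it.\<close>
  define K where "K = q * \<zeta> * (576 * Z * Ce * q + 6 * Z * D + 6)"
  have B1: "1 \<le> bB" by (simp add: bB_def)
  have Ce0: "0 < Ce" using regular_network.Ce_pos[OF rn[of 1]] by simp
  have C0: "0 < C" using c by simp
  have D0: "0 \<le> D" using C0 by (simp add: D_def)
  have "0 < C * bB^4" using C0 B1 by simp
  then have Z0: "0 < Z" by (simp add: Z_def)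
  have \<zeta>0: "0 < \<zeta>" using C0 by (simp add: \<zeta>_def add_pos_pos)
  have q0: "0 < q" using C'0 by (simp add: q_def)
  have K0: "0 < K" unfolding K_def using q0 \<zeta>0 Z0 Ce0 D0
    by (intro mult_pos_pos add_nonneg_pos add_nonneg_nonneg mult_nonneg_nonneg) auto
  have p1: "1 \<le> p n" if "1 \<le> n" for n
  proof -
    interpret regular_network "N n" n bM bA bL bP c C Ce "Me n" "Mp n" by (rule rn[OF that])
    have "card (agents_obs (N n)) \<noteq> 0" using finite_obs obs_nonempty by simp
    then show ?thesis by (simp add: p_def)
  qed
  have C'L: "ln n \<le> C' * ln (p n)" if "1 \<le> n" for n using reg[OF that] by (simp add: p_def)
  have o1': "(\<lambda>n. (real (s n))^2 * ln (p n) * (ln n)^3) \<in> o(\<lambda>n. real n)" using o1 by (simp add: p_def)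
  have rates: "filterlim (\<lambda>n. ln (p n)) at_top sequentially" "filterlim p at_top sequentially"
    "(\<lambda>n. real (s n) * g n) \<longlonglongrightarrow> 0" "g \<longlonglongrightarrow> 0"
    unfolding g_def by (rule regular_design_rates[OF p1 sparse(1) C'0 C'L o1']; assumption)+
  have L0: "0 \<le> ln (p n)" if "1 \<le> n" for n using p1[OF that] by simp
  have g0: "0 \<le> g n" if "1 \<le> n" for n using L0[OF that] by (simp add: g_def)

  \<comment> \<open>The requirements on large n: the size of p puts 3 n p^2 above 1000 for the
    quantile bounds, log p >= 4 absorbs the additive constants there, D g <= 1/2 is the range of the
    self-normalized bound, and the last two inequalities absorb the quadratic terms of the
    regression.\<close>
  define E where "E = (\<lambda>n. 2 \<le> n \<and> 2 \<le> p n \<and> 4 \<le> ln (p n) \<and> 500 \<le> p n \<and> D * g n \<le> 1/2 \<and>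
      72 * sqrt (32 * bB^4) * (s n * g n) \<le> 1 / Ce / 4 \<and> 72 * (4 * bB\<^sup>2) * q * (s n * g n) \<le> 1 / Ce / 4)"
  have evE: "\<forall>\<^sub>F n in sequentially. E n"
  proof -
    have "(\<lambda>n. D * g n) \<longlonglongrightarrow> 0" using tendsto_mult_left[OF rates(4), of D] by simp
    then have 1: "\<forall>\<^sub>F n in sequentially. D * g n < 1/2" by (rule order_tendstoD) simp
    have "(\<lambda>n. 72 * sqrt (32 * bB^4) * (s n * g n)) \<longlonglongrightarrow> 0"
      using tendsto_mult_left[OF rates(3), of "72 * sqrt (32 * bB^4)"] by simp
    then have 2: "\<forall>\<^sub>F n in sequentially. 72 * sqrt (32 * bB^4) * (s n * g n) < 1 / Ce / 4"
      by (rule order_tendstoD) (use Ce0 in simp)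
    have "(\<lambda>n. 72 * (4 * bB\<^sup>2) * q * (s n * g n)) \<longlonglongrightarrow> 0"
      using tendsto_mult_left[OF rates(3), of "72 * (4 * bB\<^sup>2) * q"] by simp
    then have 3: "\<forall>\<^sub>F n in sequentially. 72 * (4 * bB\<^sup>2) * q * (s n * g n) < 1 / Ce / 4"
      by (rule order_tendstoD) (use Ce0 in simp)
    have 4: "\<forall>\<^sub>F n in sequentially. 4 \<le> ln (p n)" "\<forall>\<^sub>F n in sequentially. 500 \<le> p n"
      using rates(1,2) unfolding filterlim_at_top by blast+
    show ?thesis using 1 2 3 4 eventually_ge_at_top[of 2]
      by eventually_elim (auto simp: E_def)
  qed
  have En: "1 \<le> n" if "E n" for n using that by (simp add: E_def)
  have quant: "1 \<le> x n" "x n \<le> q * sqrt (ln (p n))" "ln (p n) \<le> (x n)\<^sup>2"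
      "exp (- (x n)\<^sup>2 / 2) \<le> 13 * x n / (3 * real n * (p n)\<^sup>2)" if E: "E n" for n
  proof -
    have n: "2 \<le> real n" "500 \<le> p n" "4 \<le> ln (p n)" using E by (auto simp: E_def)
    have m: "1000 \<le> 3 * real n * (p n)\<^sup>2"
    proof -
      have "500\<^sup>2 \<le> (p n)\<^sup>2" by (rule power_mono) (use n in auto)
      then have "6 * 500\<^sup>2 \<le> (3 * real n) * (p n)\<^sup>2" using n by (intro mult_mono) auto
      then show ?thesis by simp
    qed
    have xeq: "x n = inv std_normal_cdf (1 - 1 / (3 * real n * (p n)\<^sup>2))" by (simp add: x_def)
    note nq = normal_quantile_bounds[OF m xeq]
    show "1 \<le> x n" by (rule nq(1))
    show "exp (- (x n)\<^sup>2 / 2) \<le> 13 * x n / (3 * real n * (p n)\<^sup>2)" by (rule nq(4))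
    have lm: "ln (3 * real n * (p n)\<^sup>2) = ln 3 + ln n + 2 * ln (p n)"
      using n by (simp add: ln_mult ln_realpow)
    have "0 \<le> ln (3::real)" "0 \<le> ln (real n)" using n by auto
    then show "ln (p n) \<le> (x n)\<^sup>2" using nq(3) lm n by linarith
    have "ln (3::real) \<le> 2" using ln_le_minus_one[of "3::real"] by simp
    then have "(x n)\<^sup>2 \<le> 4 + 2 * (C' * ln (p n)) + 4 * ln (p n)"
      using nq(2) lm C'L[OF En[OF E]] by linarith
    also have "\<dots> \<le> (2 * C' + 5) * ln (p n)" using n by (simp add: algebra_simps)
    finally have "sqrt ((x n)\<^sup>2) \<le> sqrt ((2 * C' + 5) * ln (p n))" by (rule real_sqrt_le_mono)
    then show "x n \<le> q * sqrt (ln (p n))" using nq(1) by (simp add: q_def real_sqrt_mult)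
  qed
  have xg: "x n / sqrt n \<le> q * g n" if "E n" for n
    using divide_right_mono[OF quant(2)[OF that], of "sqrt n"] by (simp add: g_def real_sqrt_divide)

  define b where "b = (\<lambda>n. 28 / (p n)\<^sup>2 + Mp n * ln (p n) / n + Me n * (bB\<^sup>2 * ln (p n) / (n * (c / Ce)))\<^sup>2
        + 4 * (p n)\<^sup>2 * exp (- (x n)\<^sup>2 / 2))"
  have b_lim: "b \<longlonglongrightarrow> 0"
  proof -
    have 1: "(\<lambda>n. 28 / (p n)\<^sup>2) \<longlonglongrightarrow> 0"
      by (intro tendsto_divide_0[OF tendsto_const] filterlim_at_top_imp_at_infinity filterlim_pow_at_top rates) simp
    have lim2: "(\<lambda>n. Me n * Mp n * ln (p n) / n) \<longlonglongrightarrow> 0"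
      using smalloD_tendsto[OF o2] by (simp add: p_def)
    have 2: "(\<lambda>n. Mp n * ln (p n) / n) \<longlonglongrightarrow> 0" and 3: "(\<lambda>n. Me n * ln (p n) / n) \<longlonglongrightarrow> 0"
    proof -
      have le: "0 \<le> Mp n * ln (p n) / n" "Mp n * ln (p n) / n \<le> Me n * Mp n * ln (p n) / n"
        "0 \<le> Me n * ln (p n) / n" "Me n * ln (p n) / n \<le> Me n * Mp n * ln (p n) / n" if n: "1 \<le> n" for n
      proof -
        have M: "1 \<le> Me n" "1 \<le> Mp n" using reg[OF n] by auto
        have "1 * Mp n \<le> Me n * Mp n" "Me n * 1 \<le> Me n * Mp n"
          using M by (intro mult_right_mono mult_left_mono; simp)+
        then show "Mp n * ln (p n) / n \<le> Me n * Mp n * ln (p n) / n" "Me n * ln (p n) / n \<le> Me n * Mp n * ln (p n) / n"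
          using L0[OF n] by (auto intro!: divide_right_mono mult_right_mono)
        show "0 \<le> Mp n * ln (p n) / n" "0 \<le> Me n * ln (p n) / n" using M L0[OF n] by auto
      qed
      show "(\<lambda>n. Mp n * ln (p n) / n) \<longlonglongrightarrow> 0"
        by (rule tendsto_sandwich[OF _ _ tendsto_const lim2]; rule eventually_mono[OF eventually_ge_at_top[of 1]])
           (use le in auto)
      show "(\<lambda>n. Me n * ln (p n) / n) \<longlonglongrightarrow> 0"
        by (rule tendsto_sandwich[OF _ _ tendsto_const lim2]; rule eventually_mono[OF eventually_ge_at_top[of 1]])
           (use le in auto)
    qed
    \<comment> \<open>M_eps (log p / n)^2 is the product of M_eps log p / n and g^2, and both
      factors vanish.\<close>
    have "(\<lambda>n. (bB\<^sup>2 / (c / Ce))\<^sup>2 * (Me n * ln (p n) / n * (g n)\<^sup>2)) \<longlonglongrightarrow> (bB\<^sup>2 / (c / Ce))\<^sup>2 * (0 * 0\<^sup>2)"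
      by (intro tendsto_intros 3 rates(4))
    then have "(\<lambda>n. (bB\<^sup>2 / (c / Ce))\<^sup>2 * (Me n * ln (p n) / n * (g n)\<^sup>2)) \<longlonglongrightarrow> 0" by simp
    then have 4: "(\<lambda>n. Me n * (bB\<^sup>2 * ln (p n) / (n * (c / Ce)))\<^sup>2) \<longlonglongrightarrow> 0"
    proof (rule Lim_transform_eventually)
      show "\<forall>\<^sub>F n in sequentially. (bB\<^sup>2 / (c / Ce))\<^sup>2 * (Me n * ln (p n) / n * (g n)\<^sup>2) = Me n * (bB\<^sup>2 * ln (p n) / (n * (c / Ce)))\<^sup>2"
        using eventually_ge_at_top[of 1]
      proof eventually_elim
        case (elim n)
        have "(g n)\<^sup>2 = ln (p n) / n" using L0[OF elim] unfolding g_def by simp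
        then show ?case by (simp add: power2_eq_square mult_ac)
      qed
    qed
    have "(\<lambda>n. 52/3 * (q * g n)) \<longlonglongrightarrow> 52/3 * (q * 0)" by (intro tendsto_intros rates(4))
    then have lim5: "(\<lambda>n. 52/3 * (q * g n)) \<longlonglongrightarrow> 0" by simp
    \<comment> \<open>The quantile bound cancels p^2 and leaves a multiple of x / n, which is at
      most x / sqrt n and hence of order g.\<close>
    have 5: "(\<lambda>n. 4 * (p n)\<^sup>2 * exp (- (x n)\<^sup>2 / 2)) \<longlonglongrightarrow> 0"
    proof (rule tendsto_sandwich[OF _ _ tendsto_const lim5])
      show "\<forall>\<^sub>F n in sequentially. 4 * (p n)\<^sup>2 * exp (- (x n)\<^sup>2 / 2) \<le> 52/3 * (q * g n)"
        using evE
      proof eventually_elim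
        case (elim n)
        have n: "1 \<le> real n" "0 < p n" using elim by (auto simp: E_def)
        have "4 * (p n)\<^sup>2 * exp (- (x n)\<^sup>2 / 2) \<le> 4 * (p n)\<^sup>2 * (13 * x n / (3 * real n * (p n)\<^sup>2))"
          by (rule mult_left_mono[OF quant(4)[OF elim]]) simp
        also have "\<dots> = 52/3 * (x n / n)" using n by (simp add: field_simps)
        also have "\<dots> \<le> 52/3 * (x n / sqrt n)"
        proof -
          have "sqrt n \<le> n" using n by (intro real_le_lsqrt) (auto simp: power2_eq_square)
          then show ?thesis using n quant(1)[OF elim] by (intro mult_left_mono divide_left_mono) auto
        qed
        also have "\<dots> \<le> 52/3 * (q * g n)" using xg[OF elim] by simp
        finally show ?case .
      qed
    qed simp
    have "(\<lambda>n. 28 / (p n)\<^sup>2 + Mp n * ln (p n) / n + Me n * (bB\<^sup>2 * ln (p n) / (n * (c / Ce)))\<^sup>2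
        + 4 * (p n)\<^sup>2 * exp (- (x n)\<^sup>2 / 2)) \<longlonglongrightarrow> 0 + 0 + 0 + 0"
      by (intro tendsto_add 1 2 4 5)
    then show ?thesis by (simp add: b_def)
  qed

  define G where "G = (\<lambda>n. regular_network.good (N n) n bP C (x n) (D * g n))"
  have ex: "\<exists>A. A \<in> sets (law (N n)) \<and> (\<forall>\<omega>\<in>A. G n \<omega>) \<and> 1 - b n \<le> measure (law (N n)) A" if E: "E n" for n
  proof -
    interpret regular_network "N n" n bM bA bL bP c C Ce "Me n" "Mp n" by (rule rn[OF En[OF E]])
    have Leq: "L = ln (p n)" and Beq: "B = bB" by (simp_all add: L_def p_def B_def bB_def)
    have deq: "D * g n = sqrt (8 * (C * B^4) * L / (n * (c / Ce)\<^sup>2))"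
      unfolding D_def g_def Leq Beq real_sqrt_mult[symmetric] by (simp add: mult_ac)
    show ?thesis
    proof (rule good_event[OF _ _ deq])
      show "2 \<le> card (agents_obs (N n))" "0 \<le> x n" "D * g n \<le> 1/2"
        using E quant(1)[OF E] by (auto simp: E_def p_def)
      fix A assume "A \<in> events" "\<And>\<omega>. \<omega> \<in> A \<Longrightarrow> good (x n) (D * g n) \<omega>"
        "1 - (28 / (card (agents_obs (N n)))\<^sup>2 + Mp n * L / n + Me n * (B\<^sup>2 * L / (n * (c / Ce)))\<^sup>2
        + 4 * (card (agents_obs (N n)))\<^sup>2 * exp (- (x n)\<^sup>2 / 2)) \<le> prob A"
      then show ?thesis unfolding G_def b_def Leq Beq by (auto simp: p_def)
    qed
  qed
  \<comment> \<open>Where \<open>E\<close> fails the event is empty: the conclusion then holds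
    vacuously for these n, and the limit of the probabilities is not affected.\<close>
  define A where "A = (\<lambda>n. if E n then SOME A. A \<in> sets (law (N n)) \<and> (\<forall>\<omega>\<in>A. G n \<omega>) \<and> 1 - b n \<le> measure (law (N n)) A else {})"
  have A: "A n \<in> sets (law (N n))" "\<And>\<omega>. \<omega> \<in> A n \<Longrightarrow> G n \<omega>" "1 - b n \<le> measure (law (N n)) (A n)" if "E n" for n
    using someI_ex[OF ex[OF that]] that by (auto simp: A_def)
  have A_sets: "A n \<in> sets (law (N n))" for n using A(1)[of n] by (cases "E n") (auto simp: A_def)
  have A_lim: "(\<lambda>n. measure (law (N n)) (A n)) \<longlonglongrightarrow> 1"
  proof (rule tendsto_sandwich)
    show "\<forall>\<^sub>F n in sequentially. 1 - b n \<le> measure (law (N n)) (A n)"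
      using evE by eventually_elim (rule A(3))
    show "(\<lambda>n. 1 - b n) \<longlonglongrightarrow> 1" using tendsto_diff[OF tendsto_const b_lim, of 1] by simp
    show "\<forall>\<^sub>F n in sequentially. measure (law (N n)) (A n) \<le> 1"
      using evE
    proof eventually_elim
      case (elim n)
      interpret regular_network "N n" n bM bA bL bP c C Ce "Me n" "Mp n" by (rule rn[OF En[OF elim]])
      show ?case by (rule prob_le_1)
    qed
  qed simp

  have remainder: "\<bar>sqrt n * (\<Sum>i\<in>Vbar (N n). regular_network.Delta (N n) (v_hat n \<omega>) (W_hat n \<omega>) k i *
        (of_bool (j = i) - (\<Sum>m\<in>Vbar (N n). \<Psi>_hat n \<omega> j m * sigma_hat n (N n) \<omega> m i)))\<bar>
      \<le> K * (s n * ln (card (agents_obs (N n))) / sqrt n + r n * sqrt (ln (card (agents_obs (N n)))))"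
    if \<omega>: "\<omega> \<in> A n" and k: "k \<in> agents_obs (N n)" and j: "j \<in> Vbar (N n)" for n \<omega> k j
  proof -
    have E: "E n" using \<omega> by (auto simp: A_def split: if_splits)
    have n1: "1 \<le> n" by (rule En[OF E])
    interpret regular_network "N n" n bM bA bL bP c C Ce "Me n" "Mp n" by (rule rn[OF n1])
    have Leq: "L = ln (p n)" and Beq: "B = bB" and Zeq: "noise_bound = Z" and \<zeta>eq: "zeta_bound = \<zeta>"
      by (simp_all add: L_def p_def B_def bB_def noise_bound_def Z_def zeta_bound_def \<zeta>_def)
    have n0: "0 < real n" using n1 by simp
    have sp: "\<omega> \<in> space (law (N n))" using \<omega> A_sets sets.sets_into_space by blast
    have good: "good (x n) (D * g n) \<omega>" using A(2)[OF E \<omega>] by (simp add: G_def)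
    have lam: "tun_lambda n (N n) = x n / sqrt n" by (simp add: tun_lambda_def x_def p_def)
    have s1: "1 \<le> real (s n)" using sparse(1)[OF n1] by simp
    have r0: "0 \<le> r n"
      by (rule thresholded_error(3)[OF finite_obs obs_nonempty sparse(2)[OF n1], of "H_inv (N n)" "\<lambda>_ _. 0" 0]) auto
    have x0: "0 \<le> x n" using quant(1)[OF E] by simp
    have gg: "0 \<le> g n" by (rule g0[OF n1])
    have sm1: "72 * real (s n) * (sqrt (32 * B^4 * n * L) / n) \<le> 1 / Ce / 4"
    proof -
      have "sqrt (32 * bB^4 * n * ln (p n)) / n = sqrt (32 * bB^4) * g n"
      proof -
        have "sqrt n * sqrt n = n" using n0 by simp
        then have h: "sqrt n / n = 1 / sqrt n" using n0 by (simp add: field_simps)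
        have "sqrt (32 * bB^4 * n * ln (p n)) / n = sqrt (32 * bB^4) * ((sqrt n / n) * sqrt (ln (p n)))"
          by (simp add: real_sqrt_mult)
        also have "\<dots> = sqrt (32 * bB^4) * g n" unfolding h by (simp add: g_def real_sqrt_divide)
        finally show ?thesis .
      qed
      then show ?thesis using E unfolding Beq Leq by (simp add: E_def mult_ac)
    qed
    have sm2: "72 * real (s n) * (4 * B\<^sup>2 * (x n / sqrt n)) \<le> 1 / Ce / 4"
    proof -
      have "72 * real (s n) * (4 * bB\<^sup>2 * (x n / sqrt n)) \<le> 72 * real (s n) * (4 * bB\<^sup>2 * (q * g n))"
        using xg[OF E] by (intro mult_left_mono) auto
      also have "\<dots> = 72 * (4 * bB\<^sup>2) * q * (s n * g n)" by simp
      finally show ?thesis using E unfolding Beq by (simp add: E_def)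
    qed
    have dd: "0 \<le> D * g n" "D * g n \<le> 1" using D0 gg E by (auto simp: E_def)
    have "\<bar>sqrt n * (\<Sum>i\<in>Vbar (N n). Delta (v_hat n \<omega>) (W_hat n \<omega>) k i *
        (of_bool (j = i) - (\<Sum>m\<in>Vbar (N n). \<Psi>_hat n \<omega> j m * sigma_hat n (N n) \<omega> m i)))\<bar>
        \<le> x n * \<zeta> * (576 * Z / (1 / Ce) * (s n * (x n / sqrt n)) + 6 * r n + 6 * Z * (D * g n))"
      using remainder_bound[OF sp good x0 _ lam dd sparse(1)[OF n1] sparse(2)[OF n1] sm1 sm2 step1[OF n1 sp] step2[OF n1 sp] k j]
        quant(3)[OF E] unfolding Leq Zeq \<zeta>eq by blast
    also have "\<dots> \<le> (q * sqrt (ln (p n))) * \<zeta> * ((576 * Z * Ce * q + 6 * Z * D + 6) * (s n * g n + r n))"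
    proof (intro mult_mono)
      have "576 * Z * Ce * (s n * (x n / sqrt n)) \<le> 576 * Z * Ce * (s n * (q * g n))"
        using xg[OF E] Z0 Ce0 by (intro mult_left_mono) auto
      \<comment> \<open>s >= 1 allows the inflation term, of order g, to be absorbed into s
        g.\<close>
      moreover have "6 * Z * D * g n \<le> 6 * Z * D * (s n * g n)"
        using mult_right_mono[OF s1 gg] Z0 D0 by (intro mult_left_mono) auto
      moreover have "0 \<le> 576 * Z * Ce * q * r n" "0 \<le> 6 * Z * D * r n" "0 \<le> 6 * (s n * g n)"
        using Z0 Ce0 q0 D0 r0 gg by auto
      ultimately show "576 * Z / (1 / Ce) * (s n * (x n / sqrt n)) + 6 * r n + 6 * Z * (D * g n)
          \<le> (576 * Z * Ce * q + 6 * Z * D + 6) * (s n * g n + r n)"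
        by (simp add: algebra_simps)
      show "0 \<le> 576 * Z / (1 / Ce) * (s n * (x n / sqrt n)) + 6 * r n + 6 * Z * (D * g n)"
        using Z0 Ce0 x0 r0 dd by auto
    qed (use quant(2)[OF E] x0 \<zeta>0 q0 L0[OF n1] in auto)
    also have "\<dots> = K * (s n * (sqrt (ln (p n)) * g n) + r n * sqrt (ln (p n)))"
      by (simp add: K_def algebra_simps)
    also have "sqrt (ln (p n)) * g n = ln (p n) / sqrt n"
      using L0[OF n1] by (simp add: g_def real_sqrt_divide)
    finally show ?thesis by (simp add: p_def)
  qed

  have representation: "\<exists>R :: 'v \<Rightarrow> 'v option \<Rightarrow> real. \<forall>k\<in>agents_obs (N n).
          (\<forall>j\<in>Vbar (N n).
            sqrt n * (debiased n (N n) \<omega> (W_hat n \<omega>) (v_hat n \<omega>) (\<Psi>_hat n \<omega>) k j - stacked (v_obs (N n)) (H_inv (N n)) k j) =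
              - (\<Sum>m\<in>Vbar (N n). \<Psi>_hat n \<omega> j m *
                   ((1 / sqrt n) * (\<Sum>t=1..n. eps (N n) t k \<omega> * one_p (N n) t \<omega> m))) + R k j) \<and>
          (MAX j\<in>Vbar (N n). \<bar>R k j\<bar>)
            \<le> K * (s n * ln (card (agents_obs (N n))) / sqrt n + r n * sqrt (ln (card (agents_obs (N n)))))"
    if n1: "1 \<le> n" and \<omega>: "\<omega> \<in> A n" for n \<omega>
  proof -
    interpret regular_network "N n" n bM bA bL bP c C Ce "Me n" "Mp n" by (rule rn[OF n1])
    have sp: "\<omega> \<in> space (law (N n))" using \<omega> A_sets sets.sets_into_space by blast
    let ?R = "\<lambda>k j. sqrt n * (\<Sum>i\<in>Vbar (N n). Delta (v_hat n \<omega>) (W_hat n \<omega>) k i *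
        (of_bool (j = i) - (\<Sum>m\<in>Vbar (N n). \<Psi>_hat n \<omega> j m * sigma_hat n (N n) \<omega> m i)))"
    show ?thesis
    proof (intro exI[of _ ?R] ballI conjI)
      fix k assume k: "k \<in> agents_obs (N n)"
      show "sqrt n * (debiased n (N n) \<omega> (W_hat n \<omega>) (v_hat n \<omega>) (\<Psi>_hat n \<omega>) k j - stacked (v_obs (N n)) (H_inv (N n)) k j) =
              - (\<Sum>m\<in>Vbar (N n). \<Psi>_hat n \<omega> j m *
                   ((1 / sqrt n) * (\<Sum>t=1..n. eps (N n) t k \<omega> * one_p (N n) t \<omega> m))) + ?R k j"
        if "j \<in> Vbar (N n)" for j
        by (rule debias_identity[OF k that sp])
      show "(MAX j\<in>Vbar (N n). \<bar>?R k j\<bar>)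
            \<le> K * (s n * ln (card (agents_obs (N n))) / sqrt n + r n * sqrt (ln (card (agents_obs (N n)))))"
      proof (subst Max_le_iff)
        show "\<forall>a\<in>(\<lambda>j. \<bar>?R k j\<bar>) ` Vbar (N n). a
            \<le> K * (s n * ln (card (agents_obs (N n))) / sqrt n + r n * sqrt (ln (card (agents_obs (N n)))))"
          using remainder[OF \<omega> k] by blast
      qed (use finite_Vbar None_in_Vbar in auto)
    qed
  qed
  \<comment> \<open>Deterministic in \<open>W\<close>: the bound holds at every sample point at
    which the thresholds satisfy the assumption. The constant C2 = 3/2 C1 is the entrywise cost 3/2
    \<mu> at the largest admissible threshold.\<close>
  have threshold: "mat_norm_inf (agents_obs (N n)) (\<lambda>k j. thresholded \<mu> W k j - H_inv (N n) k j)
            \<le> real (s n) * (3/2 * C1) * sqrt (ln (card (agents_obs (N n))) / n) + 3 * r n"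
    "mat_norm_1 (agents_obs (N n)) (\<lambda>k j. thresholded \<mu> W k j - H_inv (N n) k j)
            \<le> real (s n) * (3/2 * C1) * sqrt (ln (card (agents_obs (N n))) / n) + 3 * r n"
    if n1: "1 \<le> n" and C1: "0 < C1"
      and \<mu>: "\<forall>k\<in>agents_obs (N n). \<forall>j\<in>agents_obs (N n). 2 * \<bar>W k j - H_inv (N n) k j\<bar> \<le> \<mu> k j \<and>
        \<mu> k j \<le> C1 * sqrt (ln (card (agents_obs (N n))) / n)" for n C1 W \<mu>
  proof -
    interpret regular_network "N n" n bM bA bL bP c C Ce "Me n" "Mp n" by (rule rn[OF n1])
    let ?m = "C1 * sqrt (ln (card (agents_obs (N n))) / n)"
    have m0: "0 \<le> ?m" using C1 L0[OF n1] by (simp add: p_def)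
    have \<mu>': "2 * \<bar>W k j - H_inv (N n) k j\<bar> \<le> \<mu> k j \<and> \<mu> k j \<le> ?m"
      if "k \<in> agents_obs (N n)" "j \<in> agents_obs (N n)" for k j
      using \<mu> that by blast
    note T = thresholded_error[where W = W and \<mu> = \<mu>, OF finite_obs obs_nonempty sparse(2)[OF n1] \<mu>' m0]
    have eq: "real (s n) * (3/2 * ?m) = real (s n) * (3/2 * C1) * sqrt (ln (card (agents_obs (N n))) / n)" by simp
    have le: "real (s n) * (3/2 * ?m) + r n \<le> real (s n) * (3/2 * C1) * sqrt (ln (card (agents_obs (N n))) / n) + 3 * r n"
      unfolding eq using T(3) by simp
    show "mat_norm_inf (agents_obs (N n)) (\<lambda>k j. thresholded \<mu> W k j - H_inv (N n) k j)
            \<le> real (s n) * (3/2 * C1) * sqrt (ln (card (agents_obs (N n))) / n) + 3 * r n"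
      using T(1) le by (rule order_trans)
    show "mat_norm_1 (agents_obs (N n)) (\<lambda>k j. thresholded \<mu> W k j - H_inv (N n) k j)
            \<le> real (s n) * (3/2 * C1) * sqrt (ln (card (agents_obs (N n))) / n) + 3 * r n"
      using T(2) le by (rule order_trans)
  qed
  \<comment> \<open>The witness for C2 stays schematic, and \<open>conjI[rotated]\<close> postpones
    its positivity until \<open>threshold\<close> has fixed it as 3/2 C1.\<close>
  show ?thesis
    unfolding Let_def
    by (rule exI[of _ K], rule conjI[OF K0], intro allI impI, rule exI, rule conjI[rotated], rule exI[of _ A],
        intro conjI allI A_sets A_lim, intro impI ballI conjI, rule representation, assumption, assumption,
        intro allI impI conjI, rule threshold(1), assumption, assumption, assumption,
        rule threshold(2), assumption, assumption, assumption, simp)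
qed

end
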